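(* Let $\alpha,\beta\ge-1/2$ and let $W_\ast^{(\alpha,\beta)}f(n)=\sup_{t>0}|W_t^{(\alpha,\beta)}f(n)|$. (a) If $1<p<\infty$ and $w\in A_p(\mathbb{N})$, then there is a constant $C>0$, independent of $f$, such that $$\|W_\ast^{(\alpha,\beta)}f\|_{\ell^p(\mathbb{N},w)}\le C\|f\|_{\ell^p(\mathbb{N},w)}\quad\text{for all } f\in\ell^p(\mathbb{N},w).$$ (b) If $w\in A_1(\mathbb{N})$, then there is a constant $C>0$, independent of $f$, such that $$\|W_\ast^{(\alpha,\beta)}f\|_{\ell^{1,\infty}(\mathbb{N},w)}\le C\|f\|_{\ell^1(\mathbb{N},w)}\quad\text{for all } f\in\ell^1(\mathbb{N},w).$$
   Context: Here $\mathbb{N}=\{0,1,2,\dots\}$. Let $P_n^{(\alpha,\beta)}$ be the Jacobi polynomials, defined by $(1-x)^\alpha(1+x)^\beta P_n^{(\alpha,\beta)}(x)=\frac{(-1)^n}{2^nn!}\frac{d^n}{dx^n}\big((1-x)^{\alpha+n}(1+x)^{\beta+n}\big)$, let $d\mu_{\alpha,\beta}(x)=(1-x)^\alpha(1+x)^\beta dx$ on $[-1,1]$, and let $p_n^{(\alpha,\beta)}=P_n^{(\alpha,\beta)}/\|P_n^{(\alpha,\beta)}\|_{L^2([-1,1],d\mu_{\alpha,\beta})}$. For $t\ge0$, $$K_t^{(\alpha,\beta)}(m,n)=\int_{-1}^1e^{-(1-x)t}p_m^{(\alpha,\beta)}(x)p_n^{(\alpha,\beta)}(x)\,d\mu_{\alpha,\beta}(x),\qquad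 W_t^{(\alpha,\beta)}f(n)=\sum_{m=0}^\infty f(m)K_t^{(\alpha,\beta)}(m,n).$$ A weight is a strictly positive sequence $w=\{w(n)\}_{n\ge0}$. The space $\ell^p(\mathbb{N},w)$, $1\le p<\infty$, has norm $\|f\|_{\ell^p(\mathbb{N},w)}=\big(\sum_{m\ge0}|f(m)|^pw(m)\big)^{1/p}$, and $\|f\|_{\ell^{1,\infty}(\mathbb{N},w)}=\sup_{t>0}t\sum_{\{m\in\mathbb{N}:|f(m)|>t\}}w(m)$. For $1<p<\infty$, $w\in A_p(\mathbb{N})$ means $$\sup_{0\le n\le m}\frac{1}{(m-n+1)^p}\Big(\sum_{k=n}^mw(k)\Big)\Big(\sum_{k=n}^mw(k)^{-1/(p-1)}\Big)^{p-1}<\infty,$$ and $w\in A_1(\mathbb{N})$ means $$\sup_{0\le n\le m}\frac{1}{m-n+1}\Big(\sum_{k=n}^mw(k)\Big)\max_{n\le k\le m}w(k)^{-1}<\infty,$$ the suprema being over integers $n,m$. *)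

theory Defs
  imports "HOL-Analysis.Analysis" "HOL-Computational_Algebra.Polynomial"
begin

(* Rodrigues' formula is imposed on the open interval, where both weight factors are positive and
   the iterated derivative exists; this determines the polynomial (see jacobi_poly_ex1). *)
definition is_jacobi_poly :: "real \<Rightarrow> real \<Rightarrow> nat \<Rightarrow> real poly \<Rightarrow> bool" where
  "is_jacobi_poly \<alpha> \<beta> n P \<longleftrightarrow>
     (\<forall>x\<in>{-1<..<1}. (1 - x) powr \<alpha> * (1 + x) powr \<beta> * poly P x =
        (-1) ^ n / (2 ^ n * fact n) *
        (deriv ^^ n) (\<lambda>y. (1 - y) powr (\<alpha> + real n) * (1 + y) powr (\<beta> + real n)) x)"

definition jacobi_poly :: "real \<Rightarrow> real \<Rightarrow> nat \<Rightarrow> real poly" where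
  "jacobi_poly \<alpha> \<beta> n = (THE P. is_jacobi_poly \<alpha> \<beta> n P)"

lemma iterated_deriv_jacobi_weight:
  "\<exists>q :: real poly. \<forall>x\<in>{-1<..<1}.
     (deriv ^^ k) (\<lambda>y. (1 - y) powr a * (1 + y) powr b) x =
       (1 - x) powr (a - real k) * (1 + x) powr (b - real k) * poly q x"
proof (induction k)
  case 0
  show ?case by (rule exI[of _ 1]) simp
next
  case (Suc k)
  let ?f = "\<lambda>y::real. (1 - y) powr a * (1 + y) powr b"
  let ?c = "a - real k" and ?d = "b - real k"
  from Suc obtain q :: "real poly" where q: "\<And>x. x \<in> {-1<..<1} \<Longrightarrow>
     (deriv ^^ k) ?f x = (1 - x) powr ?c * (1 + x) powr ?d * poly q x" by blast
  define r where "r = smult (- ?c) ([:1, 1:] * q) + smult ?d ([:1, -1:] * q)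
                        + [:1, -1:] * [:1, 1:] * pderiv q"
  have "(deriv ^^ Suc k) ?f x =
      (1 - x) powr (a - real (Suc k)) * (1 + x) powr (b - real (Suc k)) * poly r x"
    if x: "x \<in> {-1<..<1}" for x
  proof -
    have pos: "1 - x > 0" "1 + x > 0" using x by auto
    let ?g = "\<lambda>x. (1 - x) powr ?c * (1 + x) powr ?d * poly q x"
    let ?u = "(1 - x) powr (?c - 1)" and ?v = "(1 + x) powr (?d - 1)"
    have c: "(1 - x) powr ?c = (1 - x) * ?u" and d: "(1 + x) powr ?d = (1 + x) * ?v"
      using pos by (simp_all add: powr_diff)
    have "((\<lambda>x. (1 - x) powr ?c) has_real_derivative ?c * ?u * (-1)) (at x)"
      by (rule DERIV_chain2[OF has_real_derivative_powr])
         (use pos in \<open>auto intro!: derivative_eq_intros\<close>)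
    moreover have "((\<lambda>x. (1 + x) powr ?d) has_real_derivative ?d * ?v * 1) (at x)"
      by (rule DERIV_chain2[OF has_real_derivative_powr])
         (use pos in \<open>auto intro!: derivative_eq_intros\<close>)
    ultimately have "(?g has_real_derivative
        ((?c * ?u * (-1)) * (1 + x) powr ?d + (?d * ?v * 1) * (1 - x) powr ?c) * poly q x
          + poly (pderiv q) x * ((1 - x) powr ?c * (1 + x) powr ?d)) (at x)"
      by (intro DERIV_mult poly_DERIV)
    moreover have "((?c * ?u * (-1)) * (1 + x) powr ?d + (?d * ?v * 1) * (1 - x) powr ?c) * poly q x
          + poly (pderiv q) x * ((1 - x) powr ?c * (1 + x) powr ?d) = ?u * ?v * poly r x"
      unfolding c d r_def by (simp add: algebra_simps)
    ultimately have "(?g has_real_derivative ?u * ?v * poly r x) (at x)" by simp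
    then have "((deriv ^^ k) ?f has_real_derivative ?u * ?v * poly r x) (at x)"
      by (rule has_field_derivative_transform_within_open[where S = "{-1<..<1}"])
         (use x q in auto)
    then show ?thesis by (simp add: DERIV_imp_deriv diff_diff_eq add.commute)
  qed
  then show ?case by (intro exI[of _ r] ballI)
qed

lemma jacobi_poly_ex1: "\<exists>!P. is_jacobi_poly \<alpha> \<beta> n P"
proof -
  obtain q :: "real poly" where q: "\<And>x. x \<in> {-1<..<1} \<Longrightarrow>
     (deriv ^^ n) (\<lambda>y. (1 - y) powr (\<alpha> + real n) * (1 + y) powr (\<beta> + real n)) x =
       (1 - x) powr \<alpha> * (1 + x) powr \<beta> * poly q x"
    using iterated_deriv_jacobi_weight[of n "\<alpha> + real n" "\<beta> + real n"]
    unfolding add_diff_cancel_right' by blast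
  show ?thesis
  proof (rule ex1I)
    show "is_jacobi_poly \<alpha> \<beta> n (smult ((-1) ^ n / (2 ^ n * fact n)) q)"
      using q by (auto simp: is_jacobi_poly_def)
  next
    fix P assume P: "is_jacobi_poly \<alpha> \<beta> n P"
    have "poly P x = poly (smult ((-1) ^ n / (2 ^ n * fact n)) q) x" if "x \<in> {-1<..<1}" for x
    proof -
      have "(1 - x) powr \<alpha> * (1 + x) powr \<beta> \<noteq> 0" using that by auto
      moreover have "(1 - x) powr \<alpha> * (1 + x) powr \<beta> * poly P x =
          (1 - x) powr \<alpha> * (1 + x) powr \<beta> * poly (smult ((-1) ^ n / (2 ^ n * fact n)) q) x"
        using P that q by (auto simp: is_jacobi_poly_def)
      ultimately show ?thesis by (rule mult_left_cancel[THEN iffD1])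
    qed
    then have "{-1<..<1} \<subseteq> {x. poly (P - smult ((-1) ^ n / (2 ^ n * fact n)) q) x = 0}" by auto
    moreover have "infinite {-1<..<1::real}" by (rule infinite_Ioo) simp
    ultimately have "infinite {x. poly (P - smult ((-1) ^ n / (2 ^ n * fact n)) q) x = 0}"
      by (rule infinite_super)
    then have "P - smult ((-1) ^ n / (2 ^ n * fact n)) q = 0"
      by (metis poly_roots_finite)
    then show "P = smult ((-1) ^ n / (2 ^ n * fact n)) q"
      by (rule eq_iff_diff_eq_0[THEN iffD2])
  qed
qed

definition jacobi_measure :: "real \<Rightarrow> real \<Rightarrow> real measure" where
  "jacobi_measure \<alpha> \<beta> =
     density (restrict_space lborel {-1..1}) (\<lambda>x. ennreal ((1 - x) powr \<alpha> * (1 + x) powr \<beta>))"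

definition jacobi_norm :: "real \<Rightarrow> real \<Rightarrow> nat \<Rightarrow> real" where
  "jacobi_norm \<alpha> \<beta> n = sqrt (\<integral>x. (poly (jacobi_poly \<alpha> \<beta> n) x)\<^sup>2 \<partial>jacobi_measure \<alpha> \<beta>)"

definition jacobi_normalized :: "real \<Rightarrow> real \<Rightarrow> nat \<Rightarrow> real \<Rightarrow> real" where
  "jacobi_normalized \<alpha> \<beta> n x = poly (jacobi_poly \<alpha> \<beta> n) x / jacobi_norm \<alpha> \<beta> n"

definition heat_kernel :: "real \<Rightarrow> real \<Rightarrow> real \<Rightarrow> nat \<Rightarrow> nat \<Rightarrow> real" where
  "heat_kernel \<alpha> \<beta> t m n =
     (\<integral>x. exp (- ((1 - x) * t)) * jacobi_normalized \<alpha> \<beta> m x * jacobi_normalized \<alpha> \<beta> n x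
        \<partial>jacobi_measure \<alpha> \<beta>)"

definition heat_op :: "real \<Rightarrow> real \<Rightarrow> real \<Rightarrow> (nat \<Rightarrow> complex) \<Rightarrow> nat \<Rightarrow> complex" where
  "heat_op \<alpha> \<beta> t f n = (\<Sum>m. f m * complex_of_real (heat_kernel \<alpha> \<beta> t m n))"

(* The supremum is taken in [0, \<infinity>], so it always exists. *)
definition heat_maximal :: "real \<Rightarrow> real \<Rightarrow> (nat \<Rightarrow> complex) \<Rightarrow> nat \<Rightarrow> ennreal" where
  "heat_maximal \<alpha> \<beta> f n = (SUP t\<in>{0<..}. ennreal (norm (heat_op \<alpha> \<beta> t f n)))"

(* Only used for exponents p > 0. *)
definition ennreal_powr :: "ennreal \<Rightarrow> real \<Rightarrow> ennreal" where
  "ennreal_powr x p = (if x = \<infinity> then \<infinity> else ennreal (enn2real x powr p))"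

definition is_weight :: "(nat \<Rightarrow> real) \<Rightarrow> bool" where
  "is_weight w \<longleftrightarrow> (\<forall>n. 0 < w n)"

(* The (weak) norms are [0, \<infinity>]-valued functionals of the modulus sequence g = |f|. *)
definition lp_norm :: "real \<Rightarrow> (nat \<Rightarrow> real) \<Rightarrow> (nat \<Rightarrow> ennreal) \<Rightarrow> ennreal" where
  "lp_norm p w g = ennreal_powr (\<Sum>m. ennreal_powr (g m) p * ennreal (w m)) (1 / p)"

definition weak_l1_norm :: "(nat \<Rightarrow> real) \<Rightarrow> (nat \<Rightarrow> ennreal) \<Rightarrow> ennreal" where
  "weak_l1_norm w g =
     (SUP t\<in>{0<..}. ennreal t * (\<Sum>m. if g m > ennreal t then ennreal (w m) else 0))"

definition lp_space :: "real \<Rightarrow> (nat \<Rightarrow> real) \<Rightarrow> (nat \<Rightarrow> complex) set" where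
  "lp_space p w = {f. lp_norm p w (\<lambda>m. ennreal (norm (f m))) < \<infinity>}"

definition Ap_class :: "real \<Rightarrow> (nat \<Rightarrow> real) set" where
  "Ap_class p = {w. is_weight w \<and>
     bdd_above {1 / (real m - real n + 1) powr p * (\<Sum>k=n..m. w k) *
                (\<Sum>k=n..m. w k powr (- 1 / (p - 1))) powr (p - 1) | n m. n \<le> m}}"

definition A1_class :: "(nat \<Rightarrow> real) set" where
  "A1_class = {w. is_weight w \<and>
     bdd_above {1 / (real m - real n + 1) * (\<Sum>k=n..m. w k) *
                Max ((\<lambda>k. inverse (w k)) ` {n..m}) | n m. n \<le> m}}"

end

theory Submission
  imports Defs
begin

text \<open>
  The maximal operator is controlled pointwise by the Hardy-Littlewood maximal function, because for every
  \<open>t > 0\<close> the kernel satisfies \<open>\<bar>K\<^sub>t(m,n)\<bar> \<le> D (1 - \<rho>) \<rho> ^ \<bar>m - n\<bar>\<close> with some \<open>\<rho> < 1\<close> depending on \<open>t\<close>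
  and a constant \<open>D\<close> that does not (\<open>heat_kernel_geometric_bound\<close>). Summation by parts turns a geometric
  average of \<open>\<bar>f\<bar>\<close> into averages over intervals (\<open>geometric_sum_le_hl_max\<close>), and so both claims become
  weighted inequalities for the maximal function on intervals of natural numbers.

  Those are Muckenhoupt's theorem. For an arbitrary weight \<open>v\<close>, the maximal function of averages with
  respect to \<open>v\<close> is of weak type (1,1) and of strong type (p,p) for the weight \<open>v\<close> itself, with constants
  that do not depend on \<open>v\<close>. Lerner's argument bounds the maximal function \<open>M g\<close> by composing two such
  operators, one for \<open>w\<close> and one for the dual weight \<open>\<sigma> = w powr (- 1 / (p - 1))\<close>; the \<open>A\<^sub>p\<close> condition is
  exactly what is needed (\<open>hl_max_powr_le_weighted_max\<close>). For \<open>A\<^sub>1\<close> one operator is enough.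

  For the kernel bound, note that the normalized polynomials satisfy
  \<open>x p\<^sub>n = a\<^sub>n p\<^sub>n\<^sub>+\<^sub>1 + b\<^sub>n p\<^sub>n + a\<^sub>n\<^sub>-\<^sub>1 p\<^sub>n\<^sub>-\<^sub>1\<close>, hence \<open>K\<^sub>t = exp (- t (1 - J))\<close> for a tridiagonal matrix \<open>J\<close>,
  and \<open>h(n) = p\<^sub>n(1) > 0\<close> solves \<open>J h = h\<close>. Conjugation by \<open>h\<close> turns \<open>J - 1\<close> into the generator of a
  birth-death chain. For \<open>\<alpha>, \<beta> \<ge> -1/2\<close> the function \<open>h\<close> is increasing up to a constant factor and the drift
  of the chain at \<open>n\<close> is at most a constant times \<open>1 / (n + 1)\<close>. Three steps follow.

  \<^item> An exponential supersolution of the chain gives \<open>\<Sum>\<^sub>j\<^sub>\<ge>\<^sub>m K\<^sub>t(k,j) \<le> C exp (- (m - k) / sqrt t)\<close> for \<open>m \<ge> k\<close>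
    and \<open>t \<ge> 1\<close> (\<open>K_upper_tail\<close>).
  \<^item> The one-dimensional Sobolev inequality \<open>u(m)\<^sup>2 \<le> C (\<Sum>\<^sub>j\<^sub>\<ge>\<^sub>m u(j)\<^sup>2)\<^sup>1\<^sup>/\<^sup>2 E(u)\<^sup>1\<^sup>/\<^sup>2\<close>, with the energy \<open>E(u)\<close> of
    \<open>1 - J\<close>, holds because \<open>h\<close> is increasing up to a constant (\<open>sup_norm_interpolation\<close>). For \<open>u = K\<^sub>t(k,\<cdot>)\<close>
    the energy is at most \<open>C K\<^sub>t(k,k) / t\<close>, and \<open>K\<^sub>t(k,k) \<le> C / sqrt t\<close> drops out (\<open>K_diagonal\<close>).
  \<^item> The same inequality, now with the exponentially small tail in place of the full \<open>\<ell>\<^sup>2\<close> norm, gives the decay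
    away from the diagonal (\<open>K_off_diagonal\<close>); the case \<open>m < k\<close> is the symmetry of the kernel.

  The facts about \<open>h\<close> and the drift are read off from the explicit recurrence coefficients, which are
  determined by the values of the Jacobi polynomials at \<open>1\<close> and \<open>-1\<close> and their leading coefficients. Rodrigues'
  formula provides these, and orthogonality.
\<close>

section \<open>The interval maximal function with a weight\<close>

text \<open>
  Greedy covering from the left: starting at the first point of \<open>E\<close>, remove its interval and continue behind
  it. The intervals chosen are disjoint, so their masses can be added without loss.
\<close>
lemma forward_interval_cover:
  fixes u v :: "nat \<Rightarrow> real"
  assumes u: "\<And>i. 0 \<le> u i" and v: "\<And>i. 0 \<le> v i" and l: "0 \<le> l"
    and E: "\<And>n. n \<in> E \<Longrightarrow> \<exists>b\<ge>n. b \<le> N \<and> l * sum v {n..b} \<le> sum u {n..b}"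
  shows "l * sum v (E \<inter> {k..N}) \<le> sum u {k..N}"
proof (induction "Suc N - k" arbitrary: k rule: less_induct)
  case less
  show ?case
  proof (cases "k \<le> N")
    case False
    then show ?thesis by simp
  next
    case True
    show ?thesis
    proof (cases "k \<in> E")
      case False
      then have "E \<inter> {k..N} = E \<inter> {Suc k..N}"
        using Suc_le_eq le_neq_implies_less by fastforce
      then have "l * sum v (E \<inter> {k..N}) \<le> sum u {Suc k..N}"
        using less[of "Suc k"] True by simp
      also have "\<dots> \<le> sum u {k..N}" by (rule sum_mono2) (use u in auto)
      finally show ?thesis .
    next
      case k: True
      then obtain b where b: "b \<ge> k" "b \<le> N" "l * sum v {k..b} \<le> sum u {k..b}"
        using E by blast
      have "sum v (E \<inter> {k..N}) \<le> sum v ({k..b} \<union> (E \<inter> {Suc b..N}))"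
        by (rule sum_mono2) (use v in auto)
      also have "\<dots> = sum v {k..b} + sum v (E \<inter> {Suc b..N})"
        by (rule sum.union_disjoint) auto
      finally have "l * sum v (E \<inter> {k..N}) \<le> l * sum v {k..b} + l * sum v (E \<inter> {Suc b..N})"
        using mult_left_mono[OF _ l] by (metis distrib_left)
      also have "\<dots> \<le> sum u {k..b} + sum u {Suc b..N}"
        using b less[of "Suc b"] by (intro add_mono) auto
      also have "\<dots> = sum u ({k..b} \<union> {Suc b..N})"
        by (rule sum.union_disjoint[symmetric]) auto
      also have "{k..b} \<union> {Suc b..N} = {k..N}" using b by auto
      finally show ?thesis .
    qed
  qed
qed

lemma backward_interval_cover:
  fixes u v :: "nat \<Rightarrow> real"
  assumes u: "\<And>i. 0 \<le> u i" and v: "\<And>i. 0 \<le> v i" and l: "0 \<le> l"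
    and E: "\<And>n. n \<in> E \<Longrightarrow> \<exists>a\<le>n. l * sum v {a..n} \<le> sum u {a..n}"
  shows "l * sum v (E \<inter> {..<k}) \<le> sum u {..<k}"
proof (induction k rule: less_induct)
  case (less k)
  show ?case
  proof (cases k)
    case 0
    then show ?thesis by simp
  next
    case (Suc n)
    show ?thesis
    proof (cases "n \<in> E")
      case False
      then have "E \<inter> {..<k} = E \<inter> {..<n}" using Suc less_Suc_eq by auto
      then have "l * sum v (E \<inter> {..<k}) \<le> sum u {..<n}"
        using less[of n] Suc by simp
      also have "\<dots> \<le> sum u {..<k}" by (rule sum_mono2) (use u Suc in auto)
      finally show ?thesis .
    next
      case n: True
      then obtain a where a: "a \<le> n" "l * sum v {a..n} \<le> sum u {a..n}"
        using E by blast
      have "sum v (E \<inter> {..<k}) \<le> sum v ((E \<inter> {..<a}) \<union> {a..n})"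
        by (rule sum_mono2) (use v Suc in auto)
      also have "\<dots> = sum v (E \<inter> {..<a}) + sum v {a..n}"
        by (rule sum.union_disjoint) auto
      finally have "l * sum v (E \<inter> {..<k}) \<le> l * sum v (E \<inter> {..<a}) + l * sum v {a..n}"
        using mult_left_mono[OF _ l] by (metis distrib_left)
      also have "\<dots> \<le> sum u {..<a} + sum u {a..n}"
        using a less[of a] Suc by (intro add_mono) auto
      also have "\<dots> = sum u ({..<a} \<union> {a..n})"
        by (rule sum.union_disjoint[symmetric]) auto
      also have "{..<a} \<union> {a..n} = {..<k}" using a Suc by auto
      finally show ?thesis .
    qed
  qed
qed

definition interval_avg :: "(nat \<Rightarrow> real) \<Rightarrow> (nat \<Rightarrow> real) \<Rightarrow> nat \<Rightarrow> nat \<Rightarrow> real" where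
  "interval_avg v g a b = (\<Sum>i=a..b. g i * v i) / (\<Sum>i=a..b. v i)"

text \<open>
  Only intervals inside \<open>{0..N}\<close> compete, which keeps all sums and maxima finite; the estimates are uniform
  in \<open>N\<close>. For \<open>n > N\<close> there is no such interval and the value is meaningless.
\<close>
definition interval_max :: "nat \<Rightarrow> (nat \<Rightarrow> real) \<Rightarrow> (nat \<Rightarrow> real) \<Rightarrow> nat \<Rightarrow> real" where
  "interval_max N v g n = Max ((\<lambda>(a, b). interval_avg v g a b) ` {(a, b). a \<le> n \<and> n \<le> b \<and> b \<le> N})"

lemma finite_intervals_through: "finite {(a, b). a \<le> n \<and> n \<le> b \<and> b \<le> (N::nat)}"
  by (rule finite_subset[of _ "{..n} \<times> {..N}"]) auto

lemma interval_avg_le_max: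
  "a \<le> n \<Longrightarrow> n \<le> b \<Longrightarrow> b \<le> N \<Longrightarrow> interval_avg v g a b \<le> interval_max N v g n"
  unfolding interval_max_def
  by (rule Max_ge) (use finite_intervals_through in \<open>auto intro!: image_eqI[where x = "(a, b)"]\<close>)

lemma interval_max_attained:
  assumes "n \<le> N"
  obtains a b where "a \<le> n" "n \<le> b" "b \<le> N" "interval_max N v g n = interval_avg v g a b"
proof -
  have "interval_max N v g n \<in> (\<lambda>(a, b). interval_avg v g a b) ` {(a, b). a \<le> n \<and> n \<le> b \<and> b \<le> N}"
    unfolding interval_max_def by (rule Max_in) (use finite_intervals_through assms in auto)
  then show ?thesis using that by auto
qed

lemma interval_max_leI:
  assumes "n \<le> N" "\<And>a b. a \<le> n \<Longrightarrow> n \<le> b \<Longrightarrow> b \<le> N \<Longrightarrow> interval_avg v g a b \<le> c"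
  shows "interval_max N v g n \<le> c"
  using assms by (metis interval_max_attained)

lemma interval_max_nonneg:
  assumes "n \<le> N" "\<And>i. 0 \<le> g i" "\<And>i. 0 \<le> v i"
  shows "0 \<le> interval_max N v g n"
proof -
  have "0 \<le> interval_avg v g n n"
    unfolding interval_avg_def using assms by (intro divide_nonneg_nonneg sum_nonneg) auto
  also have "\<dots> \<le> interval_max N v g n" by (rule interval_avg_le_max) (use assms in auto)
  finally show ?thesis .
qed

lemma interval_max_mono:
  assumes "n \<le> N" "N \<le> N'"
  shows "interval_max N v g n \<le> interval_max N' v g n"
  using assms by (intro interval_max_leI interval_avg_le_max) auto

lemma sum_weight_pos:
  fixes v :: "nat \<Rightarrow> real"
  assumes "\<And>i. 0 < v i" "a \<le> b"
  shows "0 < sum v {a..b}"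
  using assms by (intro sum_pos) auto

text \<open>
  If the average over an interval through \<open>n\<close> is at least \<open>l\<close>, then one of its two halves at \<open>n\<close> has average at
  least \<open>l / 2\<close>. This reduces the two-sided maximal function to the one-sided ones, where the greedy
  coverings apply to every weight with the same constant.
\<close>
lemma interval_max_weak_type:
  fixes g v :: "nat \<Rightarrow> real"
  assumes g: "\<And>i. 0 \<le> g i" and v: "\<And>i. 0 < v i" and l: "0 < l"
  shows "l * sum v {n. n \<le> N \<and> l \<le> interval_max N v g n} \<le> 4 * (\<Sum>n\<le>N. g n * v n)"
proof -
  define u where "u = (\<lambda>i. g i * v i)"
  have v0: "0 \<le> v i" for i using v by (rule less_imp_le)
  then have u: "0 \<le> u i" for i using g by (simp add: u_def)
  define E1 where "E1 = {n. \<exists>b\<ge>n. b \<le> N \<and> l / 2 * sum v {n..b} \<le> sum u {n..b}}"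
  define E2 where "E2 = {n. \<exists>a\<le>n. l / 2 * sum v {a..n} \<le> sum u {a..n}}"
  have sub: "{n. n \<le> N \<and> l \<le> interval_max N v g n} \<subseteq> (E1 \<inter> {0..N}) \<union> (E2 \<inter> {..<Suc N})"
  proof
    fix n assume "n \<in> {n. n \<le> N \<and> l \<le> interval_max N v g n}"
    then have n: "n \<le> N" "l \<le> interval_max N v g n" by auto
    then obtain a b where ab: "a \<le> n" "n \<le> b" "b \<le> N" "l \<le> interval_avg v g a b"
      by (metis interval_max_attained)
    have pos: "0 < sum v {a..b}" using v ab by (intro sum_weight_pos) auto
    have ge: "l * sum v {a..b} \<le> sum u {a..b}"
      using ab(4) pos by (simp add: interval_avg_def u_def field_simps)
    have split: "sum f {a..b} = sum f {a..n} + sum f {n..b} - f n" for f :: "nat \<Rightarrow> real"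
    proof -
      have "{a..b} = {a..n} \<union> {n..b}" "{a..n} \<inter> {n..b} = {n}" using ab by auto
      then show ?thesis by (simp add: sum_Un)
    qed
    have le: "v n \<le> sum v {a..n}" "v n \<le> sum v {n..b}"
      using ab v0 by (auto intro!: member_le_sum)
    have "l / 2 * sum v {a..n} \<le> sum u {a..n} \<or> l / 2 * sum v {n..b} \<le> sum u {n..b}"
    proof (rule ccontr)
      assume "\<not> ?thesis"
      then have "sum u {a..b} < l / 2 * (sum v {a..n} + sum v {n..b})"
        using split[of u] u[of n] by (simp add: field_simps)
      also have "\<dots> \<le> l / 2 * (2 * sum v {a..b})"
        using split[of v] le l by (intro mult_left_mono) auto
      finally show False using ge by simp
    qed
    then show "n \<in> (E1 \<inter> {0..N}) \<union> (E2 \<inter> {..<Suc N})"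
      using ab n unfolding E1_def E2_def by auto
  qed
  have "sum v {n. n \<le> N \<and> l \<le> interval_max N v g n} \<le> sum v ((E1 \<inter> {0..N}) \<union> (E2 \<inter> {..<Suc N}))"
    by (rule sum_mono2) (use sub v0 in auto)
  also have "\<dots> \<le> sum v (E1 \<inter> {0..N}) + sum v (E2 \<inter> {..<Suc N})"
    using v0 by (subst sum_Un) (auto intro!: sum_nonneg)
  finally have "l / 2 * sum v {n. n \<le> N \<and> l \<le> interval_max N v g n}
      \<le> l / 2 * sum v (E1 \<inter> {0..N}) + l / 2 * sum v (E2 \<inter> {..<Suc N})"
    unfolding distrib_left[symmetric] by (rule mult_left_mono) (use l in simp)
  also have "\<dots> \<le> sum u {0..N} + sum u {..<Suc N}"
    using u v0 l
    by (intro add_mono forward_interval_cover backward_interval_cover) (auto simp: E1_def E2_def)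
  also have "\<dots> = 2 * (\<Sum>n\<le>N. u n)"
    by (simp add: atLeast0AtMost lessThan_Suc_atMost)
  finally show ?thesis by (simp add: u_def)
qed

lemma has_integral_powr_cutoff:
  fixes c L a :: real
  assumes "a > -1" "0 \<le> c" "c \<le> L"
  shows "((\<lambda>l. if l \<le> c then l powr a else 0) has_integral c powr (a + 1) / (a + 1)) {0..L}"
proof -
  have "((\<lambda>l. if l \<in> {0..c} then l powr a else 0) has_integral c powr (a + 1) / (a + 1)) {0..L}"
    by (subst has_integral_restrict) (use assms has_integral_powr_from_0 in auto)
  then show ?thesis
    by (rule has_integral_eq[rotated]) auto
qed

text \<open>
  Marcinkiewicz interpolation between weak type (1,1) and the trivial bound at infinity: multiply the
  hypothesis by \<open>p * l powr (p - 2)\<close> and integrate in \<open>l\<close>.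
\<close>
lemma strong_type_from_truncated_weak_type:
  fixes G g v :: "nat \<Rightarrow> real" and p B :: real
  assumes S: "finite S" and p: "p > 1"
    and G: "\<And>n. n \<in> S \<Longrightarrow> 0 \<le> G n" and g: "\<And>n. 0 \<le> g n"
    and weak: "\<And>l. l > 0 \<Longrightarrow>
      l * (\<Sum>n\<in>S. if l \<le> G n then v n else 0) \<le> B * (\<Sum>n\<in>S. if l \<le> 2 * g n then g n * v n else 0)"
  shows "(\<Sum>n\<in>S. G n powr p * v n) \<le> B * 2 powr (p - 1) * (p / (p - 1)) * (\<Sum>n\<in>S. g n powr p * v n)"
proof -
  \<comment> \<open>All level sets are empty above \<open>L\<close>, so that integrals over \<open>{0..L}\<close> suffice.\<close>
  define L where "L = (\<Sum>n\<in>S. G n + 2 * g n)"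
  have L: "G n \<le> L" "2 * g n \<le> L" if "n \<in> S" for n
  proof -
    have "G n + 2 * g n \<le> L"
      unfolding L_def by (rule member_le_sum) (use that S G g in auto)
    then show "G n \<le> L" "2 * g n \<le> L" using G[OF that] g[of n] by auto
  qed
  define \<phi> where "\<phi> = (\<lambda>l. \<Sum>n\<in>S. p * v n * (if l \<le> G n then l powr (p - 1) else 0))"
  define \<psi> where "\<psi> = (\<lambda>l. \<Sum>n\<in>S. B * p * g n * v n * (if l \<le> 2 * g n then l powr (p - 2) else 0))"
  have \<phi>: "(\<phi> has_integral (\<Sum>n\<in>S. p * v n * (G n powr (p - 1 + 1) / (p - 1 + 1)))) {0..L}"
    unfolding \<phi>_def using S p G L
    by (intro has_integral_sum has_integral_mult_right has_integral_powr_cutoff) auto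
  have \<psi>: "(\<psi> has_integral (\<Sum>n\<in>S. B * p * g n * v n * ((2 * g n) powr (p - 2 + 1) / (p - 2 + 1)))) {0..L}"
    unfolding \<psi>_def using S p g L
    by (intro has_integral_sum has_integral_mult_right has_integral_powr_cutoff) auto
  have "\<phi> l \<le> \<psi> l" if "l \<in> {0..L}" for l
  proof (cases "l = 0")
    case True
    have "(if P then (0::real) powr q else 0) = 0" for P q by simp
    with True show ?thesis by (simp add: \<phi>_def \<psi>_def)
  next
    case False
    then have l: "l > 0" using that by auto
    have "l powr (p - 1) = l powr (p - 2) * l"
      using l powr_add[of l "p - 2" 1] by simp
    then have "\<phi> l = p * l powr (p - 2) * (l * (\<Sum>n\<in>S. if l \<le> G n then v n else 0))"
      unfolding \<phi>_def sum_distrib_left by (intro sum.cong) (auto simp: algebra_simps)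
    also have "\<dots> \<le> p * l powr (p - 2) * (B * (\<Sum>n\<in>S. if l \<le> 2 * g n then g n * v n else 0))"
      using weak[OF l] p by (intro mult_left_mono) auto
    also have "\<dots> = \<psi> l"
      unfolding \<psi>_def sum_distrib_left by (intro sum.cong) (auto simp: algebra_simps)
    finally show ?thesis .
  qed
  with \<phi> \<psi> have "(\<Sum>n\<in>S. p * v n * (G n powr (p - 1 + 1) / (p - 1 + 1)))
      \<le> (\<Sum>n\<in>S. B * p * g n * v n * ((2 * g n) powr (p - 2 + 1) / (p - 2 + 1)))"
    by (rule has_integral_le)
  also have "\<dots> = B * 2 powr (p - 1) * (p / (p - 1)) * (\<Sum>n\<in>S. g n powr p * v n)"
  proof -
    have "g n * (2 * g n) powr (p - 1) = 2 powr (p - 1) * g n powr p" for n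
    proof (cases "g n = 0")
      case False
      then have "g n > 0" using g[of n] by simp
      then have "g n powr p = g n powr (p - 1) * g n" using powr_add[of "g n" "p - 1" 1] by simp
      then show ?thesis by (simp add: powr_mult)
    qed (use p in simp)
    then have eq: "B * p * v n * (g n * (2 * g n) powr (p - 1)) / (p - 1)
        = B * p * v n * (2 powr (p - 1) * g n powr p) / (p - 1)" for n
      by simp
    have e: "p - 2 + 1 = p - 1" by simp
    show ?thesis unfolding sum_distrib_left e
    proof (rule sum.cong[OF refl])
      fix n
      show "B * p * g n * v n * ((2 * g n) powr (p - 1) / (p - 1))
          = B * 2 powr (p - 1) * (p / (p - 1)) * (g n powr p * v n)"
        using eq[of n] by (simp only: mult_ac times_divide_eq_right times_divide_eq_left)
    qed
  qed
  finally show ?thesis using p by (simp add: field_simps)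
qed

text \<open>
  Values of \<open>g\<close> below \<open>l / 2\<close> contribute at most \<open>l / 2\<close> to any average.
\<close>
lemma interval_max_truncate:
  fixes g v :: "nat \<Rightarrow> real"
  assumes v: "\<And>i. 0 < v i" and g: "\<And>i. 0 \<le> g i" and n: "n \<le> N" and l: "0 < l"
  shows "interval_max N v g n \<le> interval_max N v (\<lambda>i. if l \<le> 2 * g i then g i else 0) n + l / 2"
proof (rule interval_max_leI[OF n])
  fix a b assume ab: "a \<le> n" "n \<le> b" "b \<le> N"
  let ?g = "\<lambda>i. if l \<le> 2 * g i then g i else 0"
  have pos: "0 < sum v {a..b}" using v ab by (intro sum_weight_pos) auto
  have "(\<Sum>i=a..b. g i * v i) \<le> (\<Sum>i=a..b. ?g i * v i + l / 2 * v i)"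
  proof (rule sum_mono)
    fix i
    show "g i * v i \<le> ?g i * v i + l / 2 * v i"
      using v[of i] g[of i] l by (auto simp: distrib_right[symmetric] intro!: mult_right_mono)
  qed
  also have "\<dots> = (\<Sum>i=a..b. ?g i * v i) + l / 2 * sum v {a..b}"
    by (simp only: sum.distrib sum_distrib_left)
  finally have "interval_avg v g a b \<le> interval_avg v ?g a b + l / 2"
    using pos by (simp add: interval_avg_def field_simps)
  also have "interval_avg v ?g a b \<le> interval_max N v ?g n"
    using ab by (rule interval_avg_le_max)
  finally show "interval_avg v g a b \<le> interval_max N v ?g n + l / 2" by simp
qed

lemma interval_max_strong_type:
  fixes g v :: "nat \<Rightarrow> real" and p :: real
  assumes v: "\<And>i. 0 < v i" and g: "\<And>i. 0 \<le> g i" and p: "p > 1"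
  shows "(\<Sum>n\<le>N. interval_max N v g n powr p * v n)
    \<le> 8 * 2 powr (p - 1) * (p / (p - 1)) * (\<Sum>n\<le>N. g n powr p * v n)"
proof (rule strong_type_from_truncated_weak_type[OF _ p _ g])
  show "0 \<le> interval_max N v g n" if "n \<in> {..N}" for n
    using that v g less_imp_le by (intro interval_max_nonneg) auto
next
  fix l :: real assume l: "l > 0"
  let ?g = "\<lambda>i. if l \<le> 2 * g i then g i else 0"
  have "(\<Sum>n\<le>N. if l \<le> interval_max N v g n then v n else 0)
      \<le> (\<Sum>n\<le>N. if l / 2 \<le> interval_max N v ?g n then v n else 0)"
  proof (rule sum_mono)
    fix n assume "n \<in> {..N}"
    then show "(if l \<le> interval_max N v g n then v n else 0)
        \<le> (if l / 2 \<le> interval_max N v ?g n then v n else 0)"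
      using interval_max_truncate[of v g n N l] v g l less_imp_le[OF v[of n]] by auto
  qed
  also have "\<dots> = sum v {n. n \<le> N \<and> l / 2 \<le> interval_max N v ?g n}"
    by (subst sum.inter_filter[symmetric]) auto
  finally have "l * (\<Sum>n\<le>N. if l \<le> interval_max N v g n then v n else 0)
      \<le> 2 * (l / 2 * sum v {n. n \<le> N \<and> l / 2 \<le> interval_max N v ?g n})"
    using l by simp
  also have "\<dots> \<le> 2 * (4 * (\<Sum>n\<le>N. ?g n * v n))"
    by (intro mult_left_mono interval_max_weak_type) (use v g l in auto)
  also have "\<dots> = 8 * (\<Sum>n\<le>N. if l \<le> 2 * g n then g n * v n else 0)"
    by (simp add: sum_distrib_left if_distribR if_distrib[of "\<lambda>x. x * v _"] cong: if_cong)
  finally show "l * (\<Sum>n\<le>N. if l \<le> interval_max N v g n then v n else 0)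
      \<le> 8 * (\<Sum>n\<le>N. if l \<le> 2 * g n then g n * v n else 0)" .
qed simp

section \<open>Muckenhoupt weights on the natural numbers\<close>

abbreviation hl_max :: "nat \<Rightarrow> (nat \<Rightarrow> real) \<Rightarrow> nat \<Rightarrow> real" where
  "hl_max N \<equiv> interval_max N (\<lambda>_. 1)"

text \<open>
  Lerner's pointwise estimate. For an interval \<open>I\<close> through \<open>n\<close> and every \<open>x\<close> in \<open>I\<close>, the quotient of the sum
  of \<open>g\<close> over \<open>I\<close> by \<open>\<sigma>(I)\<close> is an average of \<open>g / \<sigma>\<close> with respect to \<open>\<sigma>\<close>, so it is at most the value at \<open>x\<close>
  of the maximal function for \<open>\<sigma>\<close>. Raising this to the power \<open>p - 1\<close> and averaging over \<open>I\<close> with respect to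
  \<open>w\<close> costs precisely the \<open>A\<^sub>p\<close> quantity of \<open>I\<close>.
\<close>
lemma hl_max_powr_le_weighted_max:
  fixes g w \<sigma> :: "nat \<Rightarrow> real" and p A :: real
  assumes w: "\<And>i. 0 < w i" and \<sigma>: "\<And>i. 0 < \<sigma> i" and g: "\<And>i. 0 \<le> g i" and p: "p > 1"
    and A: "\<And>a b. a \<le> b \<Longrightarrow>
      1 / (real b - real a + 1) powr p * sum w {a..b} * sum \<sigma> {a..b} powr (p - 1) \<le> A"
    and H: "\<And>i. i \<le> N \<Longrightarrow> H i * w i = interval_max N \<sigma> (\<lambda>j. g j / \<sigma> j) i powr (p - 1)"
    and n: "n \<le> N"
  shows "hl_max N g n powr (p - 1) \<le> A * interval_max N w H n"
proof -
  obtain a b where ab: "a \<le> n" "n \<le> b" "b \<le> N" "hl_max N g n = interval_avg (\<lambda>_. 1) g a b"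
    using n by (metis interval_max_attained)
  define len where "len = real b - real a + 1"
  have len: "len > 0" "(\<Sum>i=a..b. 1) = len" using ab by (auto simp: len_def of_nat_diff)
  have wpos: "0 < sum w {a..b}" and spos: "0 < sum \<sigma> {a..b}"
    using w \<sigma> ab by (auto intro!: sum_weight_pos)
  let ?G = "sum g {a..b}"
  have G: "0 \<le> ?G" using g by (intro sum_nonneg) auto
  have "?G powr (p - 1) / sum \<sigma> {a..b} powr (p - 1) \<le> H x * w x" if x: "x \<in> {a..b}" for x
  proof -
    have "?G / sum \<sigma> {a..b} = interval_avg \<sigma> (\<lambda>j. g j / \<sigma> j) a b"
      unfolding interval_avg_def using \<sigma> by (simp add: less_imp_neq[symmetric])
    also have "\<dots> \<le> interval_max N \<sigma> (\<lambda>j. g j / \<sigma> j) x"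
      using x ab by (intro interval_avg_le_max) auto
    finally have "(?G / sum \<sigma> {a..b}) powr (p - 1) \<le> interval_max N \<sigma> (\<lambda>j. g j / \<sigma> j) x powr (p - 1)"
      using G spos p by (intro powr_mono2) auto
    then show ?thesis using H[of x] x ab G spos by (simp add: powr_divide)
  qed
  then have "(\<Sum>x=a..b. ?G powr (p - 1) / sum \<sigma> {a..b} powr (p - 1)) \<le> (\<Sum>x=a..b. H x * w x)"
    by (intro sum_mono) auto
  also have "(\<Sum>x=a..b. H x * w x) = interval_avg w H a b * sum w {a..b}"
    using wpos by (simp add: interval_avg_def)
  also have "\<dots> \<le> interval_max N w H n * sum w {a..b}"
    using wpos ab by (intro mult_right_mono interval_avg_le_max) auto
  finally have "len * (?G powr (p - 1) / sum \<sigma> {a..b} powr (p - 1)) \<le> interval_max N w H n * sum w {a..b}"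
    using len(2) by simp
  then have "len * ?G powr (p - 1) \<le> interval_max N w H n * sum w {a..b} * sum \<sigma> {a..b} powr (p - 1)"
    using spos by (simp add: field_simps)
  also have "\<dots> = interval_max N w H n * len powr p
      * (1 / len powr p * sum w {a..b} * sum \<sigma> {a..b} powr (p - 1))"
    using len by (simp add: field_simps)
  also have "\<dots> \<le> interval_max N w H n * len powr p * A"
  proof (intro mult_left_mono mult_nonneg_nonneg)
    have "0 \<le> interval_avg w H n n"
      using H[OF n] w[of n] by (simp add: interval_avg_def)
    also have "\<dots> \<le> interval_max N w H n" using n by (intro interval_avg_le_max) auto
    finally show "0 \<le> interval_max N w H n" .
  qed (use A[of a b] ab in \<open>auto simp: len_def\<close>)
  finally have "len * ?G powr (p - 1) / len powr p \<le> A * interval_max N w H n"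
    using len by (simp add: field_simps)
  moreover have "len powr p = len powr (p - 1) * len"
    using len powr_add[of len "p - 1" 1] by simp
  ultimately have "?G powr (p - 1) / len powr (p - 1) \<le> A * interval_max N w H n"
    using len by simp
  then show ?thesis
    using ab(4) G len by (simp add: interval_avg_def powr_divide)
qed

text \<open>
  Take the pointwise estimate to the power \<open>q = p / (p - 1)\<close> and apply the strong type of the maximal function
  first in \<open>L\<^sup>q(w)\<close> and then in \<open>L\<^sup>p(\<sigma>)\<close>; the powers of \<open>w\<close> match since \<open>1 - q = - 1 / (p - 1)\<close>.
\<close>
lemma Ap_imp_hl_max_bounded:
  fixes w :: "nat \<Rightarrow> real" and p :: real
  assumes p: "p > 1" and w: "w \<in> Ap_class p"
  obtains C where "C > 0" "\<And>N g. (\<And>i. 0 \<le> g i) \<Longrightarrow>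
    (\<Sum>n\<le>N. hl_max N g n powr p * w n) \<le> C * (\<Sum>n\<le>N. g n powr p * w n)"
proof -
  have wpos: "0 < w i" for i using w by (auto simp: Ap_class_def is_weight_def)
  define \<sigma> where "\<sigma> = (\<lambda>i. w i powr (- 1 / (p - 1)))"
  have \<sigma>pos: "0 < \<sigma> i" for i using wpos[of i] by (auto simp: \<sigma>_def)
  obtain A where A: "\<And>a b. a \<le> b \<Longrightarrow>
      1 / (real b - real a + 1) powr p * sum w {a..b} * sum \<sigma> {a..b} powr (p - 1) \<le> A"
    using w unfolding Ap_class_def bdd_above_def \<sigma>_def by blast
  have "0 \<le> A"
  proof -
    have "0 \<le> 1 / (real 0 - real 0 + 1) powr p * sum w {0..0} * sum \<sigma> {0..0} powr (p - 1)"
      using wpos[of 0] by simp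
    then show ?thesis using A[of 0 0] by linarith
  qed
  define q where "q = p / (p - 1)"
  have q: "q > 1" using p by (simp add: q_def)
  have pq: "(p - 1) * q = p" using p by (simp add: q_def)
  define c where "c = (\<lambda>r::real. 8 * 2 powr (r - 1) * (r / (r - 1)))"
  have c: "c r > 0" if "r > 1" for r using that by (simp add: c_def)
  have "(\<Sum>n\<le>N. hl_max N g n powr p * w n) \<le> A powr q * c q * c p * (\<Sum>n\<le>N. g n powr p * w n)"
    if g: "\<And>i. 0 \<le> g i" for N g
  proof -
    define m where "m = interval_max N \<sigma> (\<lambda>j. g j / \<sigma> j)"
    define H where "H = (\<lambda>i. if i \<le> N then m i powr (p - 1) / w i else 0)"
    have H0: "0 \<le> H i" for i using wpos[of i] by (simp add: H_def)
    have m0: "0 \<le> m i" if "i \<le> N" for i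
      unfolding m_def using that g \<sigma>pos by (intro interval_max_nonneg) (auto simp: less_imp_le)
    have "hl_max N g n powr p * w n \<le> A powr q * (interval_max N w H n powr q * w n)" if n: "n \<le> N" for n
    proof -
      have M0: "0 \<le> interval_max N w H n"
        using n H0 wpos by (intro interval_max_nonneg) (auto simp: less_imp_le)
      have "hl_max N g n powr (p - 1) \<le> A * interval_max N w H n"
      proof (rule hl_max_powr_le_weighted_max[OF wpos \<sigma>pos g p A _ n])
        show "H i * w i = interval_max N \<sigma> (\<lambda>j. g j / \<sigma> j) i powr (p - 1)" if "i \<le> N" for i
          using that wpos[of i] by (simp add: H_def m_def)
      qed
      then have "(hl_max N g n powr (p - 1)) powr q \<le> (A * interval_max N w H n) powr q"
        using q by (intro powr_mono2) auto
      then have "hl_max N g n powr p \<le> A powr q * interval_max N w H n powr q"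
        using \<open>0 \<le> A\<close> M0 by (simp add: powr_powr pq powr_mult)
      then show ?thesis using wpos[of n] by (simp add: mult.assoc[symmetric] mult_right_mono less_imp_le)
    qed
    then have "(\<Sum>n\<le>N. hl_max N g n powr p * w n)
        \<le> A powr q * (\<Sum>n\<le>N. interval_max N w H n powr q * w n)"
      unfolding sum_distrib_left by (intro sum_mono) auto
    also have "\<dots> \<le> A powr q * (c q * (\<Sum>n\<le>N. H n powr q * w n))"
      unfolding c_def by (intro mult_left_mono interval_max_strong_type) (use wpos H0 q in auto)
    also have "(\<Sum>n\<le>N. H n powr q * w n) = (\<Sum>n\<le>N. m n powr p * \<sigma> n)"
    proof (rule sum.cong[OF refl])
      fix n assume "n \<in> {..N}"
      then have n: "n \<le> N" by simp
      have e: "1 - q = - 1 / (p - 1)" using p by (simp add: q_def field_simps)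
      have "H n powr q * w n = m n powr p * (w n powr 1 / w n powr q)"
        using n wpos[of n] m0[OF n] by (simp add: H_def powr_divide powr_powr pq)
      also have "w n powr 1 / w n powr q = \<sigma> n"
        unfolding \<sigma>_def e[symmetric] by (rule powr_diff[symmetric])
      finally show "H n powr q * w n = m n powr p * \<sigma> n" .
    qed
    also have "A powr q * (c q * (\<Sum>n\<le>N. m n powr p * \<sigma> n))
        \<le> A powr q * (c q * (c p * (\<Sum>n\<le>N. (g n / \<sigma> n) powr p * \<sigma> n)))"
    proof -
      have "(\<Sum>n\<le>N. m n powr p * \<sigma> n) \<le> c p * (\<Sum>n\<le>N. (g n / \<sigma> n) powr p * \<sigma> n)"
        unfolding m_def c_def
        by (rule interval_max_strong_type) (use \<sigma>pos g p in \<open>auto simp: less_imp_le\<close>)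
      then show ?thesis using c[OF q] by (simp add: mult_left_mono)
    qed
    also have "(\<Sum>n\<le>N. (g n / \<sigma> n) powr p * \<sigma> n) = (\<Sum>n\<le>N. g n powr p * w n)"
    proof (rule sum.cong[OF refl])
      fix n
      have "(g n / \<sigma> n) powr p * \<sigma> n = g n powr p * (\<sigma> n powr 1 / \<sigma> n powr p)"
        using \<sigma>pos[of n] g[of n] by (simp add: powr_divide)
      also have "\<sigma> n powr 1 / \<sigma> n powr p = \<sigma> n powr (1 - p)" by (rule powr_diff[symmetric])
      also have "\<dots> = w n"
      proof -
        have "(- 1 / (p - 1)) * (1 - p) = 1" using p by (simp add: field_simps)
        then show ?thesis unfolding \<sigma>_def powr_powr using wpos[of n] by simp
      qed
      finally show "(g n / \<sigma> n) powr p * \<sigma> n = g n powr p * w n" .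
    qed
    finally show ?thesis by (simp add: mult_ac)
  qed
  note bound = this
  have "A powr q * c q * c p \<le> A powr q * c q * c p + 1" by simp
  have nn: "0 \<le> A powr q * c q * c p" using c[OF q] c[OF p] by simp
  show ?thesis
  proof
    show "0 < A powr q * c q * c p + 1" using nn by simp
    fix N and g :: "nat \<Rightarrow> real" assume g: "\<And>i. 0 \<le> g i"
    have "0 \<le> (\<Sum>n\<le>N. g n powr p * w n)" using wpos by (intro sum_nonneg) (simp add: less_imp_le)
    with bound[of g N] g show "(\<Sum>n\<le>N. hl_max N g n powr p * w n)
        \<le> (A powr q * c q * c p + 1) * (\<Sum>n\<le>N. g n powr p * w n)"
      by (simp add: distrib_right)
  qed
qed

text \<open>
  The \<open>A\<^sub>1\<close> condition says \<open>w(I) / \<bar>I\<bar> \<le> A * w x\<close> for all \<open>x\<close> in \<open>I\<close>, so a plain average of \<open>g\<close> is at most \<open>A\<close>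
  times its average with respect to \<open>w\<close>, for which the weak type holds.
\<close>
lemma A1_imp_hl_max_weak:
  fixes w :: "nat \<Rightarrow> real"
  assumes w: "w \<in> A1_class"
  obtains C where "C > 0" "\<And>N g l. (\<And>i. 0 \<le> g i) \<Longrightarrow> 0 < l \<Longrightarrow>
    l * sum w {n. n \<le> N \<and> l \<le> hl_max N g n} \<le> C * (\<Sum>n\<le>N. g n * w n)"
proof -
  have wpos: "0 < w i" for i using w by (auto simp: A1_class_def is_weight_def)
  obtain A0 where A0: "\<And>a b. a \<le> b \<Longrightarrow>
      1 / (real b - real a + 1) * sum w {a..b} * Max ((\<lambda>k. inverse (w k)) ` {a..b}) \<le> A0"
    using w unfolding A1_class_def bdd_above_def by blast
  define A where "A = max A0 1"
  have A: "A > 0" by (simp add: A_def)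
  have le: "hl_max N g n \<le> A * interval_max N w g n"
    if g: "\<And>i. 0 \<le> g i" and n: "n \<le> N" for N n g
  proof -
    obtain a b where ab: "a \<le> n" "n \<le> b" "b \<le> N" "hl_max N g n = interval_avg (\<lambda>_. 1) g a b"
      using n by (metis interval_max_attained)
    define len where "len = real b - real a + 1"
    have len: "len > 0" "(\<Sum>i=a..b. 1) = len" using ab by (auto simp: len_def of_nat_diff)
    have W: "0 < sum w {a..b}" using wpos ab by (auto intro!: sum_weight_pos)
    have "sum w {a..b} * g x \<le> A * len * (g x * w x)" if x: "x \<in> {a..b}" for x
    proof -
      have "1 / len * sum w {a..b} * inverse (w x)
          \<le> 1 / len * sum w {a..b} * Max ((\<lambda>k. inverse (w k)) ` {a..b})"
        using x len W by (intro mult_left_mono Max_ge) auto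
      also have "\<dots> \<le> A" using A0[of a b] ab by (simp add: A_def len_def)
      finally have "sum w {a..b} \<le> A * len * w x"
        using len wpos[of x] by (simp add: field_simps)
      then have "sum w {a..b} * g x \<le> A * len * w x * g x" by (rule mult_right_mono) (rule g)
      then show ?thesis by (simp add: mult_ac)
    qed
    then have "(\<Sum>x=a..b. sum w {a..b} * g x) \<le> (\<Sum>x=a..b. A * len * (g x * w x))"
      by (intro sum_mono) auto
    then have "sum w {a..b} * sum g {a..b} \<le> A * len * (\<Sum>x=a..b. g x * w x)"
      by (simp only: sum_distrib_left)
    then have "sum g {a..b} / len \<le> A * ((\<Sum>x=a..b. g x * w x) / sum w {a..b})"
      using len(1) W by (simp add: field_simps)
    then have "hl_max N g n \<le> A * interval_avg w g a b"
      unfolding ab(4) by (simp only: interval_avg_def mult_1_right len(2))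
    also have "\<dots> \<le> A * interval_max N w g n"
      using A ab by (intro mult_left_mono interval_avg_le_max) auto
    finally show ?thesis .
  qed
  show ?thesis
  proof
    show "0 < 4 * A" using A by simp
    fix N and l :: real and g :: "nat \<Rightarrow> real" assume g: "\<And>i. 0 \<le> g i" and l: "0 < l"
    have "{n. n \<le> N \<and> l \<le> hl_max N g n} \<subseteq> {n. n \<le> N \<and> l / A \<le> interval_max N w g n}"
    proof clarify
      fix n assume n: "n \<le> N" "l \<le> hl_max N g n"
      then have "l \<le> A * interval_max N w g n" using le[of g n N] g by auto
      then show "l / A \<le> interval_max N w g n" using A by (simp add: field_simps)
    qed
    then have "sum w {n. n \<le> N \<and> l \<le> hl_max N g n} \<le> sum w {n. n \<le> N \<and> l / A \<le> interval_max N w g n}"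
      using wpos by (intro sum_mono2) (auto simp: less_imp_le)
    then have "l * sum w {n. n \<le> N \<and> l \<le> hl_max N g n}
        \<le> A * (l / A * sum w {n. n \<le> N \<and> l / A \<le> interval_max N w g n})"
      using l A by simp
    also have "\<dots> \<le> A * (4 * (\<Sum>n\<le>N. g n * w n))"
      using A l g wpos by (intro mult_left_mono interval_max_weak_type) auto
    finally show "l * sum w {n. n \<le> N \<and> l \<le> hl_max N g n} \<le> 4 * A * (\<Sum>n\<le>N. g n * w n)" by simp
  qed
qed

text \<open>
  Summation by parts as an induction: if all partial sums are nonnegative, decreasing weights keep them so.
\<close>
lemma decreasing_weights_sum_nonneg:
  fixes \<rho> :: real and x :: "nat \<Rightarrow> real"
  assumes \<rho>: "0 \<le> \<rho>" "\<rho> \<le> 1" and x: "\<And>d. d \<le> D \<Longrightarrow> 0 \<le> sum x {..<d}"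
  shows "\<rho> ^ D * sum x {..<D} \<le> (\<Sum>d<D. \<rho> ^ d * x d)"
  using x
proof (induction D)
  case (Suc D)
  have "\<rho> ^ Suc D * sum x {..<Suc D} \<le> \<rho> ^ D * sum x {..<Suc D}"
    using Suc.prems[of "Suc D"] \<rho> power_Suc_le_self[of \<rho> D] 
    by (intro mult_right_mono) (auto simp: mult_left_le_one_le)
  also have "\<dots> = \<rho> ^ D * sum x {..<D} + \<rho> ^ D * x D" by (simp add: distrib_left)
  also have "\<dots> \<le> (\<Sum>d<D. \<rho> ^ d * x d) + \<rho> ^ D * x D"
    using Suc by (intro add_right_mono Suc.IH) auto
  finally show ?case by simp
qed simp

text \<open>
  Compare \<open>g\<close> with the constant sequence \<open>M\<close>: the partial sums of \<open>M - g\<close> are nonnegative, hence so is its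
  sum against the decreasing weights \<open>\<rho> ^ d\<close>.
\<close>
lemma geometric_sum_le_of_averages:
  fixes \<rho> M :: real and g :: "nat \<Rightarrow> real"
  assumes \<rho>: "0 \<le> \<rho>" "\<rho> < 1" and M: "0 \<le> M" and g: "\<And>d. d \<le> D \<Longrightarrow> sum g {..<d} \<le> real d * M"
  shows "(1 - \<rho>) * (\<Sum>d<D. \<rho> ^ d * g d) \<le> M"
proof -
  have s: "(\<Sum>i<d. M - g i) = real d * M - sum g {..<d}" for d
    by (simp add: sum_subtractf)
  have "0 \<le> \<rho> ^ D * (\<Sum>i<D. M - g i)"
    using g[of D] \<rho> by (simp add: s)
  also have "\<dots> \<le> (\<Sum>d<D. \<rho> ^ d * (M - g d))"
    using \<rho> g by (intro decreasing_weights_sum_nonneg) (auto simp: s)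
  also have "\<dots> = M * (\<Sum>d<D. \<rho> ^ d) - (\<Sum>d<D. \<rho> ^ d * g d)"
    by (simp add: algebra_simps sum_subtractf sum_distrib_left)
  finally have "(1 - \<rho>) * (\<Sum>d<D. \<rho> ^ d * g d) \<le> (1 - \<rho>) * (M * (\<Sum>d<D. \<rho> ^ d))"
    using \<rho> by (intro mult_left_mono) auto
  also have "\<dots> = M * (1 - \<rho> ^ D)"
    using \<rho> by (simp add: sum_gp_strict)
  also have "\<dots> \<le> M * 1" using M \<rho> by (intro mult_left_mono) auto
  finally show ?thesis by simp
qed

lemma geometric_sum_le_hl_max:
  fixes \<rho> :: real and g :: "nat \<Rightarrow> real"
  assumes \<rho>: "0 \<le> \<rho>" "\<rho> < 1" and g: "\<And>i. 0 \<le> g i" and n: "n \<le> N"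
  shows "(1 - \<rho>) * (\<Sum>m\<le>N. g m * \<rho> ^ (if m \<le> n then n - m else m - n)) \<le> 2 * hl_max N g n"
proof -
  define M where "M = hl_max N g n"
  have M: "0 \<le> M" unfolding M_def using n g by (intro interval_max_nonneg) auto
  have avg: "sum g {a..b} \<le> real (Suc b - a) * M" if "a \<le> n" "n \<le> b" "b \<le> N" for a b
    using interval_avg_le_max[OF that, of "\<lambda>_. 1" g] that
    by (simp add: M_def interval_avg_def field_simps)
  have "(1 - \<rho>) * (\<Sum>d<Suc N - n. \<rho> ^ d * g (n + d)) \<le> M"
  proof (rule geometric_sum_le_of_averages[OF \<rho> M])
    fix d assume d: "d \<le> Suc N - n"
    show "(\<Sum>i<d. g (n + i)) \<le> real d * M"
    proof (cases d)
      case (Suc e)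
      have "(\<Sum>i<d. g (n + i)) = sum g {n..n + e}"
        by (rule sum.reindex_bij_witness[of _ "\<lambda>j. j - n" "\<lambda>i. n + i"]) (use Suc in auto)
      then show ?thesis using avg[of n "n + e"] d Suc n by simp
    qed simp
  qed
  also have "(\<Sum>d<Suc N - n. \<rho> ^ d * g (n + d)) = (\<Sum>m=n..N. \<rho> ^ (m - n) * g m)"
    by (rule sum.reindex_bij_witness[of _ "\<lambda>j. j - n" "\<lambda>i. n + i"]) (use n in auto)
  finally have 1: "(1 - \<rho>) * (\<Sum>m=n..N. \<rho> ^ (m - n) * g m) \<le> M" .
  have "(1 - \<rho>) * (\<Sum>d<Suc n. \<rho> ^ d * g (n - d)) \<le> M"
  proof (rule geometric_sum_le_of_averages[OF \<rho> M])
    fix d assume d: "d \<le> Suc n"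
    show "(\<Sum>i<d. g (n - i)) \<le> real d * M"
    proof (cases d)
      case (Suc e)
      have "(\<Sum>i<d. g (n - i)) = sum g {n - e..n}"
        by (rule sum.reindex_bij_witness[of _ "\<lambda>j. n - j" "\<lambda>i. n - i"]) (use Suc d in auto)
      then show ?thesis using avg[of "n - e" n] d Suc n by simp
    qed simp
  qed
  also have "(\<Sum>d<Suc n. \<rho> ^ d * g (n - d)) = (\<Sum>m\<le>n. \<rho> ^ (n - m) * g m)"
    by (rule sum.reindex_bij_witness[of _ "\<lambda>j. n - j" "\<lambda>i. n - i"]) auto
  finally have 2: "(1 - \<rho>) * (\<Sum>m\<le>n. \<rho> ^ (n - m) * g m) \<le> M" .
  let ?k = "\<lambda>m. g m * \<rho> ^ (if m \<le> n then n - m else m - n)"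
  have k0: "0 \<le> ?k m" for m using g \<rho> by simp
  have "sum ?k {..N} \<le> sum ?k ({..n} \<union> {n..N})"
    by (rule sum_mono2) (use k0 in auto)
  also have "\<dots> = sum ?k {..n} + sum ?k {n..N} - sum ?k ({..n} \<inter> {n..N})"
    by (rule sum_Un) auto
  also have "\<dots> \<le> sum ?k {..n} + sum ?k {n..N}"
  proof -
    have "0 \<le> sum ?k ({..n} \<inter> {n..N})" by (rule sum_nonneg) (rule k0)
    then show ?thesis by linarith
  qed
  also have "sum ?k {..n} = (\<Sum>m\<le>n. \<rho> ^ (n - m) * g m)" by (rule sum.cong) auto
  also have "sum ?k {n..N} = (\<Sum>m=n..N. \<rho> ^ (m - n) * g m)" by (rule sum.cong) auto
  finally have "(1 - \<rho>) * sum ?k {..N}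
      \<le> (1 - \<rho>) * ((\<Sum>m\<le>n. \<rho> ^ (n - m) * g m) + (\<Sum>m=n..N. \<rho> ^ (m - n) * g m))"
    using \<rho> by (intro mult_left_mono) auto
  then show ?thesis using 1 2 by (simp add: distrib_left M_def)
qed

section \<open>Maximal operators of geometrically dominated kernels\<close>

text \<open>
  The windows \<open>{0..n + N}\<close> exhaust all intervals through \<open>n\<close>, so this is the maximal function without
  truncation, provided that the truncated ones stay bounded.
\<close>
definition hl_maximal :: "(nat \<Rightarrow> real) \<Rightarrow> nat \<Rightarrow> real" where
  "hl_maximal g n = (SUP N. hl_max (n + N) g n)"

lemma hl_max_tendsto_hl_maximal:
  assumes "bdd_above (range (\<lambda>N. hl_max (n + N) g n))" and "n \<le> k"
  shows "(\<lambda>N. hl_max (N + k) g n) \<longlonglongrightarrow> hl_maximal g n"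
proof -
  have "incseq (\<lambda>N. hl_max (n + N) g n)"
    by (intro incseq_SucI interval_max_mono) auto
  then have "(\<lambda>N. hl_max (n + N) g n) \<longlonglongrightarrow> hl_maximal g n"
    unfolding hl_maximal_def using assms(1) by (intro LIMSEQ_incseq_SUP)
  then have "(\<lambda>N. hl_max (n + (N + (k - n))) g n) \<longlonglongrightarrow> hl_maximal g n"
    by (rule LIMSEQ_ignore_initial_segment)
  moreover have "n + (N + (k - n)) = N + k" for N using assms(2) by simp
  ultimately show ?thesis by simp
qed

lemma heat_op_le_hl_maximal:
  fixes f :: "nat \<Rightarrow> complex"
  assumes \<rho>: "0 \<le> \<rho>" "\<rho> < 1" and D: "0 \<le> D"
    and K: "\<And>m. \<bar>heat_kernel \<alpha> \<beta> t m n\<bar> \<le> D * (1 - \<rho>) * \<rho> ^ (if m \<le> n then n - m else m - n)"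
    and bdd: "bdd_above (range (\<lambda>N. hl_max (n + N) (\<lambda>m. norm (f m)) n))"
  shows "summable (\<lambda>m. f m * complex_of_real (heat_kernel \<alpha> \<beta> t m n))"
    and "norm (heat_op \<alpha> \<beta> t f n) \<le> 2 * D * hl_maximal (\<lambda>m. norm (f m)) n"
proof -
  let ?g = "\<lambda>m. norm (f m)" and ?F = "\<lambda>m. f m * complex_of_real (heat_kernel \<alpha> \<beta> t m n)"
  let ?k = "\<lambda>m. \<rho> ^ (if m \<le> n then n - m else m - n)"
  have part: "(\<Sum>m<k. norm (?F m)) \<le> 2 * D * hl_maximal ?g n" for k
  proof -
    have "(\<Sum>m<k. norm (?F m)) \<le> (\<Sum>m\<le>n + k. norm (?F m))"
      by (rule sum_mono2) auto
    also have "\<dots> \<le> (\<Sum>m\<le>n + k. D * (1 - \<rho>) * (?g m * ?k m))"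
    proof (rule sum_mono)
      fix m
      have "norm (?F m) = ?g m * \<bar>heat_kernel \<alpha> \<beta> t m n\<bar>" by (simp add: norm_mult)
      also have "\<dots> \<le> ?g m * (D * (1 - \<rho>) * ?k m)" by (rule mult_left_mono[OF K]) simp
      finally show "norm (?F m) \<le> D * (1 - \<rho>) * (?g m * ?k m)" by (simp only: mult_ac)
    qed
    also have "\<dots> = D * ((1 - \<rho>) * (\<Sum>m\<le>n + k. ?g m * ?k m))"
      by (simp only: sum_distrib_left mult.assoc)
    also have "\<dots> \<le> D * (2 * hl_max (n + k) ?g n)"
      using \<rho> D by (intro mult_left_mono geometric_sum_le_hl_max) auto
    also have "\<dots> \<le> D * (2 * hl_maximal ?g n)"
      unfolding hl_maximal_def using D bdd by (intro mult_left_mono cSUP_upper) auto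
    finally show ?thesis by simp
  qed
  then have s: "summable (\<lambda>m. norm (?F m))"
    by (intro summableI_nonneg_bounded) auto
  then show "summable ?F" by (rule summable_norm_cancel)
  have "norm (heat_op \<alpha> \<beta> t f n) \<le> (\<Sum>m. norm (?F m))"
    unfolding heat_op_def using s by (rule summable_norm)
  also have "\<dots> \<le> 2 * D * hl_maximal ?g n" by (rule suminf_le_const[OF s part])
  finally show "norm (heat_op \<alpha> \<beta> t f n) \<le> 2 * D * hl_maximal ?g n" .
qed

lemma ennreal_powr_ennreal: "0 \<le> x \<Longrightarrow> ennreal_powr (ennreal x) p = ennreal (x powr p)"
  by (simp add: ennreal_powr_def)

lemma ennreal_powr_mono:
  assumes "x \<le> y" "0 \<le> p"
  shows "ennreal_powr x p \<le> ennreal_powr y p"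
proof (cases "y = \<infinity>")
  case False
  then have "x \<noteq> \<infinity>" "enn2real x \<le> enn2real y"
    using assms(1) by (auto simp: top.not_eq_extremum intro!: enn2real_mono)
  then show ?thesis
    using False assms(2) by (auto simp: ennreal_powr_def intro!: ennreal_leI powr_mono2)
qed (simp add: ennreal_powr_def)

lemma lp_norm_of_real_summable:
  fixes g w :: "nat \<Rightarrow> real"
  assumes w: "\<And>i. 0 < w i" and g: "\<And>i. 0 \<le> g i"
    and fin: "lp_norm p w (\<lambda>m. ennreal (g m)) < \<infinity>"
  shows "summable (\<lambda>m. g m powr p * w m)"
    and "lp_norm p w (\<lambda>m. ennreal (g m)) = ennreal ((\<Sum>m. g m powr p * w m) powr (1 / p))"
proof -
  have eq: "ennreal_powr (ennreal (g m)) p * ennreal (w m) = ennreal (g m powr p * w m)" for m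
    using w[of m] g[of m] by (simp add: ennreal_powr_ennreal ennreal_mult)
  have nn: "0 \<le> g m powr p * w m" for m using w[of m] by simp
  have "(\<Sum>m. ennreal (g m powr p * w m)) \<noteq> \<infinity>"
    using fin unfolding lp_norm_def eq by (auto simp: ennreal_powr_def split: if_splits)
  then show s: "summable (\<lambda>m. g m powr p * w m)"
    using nn by (intro summable_suminf_not_top) auto
  show "lp_norm p w (\<lambda>m. ennreal (g m)) = ennreal ((\<Sum>m. g m powr p * w m) powr (1 / p))"
    unfolding lp_norm_def eq using s nn
    by (simp add: suminf_ennreal2 ennreal_powr_ennreal suminf_nonneg)
qed

text \<open>
  A bound that is uniform in the truncation forces the truncated maximal functions to be bounded at every
  point, because each point has positive weight; the limit then inherits the bound.
\<close>
lemma hl_maximal_strong_type: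
  fixes g w :: "nat \<Rightarrow> real"
  assumes w: "\<And>i. 0 < w i" and g: "\<And>i. 0 \<le> g i" and p: "p > 1"
    and bound: "\<And>N. (\<Sum>n\<le>N. hl_max N g n powr p * w n) \<le> B"
  shows "bdd_above (range (\<lambda>N. hl_max (n + N) g n))"
    and "(\<Sum>n\<le>k. hl_maximal g n powr p * w n) \<le> B"
proof -
  show bdd: "bdd_above (range (\<lambda>N. hl_max (n + N) g n))" for n
  proof (rule bdd_aboveI2)
    fix N
    have nn: "0 \<le> hl_max (n + N) g n" using g by (intro interval_max_nonneg) auto
    have "hl_max (n + N) g n powr p * w n \<le> (\<Sum>j\<le>n + N. hl_max (n + N) g j powr p * w j)"
      by (rule member_le_sum) (use w in \<open>auto simp: less_imp_le\<close>)
    also have "\<dots> \<le> B" by (rule bound)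
    finally have "hl_max (n + N) g n powr p \<le> B / w n" using w[of n] by (simp add: field_simps)
    then have "(hl_max (n + N) g n powr p) powr (1 / p) \<le> (B / w n) powr (1 / p)"
      using p by (intro powr_mono2) auto
    then show "hl_max (n + N) g n \<le> (B / w n) powr (1 / p)"
      using p nn by (simp add: powr_powr)
  qed
  have "(\<lambda>N. \<Sum>n\<le>k. hl_max (N + k) g n powr p * w n) \<longlonglongrightarrow> (\<Sum>n\<le>k. hl_maximal g n powr p * w n)"
  proof (intro tendsto_sum tendsto_mult tendsto_const tendsto_powr2)
    fix n assume "n \<in> {..k}"
    then have n: "n \<le> k" by simp
    show "(\<lambda>N. hl_max (N + k) g n) \<longlonglongrightarrow> hl_maximal g n"
      by (rule hl_max_tendsto_hl_maximal[OF bdd n])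
    show "\<forall>\<^sub>F N in sequentially. 0 \<le> hl_max (N + k) g n"
      using g n by (intro always_eventually allI interval_max_nonneg) auto
  qed (use p in auto)
  moreover have "(\<Sum>n\<le>k. hl_max (N + k) g n powr p * w n) \<le> B" for N
  proof -
    have "(\<Sum>n\<le>k. hl_max (N + k) g n powr p * w n) \<le> (\<Sum>n\<le>N + k. hl_max (N + k) g n powr p * w n)"
      by (rule sum_mono2) (use w in \<open>auto simp: less_imp_le\<close>)
    then show ?thesis using bound[of "N + k"] by linarith
  qed
  ultimately show "(\<Sum>n\<le>k. hl_maximal g n powr p * w n) \<le> B"
    by (intro LIMSEQ_le_const2) auto
qed

lemma hl_maximal_weak_type:
  fixes g w :: "nat \<Rightarrow> real"
  assumes w: "\<And>i. 0 < w i" and g: "\<And>i. 0 \<le> g i"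
    and bound: "\<And>N l. 0 < l \<Longrightarrow> l * sum w {n. n \<le> N \<and> l \<le> hl_max N g n} \<le> B"
  shows "bdd_above (range (\<lambda>N. hl_max (n + N) g n))"
    and "0 < l \<Longrightarrow> l * sum w {n. n \<le> k \<and> l < hl_maximal g n} \<le> B"
proof -
  show bdd: "bdd_above (range (\<lambda>N. hl_max (n + N) g n))" for n
  proof (rule bdd_aboveI2)
    fix N
    let ?l = "hl_max (n + N) g n"
    have "0 \<le> 1 * sum w {n. n \<le> 0 \<and> 1 \<le> hl_max 0 g n}"
      using w by (auto intro!: sum_nonneg simp: less_imp_le)
    then have B: "0 \<le> B" using bound[of 1 0] by linarith
    show "?l \<le> B / w n"
    proof (cases "0 < ?l")
      case True
      have "w n \<le> sum w {j. j \<le> n + N \<and> ?l \<le> hl_max (n + N) g j}"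
        by (rule member_le_sum) (use w in \<open>auto simp: less_imp_le\<close>)
      then have "?l * w n \<le> ?l * sum w {j. j \<le> n + N \<and> ?l \<le> hl_max (n + N) g j}"
        using True by (intro mult_left_mono) auto
      also have "\<dots> \<le> B" by (rule bound[OF True])
      finally show ?thesis using w[of n] by (simp add: field_simps)
    next
      case False
      moreover have "0 \<le> B / w n" using B w[of n] by simp
      ultimately show ?thesis by linarith
    qed
  qed
  assume l: "0 < l"
  let ?E = "{n. n \<le> k \<and> l < hl_maximal g n}"
  have "\<forall>\<^sub>F N in sequentially. \<forall>n\<in>?E. l < hl_max (N + k) g n"
  proof (rule eventually_ball_finite)
    show "\<forall>n\<in>?E. \<forall>\<^sub>F N in sequentially. l < hl_max (N + k) g n"
    proof
      fix n assume "n \<in> ?E"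
      then have n: "n \<le> k" "l < hl_maximal g n" by auto
      show "\<forall>\<^sub>F N in sequentially. l < hl_max (N + k) g n"
        by (rule order_tendstoD(1)[OF hl_max_tendsto_hl_maximal[OF bdd n(1)] n(2)])
    qed
  qed simp
  then obtain N where N: "\<forall>n\<in>?E. l < hl_max (N + k) g n"
    using eventually_happens trivial_limit_sequentially by blast
  have "sum w ?E \<le> sum w {n. n \<le> N + k \<and> l \<le> hl_max (N + k) g n}"
    by (rule sum_mono2) (use w N in \<open>auto simp: less_imp_le\<close>)
  then have "l * sum w ?E \<le> l * sum w {n. n \<le> N + k \<and> l \<le> hl_max (N + k) g n}"
    using l by (intro mult_left_mono) auto
  also have "\<dots> \<le> B" by (rule bound[OF l])
  finally show "l * sum w ?E \<le> B" .
qed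

lemma suminf_ennreal_le:
  fixes a :: "nat \<Rightarrow> ennreal"
  assumes "\<And>k. (\<Sum>m\<le>k. a m) \<le> b"
  shows "(\<Sum>m. a m) \<le> b"
proof (rule suminf_le_const)
  fix n
  have "sum a {..<n} \<le> sum a {..n}" by (rule sum_mono2) auto
  then show "sum a {..<n} \<le> b" using assms order_trans by blast
qed simp

text \<open>
  The whole analysis of the heat kernel enters the weighted inequalities through this single property.
\<close>
locale dominated_heat_kernel =
  fixes \<alpha> \<beta> D :: real
  assumes D_pos: "0 < D"
    and dominated: "\<And>t. 0 < t \<Longrightarrow> \<exists>\<rho>. 0 \<le> \<rho> \<and> \<rho> < 1 \<and> (\<forall>m n.
      \<bar>heat_kernel \<alpha> \<beta> t m n\<bar> \<le> D * (1 - \<rho>) * \<rho> ^ (if m \<le> n then n - m else m - n))"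
begin

lemma summable_and_maximal_le:
  assumes bdd: "\<And>n. bdd_above (range (\<lambda>N. hl_max (n + N) (\<lambda>m. norm (f m)) n))"
  shows "0 < t \<Longrightarrow> summable (\<lambda>m. f m * complex_of_real (heat_kernel \<alpha> \<beta> t m n))"
    and "heat_maximal \<alpha> \<beta> f n \<le> ennreal (2 * D * hl_maximal (\<lambda>m. norm (f m)) n)"
proof -
  have *: "summable (\<lambda>m. f m * complex_of_real (heat_kernel \<alpha> \<beta> t m n)) \<and>
      norm (heat_op \<alpha> \<beta> t f n) \<le> 2 * D * hl_maximal (\<lambda>m. norm (f m)) n" if t: "0 < t" for t
  proof -
    obtain \<rho> where "0 \<le> \<rho>" "\<rho> < 1"
      "\<And>m n. \<bar>heat_kernel \<alpha> \<beta> t m n\<bar> \<le> D * (1 - \<rho>) * \<rho> ^ (if m \<le> n then n - m else m - n)"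
      using dominated[OF t] by blast
    then show ?thesis using heat_op_le_hl_maximal[of \<rho> D \<alpha> \<beta> t n f] D_pos bdd by simp
  qed
  show "0 < t \<Longrightarrow> summable (\<lambda>m. f m * complex_of_real (heat_kernel \<alpha> \<beta> t m n))" using * by blast
  show "heat_maximal \<alpha> \<beta> f n \<le> ennreal (2 * D * hl_maximal (\<lambda>m. norm (f m)) n)"
    unfolding heat_maximal_def using * by (intro SUP_least ennreal_leI) auto
qed

theorem maximal_strong_type:
  assumes p: "1 < p" and w: "w \<in> Ap_class p"
  shows "\<exists>C::real. C > 0 \<and> (\<forall>f\<in>lp_space p w.
               (\<forall>t>0. \<forall>n. summable (\<lambda>m. f m * complex_of_real (heat_kernel \<alpha> \<beta> t m n))) \<and>
               lp_norm p w (heat_maximal \<alpha> \<beta> f)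
                 \<le> ennreal C * lp_norm p w (\<lambda>m. ennreal (norm (f m))))"
proof -
  have wpos: "0 < w i" for i using w by (auto simp: Ap_class_def is_weight_def)
  obtain C where C: "C > 0" "\<And>N g. (\<And>i. 0 \<le> g i) \<Longrightarrow>
    (\<Sum>n\<le>N. hl_max N g n powr p * w n) \<le> C * (\<Sum>n\<le>N. g n powr p * w n)"
    using Ap_imp_hl_max_bounded[OF p w] by blast
  show ?thesis
  proof (intro exI[of _ "2 * D * C powr (1 / p)"] conjI ballI allI impI)
    show "0 < 2 * D * C powr (1 / p)" using C D_pos by simp
    fix f assume f: "f \<in> lp_space p w"
    let ?g = "\<lambda>m. norm (f m)"
    define B where "B = (\<Sum>m. ?g m powr p * w m)"
    have fin: "lp_norm p w (\<lambda>m. ennreal (?g m)) < \<infinity>" using f by (simp add: lp_space_def)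
    have s: "summable (\<lambda>m. ?g m powr p * w m)"
      "lp_norm p w (\<lambda>m. ennreal (?g m)) = ennreal ((\<Sum>m. ?g m powr p * w m) powr (1 / p))"
      by (rule lp_norm_of_real_summable[OF wpos norm_ge_zero fin])+
    have nn: "0 \<le> ?g m powr p * w m" for m using wpos[of m] by simp
    have B: "0 \<le> B" unfolding B_def by (intro suminf_nonneg s nn)
    have bound: "(\<Sum>n\<le>N. hl_max N ?g n powr p * w n) \<le> C * B" for N
    proof -
      have "(\<Sum>n\<le>N. ?g n powr p * w n) \<le> B"
        unfolding B_def by (rule sum_le_suminf) (use s nn in auto)
      then have "C * (\<Sum>n\<le>N. ?g n powr p * w n) \<le> C * B" using C by (intro mult_left_mono) auto
      then show ?thesis using C(2)[of ?g N] by simp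
    qed
    have str: "bdd_above (range (\<lambda>N. hl_max (n + N) ?g n))"
      "(\<Sum>n\<le>k. hl_maximal ?g n powr p * w n) \<le> C * B" for n k
      by (rule hl_maximal_strong_type[OF wpos norm_ge_zero p bound])+
    show "summable (\<lambda>m. f m * complex_of_real (heat_kernel \<alpha> \<beta> t m n))" if "0 < t" for t n
      by (rule summable_and_maximal_le(1)[OF str(1) that])
    let ?M = "hl_maximal ?g"
    have M0: "0 \<le> ?M n" for n
    proof -
      have "0 \<le> hl_max (n + 0) ?g n" by (intro interval_max_nonneg) auto
      also have "\<dots> \<le> ?M n" unfolding hl_maximal_def using str(1) by (intro cSUP_upper) auto
      finally show ?thesis .
    qed
    have "(\<Sum>m. ennreal_powr (heat_maximal \<alpha> \<beta> f m) p * ennreal (w m)) \<le> ennreal ((2 * D) powr p * (C * B))"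
    proof (rule suminf_ennreal_le)
      fix k
      have "(\<Sum>m\<le>k. ennreal_powr (heat_maximal \<alpha> \<beta> f m) p * ennreal (w m))
          \<le> (\<Sum>m\<le>k. ennreal ((2 * D) powr p * (?M m powr p * w m)))"
      proof (rule sum_mono)
        fix m
        have "ennreal_powr (heat_maximal \<alpha> \<beta> f m) p \<le> ennreal_powr (ennreal (2 * D * ?M m)) p"
          using summable_and_maximal_le(2)[OF str(1)] p by (intro ennreal_powr_mono) auto
        also have "\<dots> = ennreal ((2 * D) powr p * ?M m powr p)"
          using D_pos M0 by (simp add: ennreal_powr_ennreal powr_mult)
        finally have "ennreal_powr (heat_maximal \<alpha> \<beta> f m) p * ennreal (w m)
            \<le> ennreal ((2 * D) powr p * ?M m powr p) * ennreal (w m)"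
          by (rule mult_right_mono) simp
        then show "ennreal_powr (heat_maximal \<alpha> \<beta> f m) p * ennreal (w m)
            \<le> ennreal ((2 * D) powr p * (?M m powr p * w m))"
          using wpos[of m] by (simp add: ennreal_mult[symmetric] mult.assoc)
      qed
      also have "\<dots> = ennreal ((2 * D) powr p * (\<Sum>m\<le>k. ?M m powr p * w m))"
        using wpos by (subst sum_ennreal) (auto simp: sum_distrib_left less_imp_le)
      also have "\<dots> \<le> ennreal ((2 * D) powr p * (C * B))"
        by (intro ennreal_leI mult_left_mono str(2)) auto
      finally show "(\<Sum>m\<le>k. ennreal_powr (heat_maximal \<alpha> \<beta> f m) p * ennreal (w m))
          \<le> ennreal ((2 * D) powr p * (C * B))" .
    qed
    then have "lp_norm p w (heat_maximal \<alpha> \<beta> f) \<le> ennreal_powr (ennreal ((2 * D) powr p * (C * B))) (1 / p)"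
      unfolding lp_norm_def using p by (intro ennreal_powr_mono) auto
    also have "\<dots> = ennreal (((2 * D) powr p * (C * B)) powr (1 / p))"
      using B C by (simp add: ennreal_powr_ennreal)
    also have "((2 * D) powr p * (C * B)) powr (1 / p) = 2 * D * C powr (1 / p) * B powr (1 / p)"
      using B C D_pos p by (simp add: powr_mult powr_powr)
    also have "ennreal \<dots> = ennreal (2 * D * C powr (1 / p)) * lp_norm p w (\<lambda>m. ennreal (?g m))"
      unfolding s(2) B_def[symmetric] using D_pos by (subst ennreal_mult) auto
    finally show "lp_norm p w (heat_maximal \<alpha> \<beta> f)
        \<le> ennreal (2 * D * C powr (1 / p)) * lp_norm p w (\<lambda>m. ennreal (?g m))" .
  qed
qed

theorem maximal_weak_type:
  assumes w: "w \<in> A1_class"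
  shows "\<exists>C::real. C > 0 \<and> (\<forall>f\<in>lp_space 1 w.
               (\<forall>t>0. \<forall>n. summable (\<lambda>m. f m * complex_of_real (heat_kernel \<alpha> \<beta> t m n))) \<and>
               weak_l1_norm w (heat_maximal \<alpha> \<beta> f)
                 \<le> ennreal C * lp_norm 1 w (\<lambda>m. ennreal (norm (f m))))"
proof -
  have wpos: "0 < w i" for i using w by (auto simp: A1_class_def is_weight_def)
  obtain C where C: "C > 0" "\<And>N g l. (\<And>i. 0 \<le> g i) \<Longrightarrow> 0 < l \<Longrightarrow>
    l * sum w {n. n \<le> N \<and> l \<le> hl_max N g n} \<le> C * (\<Sum>n\<le>N. g n * w n)"
    using A1_imp_hl_max_weak[OF w] by blast
  show ?thesis
  proof (intro exI[of _ "2 * D * C"] conjI ballI allI impI)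
    show "0 < 2 * D * C" using C D_pos by simp
    fix f assume f: "f \<in> lp_space 1 w"
    let ?g = "\<lambda>m. norm (f m)"
    define B where "B = (\<Sum>m. ?g m * w m)"
    have fin: "lp_norm 1 w (\<lambda>m. ennreal (?g m)) < \<infinity>" using f by (simp add: lp_space_def)
    have s: "summable (\<lambda>m. ?g m * w m)"
      "lp_norm 1 w (\<lambda>m. ennreal (?g m)) = ennreal (\<Sum>m. ?g m * w m)"
      using lp_norm_of_real_summable[OF wpos norm_ge_zero fin]
      by (simp_all add: powr_one[OF norm_ge_zero] suminf_nonneg less_imp_le[OF wpos])
    have nn: "0 \<le> ?g m * w m" for m using wpos[of m] by simp
    have B: "0 \<le> B" unfolding B_def by (intro suminf_nonneg s nn)
    have bound: "l * sum w {n. n \<le> N \<and> l \<le> hl_max N ?g n} \<le> C * B" if "0 < l" for N l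
    proof -
      have "(\<Sum>n\<le>N. ?g n * w n) \<le> B"
        unfolding B_def by (rule sum_le_suminf) (use s nn in auto)
      then have "C * (\<Sum>n\<le>N. ?g n * w n) \<le> C * B" using C by (intro mult_left_mono) auto
      then show ?thesis using C(2)[of ?g l N] that by simp
    qed
    have wk: "bdd_above (range (\<lambda>N. hl_max (n + N) ?g n))"
      "0 < l \<Longrightarrow> l * sum w {n. n \<le> k \<and> l < hl_maximal ?g n} \<le> C * B" for n k l
      by (rule hl_maximal_weak_type[OF wpos norm_ge_zero bound], assumption+)+
    show "summable (\<lambda>m. f m * complex_of_real (heat_kernel \<alpha> \<beta> t m n))" if "0 < t" for t n
      by (rule summable_and_maximal_le(1)[OF wk(1) that])
    let ?M = "hl_maximal ?g"
    have "weak_l1_norm w (heat_maximal \<alpha> \<beta> f) \<le> ennreal (2 * D * C * B)"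
      unfolding weak_l1_norm_def
    proof (rule SUP_least)
      fix t :: real assume "t \<in> {0<..}"
      then have t: "0 < t" by simp
      have "(\<Sum>m. if ennreal t < heat_maximal \<alpha> \<beta> f m then ennreal (w m) else 0) \<le> ennreal (2 * D * C * B / t)"
      proof (rule suminf_ennreal_le)
        fix k
        let ?E = "{n. n \<le> k \<and> t / (2 * D) < ?M n}"
        have "(\<Sum>m\<le>k. if ennreal t < heat_maximal \<alpha> \<beta> f m then ennreal (w m) else 0)
            \<le> (\<Sum>m\<le>k. if t / (2 * D) < ?M m then ennreal (w m) else 0)"
        proof (rule sum_mono)
          fix m
          have "t / (2 * D) < ?M m" if "ennreal t < heat_maximal \<alpha> \<beta> f m"
          proof -
            have "ennreal t < ennreal (2 * D * ?M m)"
              using that summable_and_maximal_le(2)[OF wk(1)] by (rule less_le_trans)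
            then have "t < 2 * D * ?M m" using t by (simp add: ennreal_less_iff)
            then show ?thesis using D_pos by (simp add: field_simps)
          qed
          then show "(if ennreal t < heat_maximal \<alpha> \<beta> f m then ennreal (w m) else 0)
              \<le> (if t / (2 * D) < ?M m then ennreal (w m) else 0)" by auto
        qed
        also have "\<dots> = (\<Sum>m\<in>?E. ennreal (w m))"
          by (subst sum.inter_filter[symmetric]) auto
        also have "\<dots> = ennreal (sum w ?E)"
          by (rule sum_ennreal) (use wpos in \<open>auto simp: less_imp_le\<close>)
        also have "\<dots> \<le> ennreal (2 * D * C * B / t)"
        proof (rule ennreal_leI)
          have "t / (2 * D) * sum w ?E \<le> C * B"
            using t D_pos by (intro wk(2)) auto
          then show "sum w ?E \<le> 2 * D * C * B / t" using t D_pos by (simp add: field_simps)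
        qed
        finally show "(\<Sum>m\<le>k. if ennreal t < heat_maximal \<alpha> \<beta> f m then ennreal (w m) else 0)
            \<le> ennreal (2 * D * C * B / t)" .
      qed
      then have "ennreal t * (\<Sum>m. if ennreal t < heat_maximal \<alpha> \<beta> f m then ennreal (w m) else 0)
          \<le> ennreal t * ennreal (2 * D * C * B / t)"
        by (rule mult_left_mono) simp
      also have "\<dots> = ennreal (2 * D * C * B)"
        using t B C D_pos by (simp add: ennreal_mult[symmetric])
      finally show "ennreal t * (\<Sum>m. if ennreal t < heat_maximal \<alpha> \<beta> f m then ennreal (w m) else 0)
          \<le> ennreal (2 * D * C * B)" .
    qed
    also have "\<dots> = ennreal (2 * D * C) * lp_norm 1 w (\<lambda>m. ennreal (?g m))"
      unfolding s(2) using B C D_pos by (simp add: B_def[symmetric] ennreal_mult[symmetric])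
    finally show "weak_l1_norm w (heat_maximal \<alpha> \<beta> f)
        \<le> ennreal (2 * D * C) * lp_norm 1 w (\<lambda>m. ennreal (?g m))" .
  qed
qed

end

section \<open>Heat kernels of orthonormal recurrences\<close>

lemma cosh_le_quadratic:
  fixes s :: real
  assumes "0 \<le> s" "s \<le> 1"
  shows "cosh s \<le> 1 + s\<^sup>2" and "sinh s \<le> 2 * s"
proof -
  have e: "exp s \<le> 1 + s + s\<^sup>2" using assms by (rule exp_bound)
  have "exp (- s) = 1 / exp s" by (simp add: exp_minus field_simps)
  also have "\<dots> \<le> 1 / (1 + s)" using assms exp_ge_add_one_self[of s] by (intro divide_left_mono) auto
  also have "\<dots> \<le> 1 - s + s\<^sup>2"
  proof -
    have "(1 - s + s\<^sup>2) * (1 + s) = 1 + s ^ 3" by (simp add: algebra_simps power2_eq_square power3_eq_cube)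
    then have "1 \<le> (1 - s + s\<^sup>2) * (1 + s)" using assms by simp
    then show ?thesis using assms by (simp add: field_simps)
  qed
  finally have e': "exp (- s) \<le> 1 - s + s\<^sup>2" .
  show "cosh s \<le> 1 + s\<^sup>2" using e e' by (simp add: cosh_field_def)
  have "s\<^sup>2 \<le> s" using assms by (simp add: power2_eq_square mult_left_le)
  then show "sinh s \<le> 2 * s" using e exp_ge_add_one_self[of "- s"] assms by (simp add: sinh_field_def)
qed

lemma sinh_le_mult_cosh:
  fixes y :: real
  assumes "0 \<le> y"
  shows "sinh y \<le> y * cosh y"
proof -
  have "(\<lambda>y::real. y * cosh y - sinh y) 0 \<le> (\<lambda>y. y * cosh y - sinh y) y"
  proof (rule DERIV_nonneg_imp_nondecreasing[OF assms])
    fix x :: real assume "0 \<le> x" "x \<le> y"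
    have "((\<lambda>y. y * cosh y - sinh y) has_real_derivative x * sinh x) (at x)"
      by (auto intro!: derivative_eq_intros)
    then show "\<exists>z. ((\<lambda>y. y * cosh y - sinh y) has_real_derivative z) (at x) \<and> 0 \<le> z"
      using \<open>0 \<le> x\<close> by (intro exI[of _ "x * sinh x"] conjI) auto
  qed
  then show ?thesis by simp
qed

text \<open>
  Multiplication by \<open>x\<close> acts on the orthonormal functions \<open>p n\<close> as a tridiagonal matrix \<open>J\<close> with diagonal \<open>b\<close> and
  off-diagonal \<open>a\<close>; \<open>a' n\<close> is \<open>a (n - 1)\<close>, with the value \<open>0\<close> at the boundary. The sequence \<open>h\<close> is the positive
  solution of \<open>J h = h\<close>. In the chain obtained by conjugation with \<open>h\<close>, the rates of the jumps from \<open>n\<close> to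
  \<open>n + 1\<close> and to \<open>n - 1\<close> are \<open>a n * h (n + 1) / h n\<close> and \<open>a' n * h (n - 1) / h n\<close>; the last assumption bounds their
  difference.
\<close>
locale orthonormal_recurrence = finite_measure M for M :: "real measure" +
  fixes p :: "nat \<Rightarrow> real \<Rightarrow> real" and a b a' h :: "nat \<Rightarrow> real" and c H L :: real
  assumes space_M: "space M = {-1..1}"
    and sets_M: "sets M = sets (restrict_space borel {-1..1})"
    and p_cont: "\<And>n. continuous_on UNIV (p n)"
    and orthonormal: "\<And>m n. (\<integral>x. p m x * p n x \<partial>M) = (if m = n then 1 else 0)"
    and a'_def: "\<And>n. a' n = (case n of 0 \<Rightarrow> 0 | Suc k \<Rightarrow> a k)"
    and recurrence: "\<And>n x. x * p n x = a n * p (Suc n) x + b n * p n x + a' n * p (n - 1) x"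
    and h_def: "\<And>n. h n = p n 1"
    and h_pos: "\<And>n. 0 < h n"
    and c_pos: "0 < c"
    and a_lower: "\<And>n. c \<le> a n"
    and h_quasi_mono: "\<And>m n. m \<le> n \<Longrightarrow> h m \<le> H * h n"
    and h_step: "\<And>n. h (Suc n) \<le> L * h n"
    and drift: "\<And>n. a n * h (Suc n) - a' n * h (n - 1) \<le> L / (real n + 1) * h n"
begin

lemma a_pos: "0 < a n" using c_pos a_lower less_le_trans by blast
lemma a'_nonneg: "0 \<le> a' n" using a_pos by (auto simp: a'_def less_imp_le split: nat.splits)
lemma a'_simps: "a' 0 = 0" "a' (Suc n) = a n" by (simp_all add: a'_def)
lemma L_pos: "0 < L"
proof -
  have "0 < L * h 0" using h_step[of 0] h_pos[of "Suc 0"] by linarith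
  then show ?thesis using h_pos[of 0] by (rule zero_less_mult_pos2)
qed
lemma H_ge_1: "1 \<le> H" using h_quasi_mono[of 0 0] h_pos[of 0] by simp

lemma h_recurrence: "h n = a n * h (Suc n) + b n * h n + a' n * h (n - 1)"
  using recurrence[of 1 n] unfolding h_def mult_1 .

lemma continuous_integrable:
  assumes "continuous_on UNIV (f :: real \<Rightarrow> real)"
  shows "integrable M f"
proof -
  have "compact (f ` {-1..1})"
    by (rule compact_continuous_image[OF continuous_on_subset[OF assms]]) auto
  then have "bounded (f ` {-1..1})" by (rule compact_imp_bounded)
  then obtain B where "\<forall>y\<in>f ` {-1..1}. norm y \<le> B" unfolding bounded_iff by blast
  then have B: "norm (f x) \<le> B" if "x \<in> {-1..1}" for x using that by blast
  have "f \<in> borel_measurable borel" using assms by (rule borel_measurable_continuous_onI)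
  then have "f \<in> borel_measurable (restrict_space borel {-1..1})" by (rule measurable_restrict_space1)
  then have "f \<in> borel_measurable M" unfolding measurable_cong_sets[OF sets_M refl] .
  then show ?thesis
    by (intro integrable_const_bound[where B = B] AE_I2) (use B space_M in auto)
qed

lemmas cont = p_cont continuous_intros

lemma integral_mono_M:
  assumes "continuous_on UNIV f" "continuous_on UNIV g" "\<And>x. -1 \<le> x \<Longrightarrow> x \<le> 1 \<Longrightarrow> f x \<le> (g x :: real)"
  shows "(\<integral>x. f x \<partial>M) \<le> (\<integral>x. g x \<partial>M)"
  using assms by (intro integral_mono continuous_integrable) (auto simp: space_M)

lemma integral_nonneg_M:
  assumes "\<And>x. -1 \<le> x \<Longrightarrow> x \<le> 1 \<Longrightarrow> 0 \<le> (f x :: real)"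
  shows "0 \<le> (\<integral>x. f x \<partial>M)"
  using assms by (intro Bochner_Integration.integral_nonneg_AE AE_I2) (auto simp: space_M)

lemma integral_p_combination:
  assumes "continuous_on UNIV g"
  shows "(\<integral>x. g x * (x * p n x) \<partial>M)
    = a n * (\<integral>x. g x * p (Suc n) x \<partial>M) + b n * (\<integral>x. g x * p n x \<partial>M) + a' n * (\<integral>x. g x * p (n - 1) x \<partial>M)"
proof -
  have "g x * (x * p n x) = a n * (g x * p (Suc n) x) + b n * (g x * p n x) + a' n * (g x * p (n - 1) x)" for x
    unfolding recurrence by (simp add: algebra_simps)
  then have "(\<integral>x. g x * (x * p n x) \<partial>M)
      = (\<integral>x. a n * (g x * p (Suc n) x) + b n * (g x * p n x) + a' n * (g x * p (n - 1) x) \<partial>M)"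
    by (simp only:)
  also have "\<dots> = a n * (\<integral>x. g x * p (Suc n) x \<partial>M) + b n * (\<integral>x. g x * p n x \<partial>M)
      + a' n * (\<integral>x. g x * p (n - 1) x \<partial>M)"
  proof -
    have i: "integrable M (\<lambda>x. g x * p q x)" for q
      by (intro continuous_integrable continuous_on_mult assms p_cont)
    show ?thesis by (simp add: i)
  qed
  finally show ?thesis .
qed

text \<open>
  The entries of the matrix power \<open>(1 + J) ^ i\<close>.
\<close>
definition moment :: "nat \<Rightarrow> nat \<Rightarrow> nat \<Rightarrow> real" where
  "moment i k j = (\<integral>x. (1 + x) ^ i * p k x * p j x \<partial>M)"

lemma moment_0: "moment 0 k j = (if k = j then 1 else 0)"
  by (simp add: moment_def orthonormal)

lemma moment_Suc: "moment (Suc i) k j = a k * moment i (Suc k) j + (1 + b k) * moment i k j + a' k * moment i (k - 1) j"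
proof -
  let ?g = "\<lambda>x. (1 + x) ^ i * p j x"
  have g: "continuous_on UNIV ?g" by (intro cont)
  have "moment (Suc i) k j = (\<integral>x. ?g x * p k x + ?g x * (x * p k x) \<partial>M)"
    unfolding moment_def by (simp add: algebra_simps)
  also have "\<dots> = (\<integral>x. ?g x * p k x \<partial>M) + (\<integral>x. ?g x * (x * p k x) \<partial>M)"
    by (intro Bochner_Integration.integral_add continuous_integrable cont)
  also have "(\<integral>x. ?g x * (x * p k x) \<partial>M) = a k * (\<integral>x. ?g x * p (Suc k) x \<partial>M)
      + b k * (\<integral>x. ?g x * p k x \<partial>M) + a' k * (\<integral>x. ?g x * p (k - 1) x \<partial>M)"
    by (rule integral_p_combination[OF g])
  finally have eq: "moment (Suc i) k j = (\<integral>x. ?g x * p k x \<partial>M) + (a k * (\<integral>x. ?g x * p (Suc k) x \<partial>M)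
      + b k * (\<integral>x. ?g x * p k x \<partial>M) + a' k * (\<integral>x. ?g x * p (k - 1) x \<partial>M))" .
  have "(\<integral>x. ?g x * p q x \<partial>M) = moment i q j" for q
    unfolding moment_def by (simp add: mult_ac)
  note eq[unfolded this]
  then show ?thesis by (simp add: algebra_simps)
qed

text \<open>
  The diagonal entry \<open>1 + b k\<close> is the integral of \<open>(1 + x) * (p k x)\<^sup>2\<close>. Hence \<open>1 + J\<close> has nonnegative
  entries; this makes the heat kernel positive and allows comparison with supersolutions.
\<close>
lemma one_plus_b_nonneg: "0 \<le> 1 + b k"
proof -
  have "moment 1 k k = 1 + b k"
    using moment_Suc[of 0 k k] a'_simps by (cases k) (auto simp: moment_0)
  moreover have "0 \<le> moment 1 k k"
    unfolding moment_def by (rule integral_nonneg_M) (simp add: mult.assoc)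
  ultimately show ?thesis by simp
qed

lemma moment_nonneg: "0 \<le> moment i k j"
proof (induction i arbitrary: k)
  case (Suc i)
  have "0 \<le> (1 + b k) * moment i k j" by (rule mult_nonneg_nonneg[OF one_plus_b_nonneg Suc])
  with Suc show ?case
    unfolding moment_Suc by (simp add: a'_nonneg less_imp_le[OF a_pos])
qed (simp add: moment_0)

text \<open>
  If \<open>(1 + J)(h F) \<le> \<theta> h F\<close>, then \<open>(1 + J) ^ i (h F) \<le> \<theta> ^ i h F\<close>. The recurrence acts on the row index \<open>k\<close>, so
  the sum over the column index can be cut off at any \<open>N\<close>.
\<close>
lemma moment_supersolution:
  assumes F: "\<And>k. 0 \<le> F k" and super: "\<And>k. a k * (h (Suc k) * F (Suc k)) + (1 + b k) * (h k * F k)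
      + a' k * (h (k - 1) * F (k - 1)) \<le> \<theta> * (h k * F k)"
    and \<theta>: "0 \<le> \<theta>"
  shows "(\<Sum>j<N. moment i k j * (h j * F j)) \<le> \<theta> ^ i * (h k * F k)"
proof (induction i arbitrary: k)
  case 0
  have "0 \<le> h k * F k" using h_pos F by (simp add: less_imp_le)
  moreover have "(\<Sum>j<N. moment 0 k j * (h j * F j)) = (if k < N then h k * F k else 0)"
    by (simp add: moment_0 if_distrib[of "\<lambda>x. x * _"] cong: if_cong)
  ultimately show ?case by simp
next
  case (Suc i)
  let ?S = "\<lambda>k. \<Sum>j<N. moment i k j * (h j * F j)"
  have "(\<Sum>j<N. moment (Suc i) k j * (h j * F j)) = a k * ?S (Suc k) + (1 + b k) * ?S k + a' k * ?S (k - 1)"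
    unfolding moment_Suc by (simp add: sum_distrib_left sum.distrib[symmetric] algebra_simps)
  also have "\<dots> \<le> a k * (\<theta> ^ i * (h (Suc k) * F (Suc k))) + (1 + b k) * (\<theta> ^ i * (h k * F k))
      + a' k * (\<theta> ^ i * (h (k - 1) * F (k - 1)))"
    using one_plus_b_nonneg a'_nonneg a_pos
    by (intro add_mono mult_left_mono Suc) (auto simp: less_imp_le)
  also have "\<dots> = \<theta> ^ i * (a k * (h (Suc k) * F (Suc k)) + (1 + b k) * (h k * F k)
      + a' k * (h (k - 1) * F (k - 1)))" by (simp add: algebra_simps)
  also have "\<dots> \<le> \<theta> ^ i * (\<theta> * (h k * F k))"
    using \<theta> super by (intro mult_left_mono) auto
  finally show ?case by (simp add: mult_ac)
qed

text \<open>
  The entries of \<open>exp (- t (1 - J))\<close>.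
\<close>
definition K :: "real \<Rightarrow> nat \<Rightarrow> nat \<Rightarrow> real" where
  "K t m n = (\<integral>x. exp (- ((1 - x) * t)) * p m x * p n x \<partial>M)"

lemma K_sym: "K t m n = K t n m" by (simp add: K_def mult_ac)

text \<open>
  Expansion of \<open>exp (- ((1 - x) * t)) = exp (- 2 * t) * exp (t * (1 + x))\<close>; the shift by \<open>1 + x\<close> gives a series of
  nonnegative terms.
\<close>
lemma K_series:
  assumes t: "0 \<le> t"
  shows "(\<lambda>i. exp (- 2 * t) * (t ^ i / fact i) * moment i k j) sums K t k j"
proof -
  define f where "f = (\<lambda>i x. exp (- 2 * t) * (t ^ i / fact i) * ((1 + x) ^ i * p k x * p j x))"
  have exps: "(\<lambda>i. exp (- 2 * t) * ((t * y) ^ i / fact i)) sums (exp (- 2 * t) * exp (t * y))" for y :: real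
    using sums_mult[OF exp_converges[of "t * y"]] by (simp only: real_scaleR_def divide_inverse_commute)
  have fs: "(\<lambda>i. f i x) sums (exp (- ((1 - x) * t)) * p k x * p j x)" for x
  proof -
    have "(\<lambda>i. exp (- 2 * t) * ((t * (1 + x)) ^ i / fact i) * (p k x * p j x))
        sums (exp (- 2 * t) * exp (t * (1 + x)) * (p k x * p j x))"
      by (intro sums_mult2 exps)
    moreover have "exp (- 2 * t) * exp (t * (1 + x)) = exp (- ((1 - x) * t))"
      by (simp add: exp_add[symmetric] algebra_simps)
    ultimately show ?thesis unfolding f_def by (simp add: power_mult_distrib mult_ac)
  qed
  have int: "integrable M (f i)" for i unfolding f_def by (intro continuous_integrable cont)
  have nf: "norm (f i x) = exp (- 2 * t) * (t ^ i / fact i) * (\<bar>1 + x\<bar> ^ i * \<bar>p k x * p j x\<bar>)" for i x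
    using t by (simp add: f_def abs_mult power_abs)
  have "(\<lambda>i. \<integral>x. f i x \<partial>M) sums (\<integral>x. (\<Sum>i. f i x) \<partial>M)"
  proof (rule sums_integral[OF int])
    show "AE x in M. summable (\<lambda>i. norm (f i x))"
    proof (rule AE_I2)
      fix x
      have "summable (\<lambda>i. exp (- 2 * t) * ((t * \<bar>1 + x\<bar>) ^ i / fact i) * \<bar>p k x * p j x\<bar>)"
        by (intro summable_mult2 sums_summable[OF exps])
      then show "summable (\<lambda>i. norm (f i x))" unfolding nf by (simp add: power_mult_distrib mult_ac)
    qed
    let ?B = "\<integral>x. \<bar>p k x * p j x\<bar> \<partial>M"
    have cabs: "continuous_on UNIV (\<lambda>x. \<bar>p k x * p j x\<bar>)" by (intro continuous_intros p_cont)
    show "summable (\<lambda>i. \<integral>x. norm (f i x) \<partial>M)"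
    proof (rule summable_comparison_test')
      show "summable (\<lambda>i. exp (- 2 * t) * ((t * 2) ^ i / fact i) * ?B)"
        by (intro summable_mult2 sums_summable[OF exps])
      fix i :: nat
      have "(\<integral>x. norm (f i x) \<partial>M) \<le> (\<integral>x. exp (- 2 * t) * ((t * 2) ^ i / fact i) * \<bar>p k x * p j x\<bar> \<partial>M)"
      proof (rule integral_mono_M)
        show "continuous_on UNIV (\<lambda>x. norm (f i x))" unfolding f_def by (intro continuous_on_norm cont)
        show "continuous_on UNIV (\<lambda>x. exp (- 2 * t) * ((t * 2) ^ i / fact i) * \<bar>p k x * p j x\<bar>)"
          by (intro continuous_on_mult continuous_on_const cabs)
        fix x :: real assume x: "-1 \<le> x" "x \<le> 1"
        then have "\<bar>1 + x\<bar> ^ i \<le> 2 ^ i" by (intro power_mono) auto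
        then show "norm (f i x) \<le> exp (- 2 * t) * ((t * 2) ^ i / fact i) * \<bar>p k x * p j x\<bar>"
          unfolding nf power_mult_distrib using t
          by (simp add: mult.assoc divide_right_mono mult_left_mono mult_right_mono)
      qed
      then show "norm (\<integral>x. norm (f i x) \<partial>M) \<le> exp (- 2 * t) * ((t * 2) ^ i / fact i) * ?B"
        using cabs by (simp add: continuous_integrable integral_nonneg_M)
    qed
  qed
  moreover have "(\<integral>x. f i x \<partial>M) = exp (- 2 * t) * (t ^ i / fact i) * moment i k j" for i
    unfolding f_def moment_def by simp
  moreover have "(\<Sum>i. f i x) = exp (- ((1 - x) * t)) * p k x * p j x" for x
    using fs sums_unique by metis
  ultimately show ?thesis by (simp add: K_def)
qed

lemma K_nonneg: "0 \<le> t \<Longrightarrow> 0 \<le> K t k j"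
  by (rule sums_le[OF _ sums_zero K_series]) (auto simp: moment_nonneg)

lemma K_supersolution:
  assumes t: "0 \<le> t" and F: "\<And>k. 0 \<le> F k"
    and super: "\<And>k. a k * (h (Suc k) * F (Suc k)) + (1 + b k) * (h k * F k)
      + a' k * (h (k - 1) * F (k - 1)) \<le> \<theta> * (h k * F k)"
    and \<theta>: "0 \<le> \<theta>"
  shows "(\<Sum>j<N. K t k j * (h j * F j)) \<le> exp ((\<theta> - 2) * t) * (h k * F k)"
proof (rule sums_le)
  show "(\<lambda>i. \<Sum>j<N. exp (- 2 * t) * (t ^ i / fact i) * moment i k j * (h j * F j))
      sums (\<Sum>j<N. K t k j * (h j * F j))"
    by (intro sums_sum sums_mult2 K_series t)
  have "(\<lambda>i. exp (- 2 * t) * ((t * \<theta>) ^ i /\<^sub>R fact i) * (h k * F k))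
      sums (exp (- 2 * t) * exp (t * \<theta>) * (h k * F k))"
    by (intro sums_mult2 sums_mult exp_converges)
  moreover have "exp (- 2 * t) * exp (t * \<theta>) = exp ((\<theta> - 2) * t)"
    by (simp add: exp_add[symmetric] algebra_simps)
  ultimately show "(\<lambda>i. exp (- 2 * t) * (t ^ i / fact i) * (\<theta> ^ i * (h k * F k)))
      sums (exp ((\<theta> - 2) * t) * (h k * F k))"
    by (simp add: power_mult_distrib field_simps)
  show "(\<Sum>j<N. exp (- 2 * t) * (t ^ i / fact i) * moment i k j * (h j * F j))
      \<le> exp (- 2 * t) * (t ^ i / fact i) * (\<theta> ^ i * (h k * F k))" for i
  proof -
    have "(\<Sum>j<N. exp (- 2 * t) * (t ^ i / fact i) * moment i k j * (h j * F j))
        = exp (- 2 * t) * (t ^ i / fact i) * (\<Sum>j<N. moment i k j * (h j * F j))"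
      by (simp only: sum_distrib_left mult.assoc)
    also have "\<dots> \<le> exp (- 2 * t) * (t ^ i / fact i) * (\<theta> ^ i * (h k * F k))"
      using t by (intro mult_left_mono moment_supersolution F super \<theta>) auto
    finally show ?thesis .
  qed
qed

text \<open>
  To the right of \<open>k0\<close> the function \<open>F\<close> grows like \<open>exp (s * (j - k0))\<close>, to the left it is constant. Jumps of
  size one change it by a relative amount of order \<open>s\<^sup>2\<close> on average, plus the drift times \<open>s * sinh\<close>. The drift
  is only of order \<open>1 / (k + 1)\<close>, but \<open>sinh y \<le> y * cosh y\<close> with \<open>y \<le> s * (k + 1)\<close> makes up for it. As
  \<open>F\<close> is constant on the left of \<open>k0\<close>, a one-sided bound for the drift is enough.
\<close>
lemma cosh_supersolution:
  fixes k0 :: nat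
  assumes s: "0 \<le> s" "s \<le> 1"
  defines "F \<equiv> \<lambda>j. cosh (s * real (j - k0))"
  shows "a k * (h (Suc k) * F (Suc k)) + (1 + b k) * (h k * F k) + a' k * (h (k - 1) * F (k - 1))
    \<le> (2 + (2 + 2 * L) * s\<^sup>2) * (h k * F k)"
proof -
  let ?P = "a k * h (Suc k)" and ?Q = "a' k * h (k - 1)"
  have P: "0 \<le> ?P" and Q: "0 \<le> ?Q"
    using a_pos a'_nonneg h_pos by (auto simp: less_imp_le)
  have PQ: "?P + ?Q = (1 - b k) * h k" using h_recurrence[of k] by (simp add: algebra_simps)
  also have "\<dots> \<le> 2 * h k" using one_plus_b_nonneg[of k] h_pos[of k] by (intro mult_right_mono) auto
  finally have PQ2: "?P + ?Q \<le> 2 * h k" .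
  have F: "0 \<le> F j" for j by (simp add: F_def less_imp_le)
  have "?P * (F (Suc k) - F k) + ?Q * (F (k - 1) - F k) \<le> (2 + 2 * L) * s\<^sup>2 * (h k * F k)"
  proof (cases k k0 rule: linorder_cases)
    case less
    then have "F (Suc k) = 1" "F k = 1" "F (k - 1) = 1" by (auto simp: F_def)
    then show ?thesis using L_pos h_pos[of k] by simp
  next
    case equal
    then have e: "F (Suc k) = cosh s" "F k = 1" "F (k - 1) = 1" by (auto simp: F_def Suc_diff_le)
    have "?P * (cosh s - 1) \<le> (2 * h k) * s\<^sup>2"
      by (rule mult_mono) (use cosh_le_quadratic(1)[OF s] P Q PQ2 h_pos[of k] cosh_real_ge_1[of s] in auto)
    also have "\<dots> \<le> (2 + 2 * L) * s\<^sup>2 * h k"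
      using L_pos h_pos[of k] by (simp add: algebra_simps)
    finally show ?thesis unfolding e by simp
  next
    case greater
    define y where "y = s * real (k - k0)"
    have y: "0 \<le> y" "y \<le> s * (real k + 1)"
      using s unfolding y_def by (auto intro!: mult_left_mono)
    have "s * real (Suc k - k0) = y + s" "s * real (k - 1 - k0) = y - s"
      using greater by (auto simp: y_def Suc_diff_le of_nat_diff algebra_simps)
    then have e: "F (Suc k) = cosh y * cosh s + sinh y * sinh s" "F k = cosh y"
      "F (k - 1) = cosh y * cosh s - sinh y * sinh s"
      by (auto simp: F_def y_def[symmetric] cosh_add cosh_diff)
    have "?P * (F (Suc k) - F k) + ?Q * (F (k - 1) - F k)
        = (?P + ?Q) * (cosh y * (cosh s - 1)) + (?P - ?Q) * (sinh y * sinh s)"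
      unfolding e by (simp add: algebra_simps)
    also have "(?P + ?Q) * (cosh y * (cosh s - 1)) \<le> (2 * h k) * (cosh y * s\<^sup>2)"
      using cosh_le_quadratic(1)[OF s] P Q PQ2 h_pos[of k] cosh_real_ge_1[of s]
      by (intro mult_mono[of "?P + ?Q"] mult_left_mono) (auto simp: less_imp_le)
    also have "(?P - ?Q) * (sinh y * sinh s) \<le> (L / (real k + 1) * h k) * (sinh y * sinh s)"
      using y s by (intro mult_right_mono drift) auto
    also have "\<dots> \<le> (L / (real k + 1) * h k) * ((y * cosh y) * (2 * s))"
      using y s L_pos h_pos[of k] sinh_le_mult_cosh[OF y(1)] cosh_le_quadratic(2)[OF s]
      by (intro mult_left_mono mult_mono) (auto simp: less_imp_le)
    also have "\<dots> \<le> (L / (real k + 1) * h k) * ((s * (real k + 1) * cosh y) * (2 * s))"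
      using y s L_pos h_pos[of k] by (intro mult_left_mono mult_right_mono) (auto simp: less_imp_le)
    also have "(2 * h k) * (cosh y * s\<^sup>2) + \<dots> = (2 + 2 * L) * s\<^sup>2 * (h k * cosh y)"
      by (simp add: field_simps power2_eq_square)
    finally show ?thesis unfolding e by simp
  qed
  moreover have "a k * (h (Suc k) * F (Suc k)) + (1 + b k) * (h k * F k) + a' k * (h (k - 1) * F (k - 1))
      = 2 * h k * F k + (?P * (F (Suc k) - F k) + ?Q * (F (k - 1) - F k))"
  proof -
    have "(1 + b k) * (h k * F k) = (2 * h k - (?P + ?Q)) * F k" unfolding PQ by (simp add: algebra_simps)
    then show ?thesis by (simp add: algebra_simps)
  qed
  ultimately show ?thesis by (simp add: algebra_simps)
qed

text \<open>
  Exponential Chebyshev inequality: for \<open>j \<ge> m \<ge> k\<close> the weight \<open>h j * F j\<close> is at least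
  \<open>h k / H * exp (s * (m - k)) / 2\<close>. Without quasi-monotonicity of \<open>h\<close> this would bound the tail of the chain,
  but not that of the kernel.
\<close>
lemma K_upper_tail:
  assumes t: "0 \<le> t" and s: "0 \<le> s" "s \<le> 1" and km: "k \<le> m"
  shows "(\<Sum>j=m..<N. K t k j) \<le> 2 * H * exp ((2 + 2 * L) * s\<^sup>2 * t) * exp (- (s * (real m - real k)))"
proof -
  let ?F = "\<lambda>j. cosh (s * real (j - k))" and ?E = "exp ((2 + 2 * L) * s\<^sup>2 * t)"
  let ?e = "exp (s * (real m - real k))"
  have "(\<Sum>j=m..<N. K t k j) * (h k / H * (?e / 2)) \<le> (\<Sum>j<N. K t k j * (h j * ?F j))"
  proof -
    have "(\<Sum>j=m..<N. K t k j) * (h k / H * (?e / 2)) \<le> (\<Sum>j=m..<N. K t k j * (h j * ?F j))"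
      unfolding sum_distrib_right
    proof (intro sum_mono mult_left_mono mult_mono K_nonneg t)
      fix j assume "j \<in> {m..<N}"
      then have j: "m \<le> j" by simp
      then show "h k / H \<le> h j" using h_quasi_mono[of k j] km H_ge_1 by (simp add: field_simps)
      have "?e \<le> exp (s * real (j - k))"
        using s j km by (simp add: mult_left_mono of_nat_diff)
      then show "?e / 2 \<le> ?F j" unfolding cosh_field_def by (simp add: add_increasing2)
    qed (use h_pos in \<open>auto simp: less_imp_le\<close>)
    also have "\<dots> \<le> (\<Sum>j<N. K t k j * (h j * ?F j))"
      by (rule sum_mono2) (use h_pos K_nonneg t in \<open>auto simp: less_imp_le\<close>)
    finally show ?thesis .
  qed
  also have "\<dots> \<le> exp ((2 + (2 + 2 * L) * s\<^sup>2 - 2) * t) * (h k * ?F k)"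
    using t L_pos by (intro K_supersolution cosh_supersolution s) (auto simp: less_imp_le)
  also have "\<dots> = ?E * h k" by simp
  finally have "(\<Sum>j=m..<N. K t k j) * ?e * h k \<le> 2 * H * ?E * h k"
    using H_ge_1 by (simp add: field_simps)
  then have "(\<Sum>j=m..<N. K t k j) * ?e \<le> 2 * H * ?E" using h_pos[of k] by simp
  moreover have "exp (- (s * (real m - real k))) = 1 / ?e" by (simp only: exp_minus inverse_eq_divide)
  ultimately show ?thesis by (simp add: pos_le_divide_eq)
qed

lemma bessel_inequality:
  assumes g: "continuous_on UNIV g"
  shows "(\<Sum>j<N. (\<integral>x. g x * p j x \<partial>M)\<^sup>2) \<le> (\<integral>x. (g x)\<^sup>2 \<partial>M)"
proof -
  define u where "u = (\<lambda>j. \<integral>x. g x * p j x \<partial>M)"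
  define s where "s = (\<lambda>x. \<Sum>j<N. u j * p j x)"
  have s: "continuous_on UNIV s" unfolding s_def by (intro cont)
  have igp: "integrable M (\<lambda>x. g x * p j x)" for j by (intro continuous_integrable cont g)
  have ipp: "integrable M (\<lambda>x. p i x * p j x)" for i j by (intro continuous_integrable cont)
  have isp: "integrable M (\<lambda>x. s x * p j x)" for j by (intro continuous_integrable cont s)
  have gs: "(\<integral>x. g x * s x \<partial>M) = (\<Sum>j<N. (u j)\<^sup>2)"
  proof -
    have "(\<integral>x. g x * s x \<partial>M) = (\<integral>x. (\<Sum>j<N. u j * (g x * p j x)) \<partial>M)"
      unfolding s_def by (simp add: sum_distrib_left mult_ac)
    also have "\<dots> = (\<Sum>j<N. u j * (\<integral>x. g x * p j x \<partial>M))"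
      by (subst Bochner_Integration.integral_sum) (auto intro!: integrable_mult_right igp)
    finally show ?thesis by (simp add: u_def power2_eq_square)
  qed
  have sp: "(\<integral>x. s x * p j x \<partial>M) = u j" if "j < N" for j
  proof -
    have "(\<integral>x. s x * p j x \<partial>M) = (\<integral>x. (\<Sum>i<N. u i * (p i x * p j x)) \<partial>M)"
      unfolding s_def by (simp add: sum_distrib_right mult.assoc)
    also have "\<dots> = (\<Sum>i<N. u i * (\<integral>x. p i x * p j x \<partial>M))"
      by (subst Bochner_Integration.integral_sum) (auto intro!: integrable_mult_right ipp)
    also have "\<dots> = u j"
      unfolding orthonormal using that by (simp add: if_distrib[of "\<lambda>x. _ * x"] cong: if_cong)
    finally show ?thesis .
  qed
  have ss: "(\<integral>x. s x * s x \<partial>M) = (\<Sum>j<N. (u j)\<^sup>2)"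
  proof -
    have "(\<integral>x. s x * s x \<partial>M) = (\<integral>x. (\<Sum>j<N. u j * (s x * p j x)) \<partial>M)"
      by (subst (2) s_def) (simp add: sum_distrib_left mult_ac)
    also have "\<dots> = (\<Sum>j<N. u j * (\<integral>x. s x * p j x \<partial>M))"
      by (subst Bochner_Integration.integral_sum) (auto intro!: integrable_mult_right isp)
    also have "\<dots> = (\<Sum>j<N. u j * u j)" by (rule sum.cong) (auto simp: sp)
    finally show ?thesis by (simp add: power2_eq_square)
  qed
  have "0 \<le> (\<integral>x. (g x - s x)\<^sup>2 \<partial>M)" by (rule integral_nonneg_M) simp
  also have "\<dots> = (\<integral>x. (g x)\<^sup>2 - 2 * (g x * s x) + s x * s x \<partial>M)"
    by (simp add: power2_eq_square algebra_simps)
  also have "\<dots> = (\<integral>x. (g x)\<^sup>2 \<partial>M) - 2 * (\<integral>x. g x * s x \<partial>M) + (\<integral>x. s x * s x \<partial>M)"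
  proof -
    have "integrable M (\<lambda>x. (g x)\<^sup>2)" "integrable M (\<lambda>x. g x * s x)" "integrable M (\<lambda>x. s x * s x)"
      by (intro continuous_integrable cont g s)+
    then show ?thesis by simp
  qed
  finally show ?thesis unfolding gs ss by (simp add: u_def)
qed

lemma a_le_1: "a n \<le> 1"
proof -
  have "(\<integral>x. p (Suc n) x * (x * p n x) \<partial>M) = a n"
    by (subst integral_p_combination[OF p_cont]) (auto simp: orthonormal)
  moreover have "(\<integral>x. p (Suc n) x * (x * p n x) \<partial>M)
      \<le> (\<integral>x. 1 / 2 * (p (Suc n) x * p (Suc n) x + p n x * p n x) \<partial>M)"
  proof (rule integral_mono_M)
    show "continuous_on UNIV (\<lambda>x. p (Suc n) x * (x * p n x))" by (intro cont)
    show "continuous_on UNIV (\<lambda>x. 1 / 2 * (p (Suc n) x * p (Suc n) x + p n x * p n x))" by (intro cont)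
    fix x :: real assume x: "-1 \<le> x" "x \<le> 1"
    let ?y = "p (Suc n) x * p n x"
    have "p (Suc n) x * (x * p n x) = x * ?y" by simp
    also have "\<dots> \<le> \<bar>x\<bar> * \<bar>?y\<bar>" by (metis abs_ge_self abs_mult)
    also have "\<dots> \<le> \<bar>?y\<bar>" using x by (intro mult_left_le_one_le) auto
    also have "\<dots> \<le> 1 / 2 * (p (Suc n) x * p (Suc n) x + p n x * p n x)"
      using sum_squares_bound[of "\<bar>p (Suc n) x\<bar>" "\<bar>p n x\<bar>"] by (simp add: abs_mult power2_eq_square)
    finally show "p (Suc n) x * (x * p n x) \<le> 1 / 2 * (p (Suc n) x * p (Suc n) x + p n x * p n x)" .
  qed
  moreover have "(\<integral>x. 1 / 2 * (p (Suc n) x * p (Suc n) x + p n x * p n x) \<partial>M) = 1"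
  proof -
    have i: "integrable M (\<lambda>x. p q x * p q x)" for q by (intro continuous_integrable cont)
    show ?thesis by (simp add: i orthonormal)
  qed
  ultimately show ?thesis by simp
qed

text \<open>
  The contribution of the edge between \<open>j\<close> and \<open>j + 1\<close> to the quadratic form of \<open>1 - J\<close>, written in terms of
  \<open>u / h\<close>, where the form has no zeroth-order term.
\<close>
definition energy :: "(nat \<Rightarrow> real) \<Rightarrow> nat \<Rightarrow> real" where
  "energy u j = a j * h j * h (Suc j) * (u j / h j - u (Suc j) / h (Suc j))\<^sup>2"

lemma energy_nonneg: "0 \<le> energy u j"
  unfolding energy_def using a_pos h_pos by (intro mult_nonneg_nonneg) (auto simp: less_imp_le)

text \<open>
  With \<open>v = u / h\<close> and the flux \<open>J j = a j * h j * h (j + 1) * (v j - v (j + 1))\<close>, the recurrence for \<open>h\<close> gives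
  \<open>h * (1 - J) u = J j - J (j - 1)\<close>.
\<close>
lemma energy_summation_by_parts:
  "(\<Sum>j<N. energy u j) + u N / h N * (a N * h N * h (Suc N) * (u N / h N - u (Suc N) / h (Suc N)))
    = (\<Sum>j\<le>N. u j * (u j - (a j * u (Suc j) + b j * u j + a' j * u (j - 1))))"
proof -
  define v where "v = (\<lambda>j. u j / h j)"
  define J where "J = (\<lambda>j. a j * h j * h (Suc j) * (v j - v (Suc j)))"
  have u: "u j = h j * v j" for j using h_pos[of j] by (simp add: v_def)
  have flux: "h j * (u j - (a j * u (Suc j) + b j * u j + a' j * u (j - 1)))
      = J j - a' j * h (j - 1) * h j * (v (j - 1) - v j)" for j
  proof -
    have "h j * (u j - (a j * u (Suc j) + b j * u j + a' j * u (j - 1)))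
      = h j * (h j * v j - (a j * (h (Suc j) * v (Suc j)) + b j * (h j * v j) + a' j * (h (j - 1) * v (j - 1))))"
      by (simp only: u)
    also have "\<dots> = h j * v j * h j - h j * (a j * (h (Suc j) * v (Suc j)) + b j * (h j * v j) + a' j * (h (j - 1) * v (j - 1)))"
      by (simp add: algebra_simps)
    also have "h j * v j * h j = h j * v j * (a j * h (Suc j) + b j * h j + a' j * h (j - 1))"
      using h_recurrence[of j] by simp
    finally show ?thesis by (simp add: J_def algebra_simps)
  qed
  have e: "energy u j = J j * (v j - v (Suc j))" for j
    by (simp add: energy_def J_def v_def power2_eq_square)
  let ?w = "\<lambda>j. u j - (a j * u (Suc j) + b j * u j + a' j * u (j - 1))"
  have uw: "u j * ?w j = v j * (h j * ?w j)" for j by (simp add: u mult_ac)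
  have "(\<Sum>j<N. energy u j) + v N * J N = (\<Sum>j\<le>N. u j * ?w j)"
  proof (induction N)
    case 0
    show ?case using uw[of 0] unfolding flux by (simp add: a'_simps)
  next
    case (Suc N)
    have "u (Suc N) * ?w (Suc N) = v (Suc N) * (J (Suc N) - J N)"
      unfolding uw flux by (simp add: a'_simps J_def)
    then have "(\<Sum>j\<le>Suc N. u j * ?w j) = (\<Sum>j<N. energy u j) + v N * J N + v (Suc N) * (J (Suc N) - J N)"
      using Suc by simp
    then show ?case by (simp add: e algebra_simps)
  qed
  then show ?thesis by (simp add: v_def J_def)
qed

text \<open>
  The boundary term is at least \<open>- u n * u (n + 1)\<close>, which tends to zero.
\<close>
lemma energy_sum_le:
  assumes u0: "u \<longlonglongrightarrow> 0" and u: "\<And>j. 0 \<le> u j"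
    and B: "\<And>N. (\<Sum>j\<le>N. u j * (u j - (a j * u (Suc j) + b j * u j + a' j * u (j - 1)))) \<le> B"
  shows "(\<Sum>j<N. energy u j) \<le> B"
proof -
  have "(\<lambda>n. B + u n * u (Suc n)) \<longlonglongrightarrow> B + 0 * 0"
    by (intro tendsto_intros u0 LIMSEQ_Suc)
  moreover have "(\<Sum>j<N. energy u j) \<le> B + u n * u (Suc n)" if n: "N \<le> n" for n
  proof -
    have "(\<Sum>j<N. energy u j) \<le> (\<Sum>j<n. energy u j)"
      by (rule sum_mono2) (use n energy_nonneg in auto)
    also have "\<dots> = (\<Sum>j\<le>n. u j * (u j - (a j * u (Suc j) + b j * u j + a' j * u (j - 1))))
        - a n * (h (Suc n) / h n) * (u n)\<^sup>2 + a n * (u n * u (Suc n))"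
    proof -
      have "u n / h n * (a n * h n * h (Suc n) * (u n / h n - u (Suc n) / h (Suc n)))
          = a n * (h (Suc n) / h n) * (u n)\<^sup>2 - a n * (u n * u (Suc n))"
        using h_pos[of n] h_pos[of "Suc n"] by (simp add: field_simps power2_eq_square)
      then show ?thesis using energy_summation_by_parts[of u n] by linarith
    qed
    also have "\<dots> \<le> B + 1 * (u n * u (Suc n))"
    proof -
      have "0 \<le> a n * (h (Suc n) / h n) * (u n)\<^sup>2" using a_pos h_pos by (simp add: less_imp_le)
      moreover have "a n * (u n * u (Suc n)) \<le> 1 * (u n * u (Suc n))"
        using u a_le_1 by (intro mult_right_mono) auto
      ultimately show ?thesis using B[of n] by linarith
    qed
    finally show ?thesis by simp
  qed
  ultimately show ?thesis by (intro LIMSEQ_le_const) auto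
qed

definition interp_const :: real where "interp_const = H\<^sup>2 * (1 / c + L + H)"

lemma interp_const_pos: "0 < interp_const"
  unfolding interp_const_def using H_ge_1 L_pos c_pos by (intro mult_pos_pos add_pos_pos) auto

text \<open>
  Write \<open>(u m)\<^sup>2 = (h m)\<^sup>2 (v m)\<^sup>2\<close> with \<open>v = u / h\<close> as a telescoping sum of \<open>(h m)\<^sup>2 ((v j)\<^sup>2 - (v (j + 1))\<^sup>2)\<close> over
  \<open>j \<ge> m\<close>. As \<open>h\<close> is increasing up to the factor \<open>H\<close>, \<open>(h m)\<^sup>2\<close> may be replaced by \<open>h j * h (j + 1)\<close>, and each
  term is a product of a square root of the energy and a value of \<open>u\<close>. The parameter \<open>l\<close> takes the place of
  the Cauchy-Schwarz inequality; its best choice is \<open>sqrt (T / E)\<close>.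
\<close>
lemma sup_norm_interpolation:
  assumes u0: "u \<longlonglongrightarrow> 0"
    and E: "\<And>N. (\<Sum>j<N. energy u j) \<le> E" and T: "\<And>N. (\<Sum>j=m..<N. (u j)\<^sup>2) \<le> T"
    and l: "0 < l"
  shows "(u m)\<^sup>2 \<le> interp_const * (l * E + T / l)"
proof -
  define v where "v = (\<lambda>j. u j / h j)"
  have v: "h j * v j = u j" for j using h_pos[of j] by (simp add: v_def)
  have T0: "0 \<le> T" using T[of m] by simp
  have E0: "0 \<le> E" using E[of 0] by simp
  \<comment> \<open>The arithmetic-geometric mean inequality with the parameter \<open>l\<close> splits each term.\<close>
  have step: "(h m)\<^sup>2 * ((v j)\<^sup>2 - (v (Suc j))\<^sup>2)
      \<le> H\<^sup>2 / 2 * (l * energy u j / c + 2 / l * (L * (u j)\<^sup>2 + H * (u (Suc j))\<^sup>2))"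
    if j: "m \<le> j" for j
  proof -
    let ?hh = "h j * h (Suc j)" and ?d = "\<bar>v j - v (Suc j)\<bar>" and ?s = "\<bar>v j + v (Suc j)\<bar>"
    have hh: "0 < ?hh" using h_pos by simp
    have "(h m)\<^sup>2 \<le> (H * h j) * (H * h (Suc j))"
      unfolding power2_eq_square using h_quasi_mono[of m j] h_quasi_mono[of m "Suc j"] h_pos[of m] j
      by (intro mult_mono) auto
    then have hm: "(h m)\<^sup>2 \<le> H\<^sup>2 * ?hh" by (simp add: power2_eq_square mult_ac)
    have "(h m)\<^sup>2 * ((v j)\<^sup>2 - (v (Suc j))\<^sup>2) \<le> (h m)\<^sup>2 * (?d * ?s)"
      by (intro mult_left_mono) (auto simp: abs_mult[symmetric] power2_eq_square algebra_simps intro: order_trans[OF _ abs_ge_self])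
    also have "\<dots> \<le> H\<^sup>2 * ?hh * (?d * ?s)" by (intro mult_right_mono hm) auto
    also have "?d * ?s \<le> 1 / 2 * (l * ?d\<^sup>2 + ?s\<^sup>2 / l)"
    proof -
      have "0 \<le> (l * ?d - ?s)\<^sup>2" by simp
      then have "2 * l * (?d * ?s) \<le> l\<^sup>2 * ?d\<^sup>2 + ?s\<^sup>2" by (simp add: power2_diff power_mult_distrib)
      then show ?thesis using l by (simp add: field_simps power2_eq_square)
    qed
    then have "H\<^sup>2 * ?hh * (?d * ?s) \<le> H\<^sup>2 * ?hh * (1 / 2 * (l * ?d\<^sup>2 + ?s\<^sup>2 / l))"
      using hh by (intro mult_left_mono) auto
    also have "\<dots> = H\<^sup>2 / 2 * (l * (?hh * ?d\<^sup>2) + 1 / l * (?hh * ?s\<^sup>2))"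
      by (simp add: algebra_simps)
    also have "\<dots> \<le> H\<^sup>2 / 2 * (l * energy u j / c + 2 / l * (L * (u j)\<^sup>2 + H * (u (Suc j))\<^sup>2))"
    proof (intro mult_left_mono add_mono)
      have "c * (?hh * ?d\<^sup>2) \<le> a j * (?hh * ?d\<^sup>2)" using a_lower hh by (intro mult_right_mono) auto
      also have "\<dots> = energy u j" by (simp add: energy_def v_def)
      finally have "?hh * ?d\<^sup>2 \<le> energy u j / c" using c_pos by (simp add: field_simps)
      then have "l * (?hh * ?d\<^sup>2) \<le> l * (energy u j / c)" using l by (intro mult_left_mono) auto
      then show "l * (?hh * ?d\<^sup>2) \<le> l * energy u j / c" by simp
      have "?s\<^sup>2 \<le> 2 * ((v j)\<^sup>2 + (v (Suc j))\<^sup>2)"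
        using sum_squares_bound[of "v j" "v (Suc j)"] by (simp add: power2_sum)
      then have "?hh * ?s\<^sup>2 \<le> ?hh * (2 * ((v j)\<^sup>2 + (v (Suc j))\<^sup>2))" using hh by (intro mult_left_mono) auto
      also have "\<dots> = 2 * (h (Suc j) * (h j * (v j)\<^sup>2) + h j * (h (Suc j) * (v (Suc j))\<^sup>2))"
        by (simp add: algebra_simps)
      also have "\<dots> \<le> 2 * ((L * h j) * (h j * (v j)\<^sup>2) + (H * h (Suc j)) * (h (Suc j) * (v (Suc j))\<^sup>2))"
        using h_step[of j] h_quasi_mono[of j "Suc j"] h_pos
        by (intro mult_left_mono add_mono mult_right_mono) (auto simp: less_imp_le)
      also have "\<dots> = 2 * (L * (h j * v j)\<^sup>2 + H * (h (Suc j) * v (Suc j))\<^sup>2)"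
        by (simp add: power_mult_distrib power2_eq_square algebra_simps)
      finally have "?hh * ?s\<^sup>2 \<le> 2 * (L * (u j)\<^sup>2 + H * (u (Suc j))\<^sup>2)" unfolding v .
      then have "1 / l * (?hh * ?s\<^sup>2) \<le> 1 / l * (2 * (L * (u j)\<^sup>2 + H * (u (Suc j))\<^sup>2))"
        using l by (intro mult_left_mono) auto
      then show "1 / l * (?hh * ?s\<^sup>2) \<le> 2 / l * (L * (u j)\<^sup>2 + H * (u (Suc j))\<^sup>2)" by simp
    qed simp
    finally show ?thesis .
  qed
  have bound: "(u m)\<^sup>2 - H\<^sup>2 * (u n)\<^sup>2 \<le> interp_const * (l * E + T / l)" if n: "m \<le> n" for n
  proof -
    have "(u m)\<^sup>2 - (h m)\<^sup>2 * (v n)\<^sup>2 = (h m)\<^sup>2 * ((v m)\<^sup>2 - (v n)\<^sup>2)"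
      by (simp add: v[symmetric] power_mult_distrib algebra_simps)
    also have "\<dots> = (\<Sum>j=m..<n. (h m)\<^sup>2 * ((v j)\<^sup>2 - (v (Suc j))\<^sup>2))"
      using sum_Suc_diff'[OF n, of "\<lambda>j. - (v j)\<^sup>2"] by (simp add: sum_distrib_left[symmetric])
    also have "\<dots> \<le> (\<Sum>j=m..<n. H\<^sup>2 / 2 * (l * energy u j / c + 2 / l * (L * (u j)\<^sup>2 + H * (u (Suc j))\<^sup>2)))"
      by (intro sum_mono step) auto
    also have "\<dots> = H\<^sup>2 / 2 * (l / c * (\<Sum>j=m..<n. energy u j)
        + 2 / l * (L * (\<Sum>j=m..<n. (u j)\<^sup>2) + H * (\<Sum>j=m..<n. (u (Suc j))\<^sup>2)))"
      by (simp add: sum_distrib_left sum.distrib algebra_simps)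
    also have "\<dots> \<le> H\<^sup>2 / 2 * (l / c * E + 2 / l * (L * T + H * T))"
    proof (intro mult_left_mono add_mono)
      have "(\<Sum>j=m..<n. energy u j) \<le> (\<Sum>j<n. energy u j)"
        by (rule sum_mono2) (use energy_nonneg in auto)
      then show "(\<Sum>j=m..<n. energy u j) \<le> E" using E[of n] by linarith
      have "(\<Sum>j=m..<n. (u (Suc j))\<^sup>2) = (\<Sum>j=Suc m..<Suc n. (u j)\<^sup>2)"
        by (rule sum.shift_bounds_Suc_ivl[symmetric])
      also have "\<dots> \<le> (\<Sum>j=m..<Suc n. (u j)\<^sup>2)" by (rule sum_mono2) auto
      finally show "(\<Sum>j=m..<n. (u (Suc j))\<^sup>2) \<le> T" using T[of "Suc n"] by linarith
    qed (use l c_pos L_pos H_ge_1 T in auto)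
    also have "\<dots> \<le> interp_const * (l * E + T / l)"
    proof -
      have "0 < 1 / c" using c_pos by simp
      then have "1 / 2 * (1 / c) \<le> 1 / c + L + H" using L_pos H_ge_1 by linarith
      then have "1 / 2 * (1 / c) * (l * E) \<le> (1 / c + L + H) * (l * E)"
        using l E0 by (intro mult_right_mono) auto
      moreover have "(L + H) * (T / l) \<le> (1 / c + L + H) * (T / l)"
        using l T0 c_pos by (intro mult_right_mono) auto
      ultimately have "1 / 2 * (1 / c) * (l * E) + (L + H) * (T / l) \<le> (1 / c + L + H) * (l * E + T / l)"
        by (simp add: distrib_left)
      then have "H\<^sup>2 * (1 / 2 * (1 / c) * (l * E) + (L + H) * (T / l)) \<le> H\<^sup>2 * ((1 / c + L + H) * (l * E + T / l))"
        by (rule mult_left_mono) simp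
      moreover have "H\<^sup>2 / 2 * (l / c * E + 2 / l * (L * T + H * T))
          = H\<^sup>2 * (1 / 2 * (1 / c) * (l * E) + (L + H) * (T / l))"
        using l c_pos by (simp add: field_simps)
      ultimately show ?thesis unfolding interp_const_def by (simp only: mult.assoc)
    qed
    finally have "(u m)\<^sup>2 - (h m)\<^sup>2 * (v n)\<^sup>2 \<le> interp_const * (l * E + T / l)" .
    moreover have "(h m)\<^sup>2 * (v n)\<^sup>2 \<le> (H * h n)\<^sup>2 * (v n)\<^sup>2"
      using h_quasi_mono[OF n] h_pos[of m] by (intro mult_right_mono power_mono) auto
    moreover have "(H * h n)\<^sup>2 * (v n)\<^sup>2 = H\<^sup>2 * (u n)\<^sup>2" by (simp add: v[symmetric] power_mult_distrib)
    ultimately show ?thesis by linarith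
  qed
  have "(\<lambda>n. (u m)\<^sup>2 - H\<^sup>2 * (u n)\<^sup>2) \<longlonglongrightarrow> (u m)\<^sup>2 - H\<^sup>2 * 0\<^sup>2"
    by (intro tendsto_intros u0)
  then have "(u m)\<^sup>2 - H\<^sup>2 * 0\<^sup>2 \<le> interp_const * (l * E + T / l)"
    using bound by (intro LIMSEQ_le_const2) auto
  then show ?thesis by simp
qed

lemma K_row_square_sum:
  assumes "0 \<le> t"
  shows "(\<Sum>j<N. (K t k j)\<^sup>2) \<le> K (2 * t) k k" and "K (2 * t) k k \<le> K t k k"
proof -
  let ?g = "\<lambda>x. exp (- ((1 - x) * t)) * p k x"
  have "(\<Sum>j<N. (K t k j)\<^sup>2) \<le> (\<integral>x. (?g x)\<^sup>2 \<partial>M)"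
    unfolding K_def by (rule bessel_inequality) (intro cont)
  moreover have "(?g x)\<^sup>2 = exp (- ((1 - x) * (2 * t))) * p k x * p k x" for x
  proof -
    have "- ((1 - x) * (2 * t)) = - ((1 - x) * t) + - ((1 - x) * t)" by (simp add: algebra_simps)
    then have "exp (- ((1 - x) * (2 * t))) = exp (- ((1 - x) * t)) * exp (- ((1 - x) * t))"
      by (simp only: exp_add)
    then show ?thesis by (simp add: power2_eq_square)
  qed
  ultimately show "(\<Sum>j<N. (K t k j)\<^sup>2) \<le> K (2 * t) k k" unfolding K_def by simp
  show "K (2 * t) k k \<le> K t k k"
    unfolding K_def mult.assoc
  proof (rule integral_mono_M)
    fix x :: real assume "-1 \<le> x" "x \<le> 1"
    then have "0 \<le> (1 - x) * t" using assms by simp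
    then have "(1 - x) * t \<le> (1 - x) * (2 * t)" by (simp add: algebra_simps)
    then have "exp (- ((1 - x) * (2 * t))) \<le> exp (- ((1 - x) * t))" by (simp only: exp_le_cancel_iff neg_le_iff_le)
    then show "exp (- ((1 - x) * (2 * t))) * (p k x * p k x) \<le> exp (- ((1 - x) * t)) * (p k x * p k x)"
      by (rule mult_right_mono) simp
  qed (intro cont)+
qed

lemma K_row_tendsto_0:
  assumes "0 \<le> t"
  shows "K t k \<longlonglongrightarrow> 0"
proof -
  have "summable (\<lambda>j. (K t k j)\<^sup>2)"
    by (rule summableI_nonneg_bounded[of _ "K (2 * t) k k"]) (use K_row_square_sum(1)[OF assms] in auto)
  then have "(\<lambda>j. (K t k j)\<^sup>2) \<longlonglongrightarrow> 0" by (rule summable_LIMSEQ_zero)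
  then show ?thesis by simp
qed

text \<open>
  For \<open>g x = exp (- ((1 - x) * t)) * p k x\<close> the entries of \<open>K t k\<close> are the coefficients of \<open>g\<close>, and those of
  \<open>(1 - J) (K t k)\<close> are the coefficients of \<open>(1 - x) * g x\<close>. Bessel's inequality and \<open>z\<^sup>2 * exp (- z) \<le> 2\<close> for
  \<open>z = (1 - x) * t\<close> bound both by \<open>K t k k\<close>.
\<close>
lemma K_energy:
  assumes t: "0 < t"
  shows "(\<Sum>j<N. energy (K t k) j) \<le> 3 / 2 * K t k k / t"
proof (rule energy_sum_le)
  fix N
  let ?g = "\<lambda>x. exp (- ((1 - x) * t)) * p k x" and ?u = "K t k"
  define w where "w = (\<lambda>j. \<integral>x. ((1 - x) * ?g x) * p j x \<partial>M)"
  have g: "continuous_on UNIV ?g" by (intro cont)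
  have w: "?u j - (a j * ?u (Suc j) + b j * ?u j + a' j * ?u (j - 1)) = w j" for j
  proof -
    have "w j = (\<integral>x. ?g x * p j x - ?g x * (x * p j x) \<partial>M)"
      unfolding w_def by (simp add: algebra_simps)
    also have "\<dots> = (\<integral>x. ?g x * p j x \<partial>M) - (\<integral>x. ?g x * (x * p j x) \<partial>M)"
      by (intro Bochner_Integration.integral_diff continuous_integrable cont)
    also have "(\<integral>x. ?g x * (x * p j x) \<partial>M) = a j * ?u (Suc j) + b j * ?u j + a' j * ?u (j - 1)"
      unfolding integral_p_combination[OF g] K_def ..
    finally show ?thesis unfolding K_def by simp
  qed
  have w2: "(\<Sum>j<Suc N. (w j)\<^sup>2) \<le> 2 / t\<^sup>2 * ?u k"
  proof -
    have "(\<Sum>j<Suc N. (w j)\<^sup>2) \<le> (\<integral>x. ((1 - x) * ?g x)\<^sup>2 \<partial>M)"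
      unfolding w_def by (rule bessel_inequality) (intro cont)
    also have "\<dots> \<le> (\<integral>x. 2 / t\<^sup>2 * (exp (- ((1 - x) * t)) * p k x * p k x) \<partial>M)"
    proof (rule integral_mono_M)
      fix x :: real assume x: "-1 \<le> x" "x \<le> 1"
      define z where "z = (1 - x) * t"
      have z: "0 \<le> z" using x t by (simp add: z_def)
      have "z\<^sup>2 / 2 \<le> exp z"
        using exp_lower_Taylor_quadratic[OF z] z by linarith
      then have "z\<^sup>2 * exp (- z) \<le> 2" by (simp add: exp_minus field_simps)
      then have "(z\<^sup>2 * exp (- z)) * (exp (- z) * (p k x)\<^sup>2) \<le> 2 * (exp (- z) * (p k x)\<^sup>2)"
        by (rule mult_right_mono) simp
      moreover have "((1 - x) * ?g x)\<^sup>2 = 1 / t\<^sup>2 * ((z\<^sup>2 * exp (- z)) * (exp (- z) * (p k x)\<^sup>2))"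
        using t by (simp add: z_def power2_eq_square)
      ultimately have "((1 - x) * ?g x)\<^sup>2 \<le> 1 / t\<^sup>2 * (2 * (exp (- z) * (p k x)\<^sup>2))"
        by (simp add: divide_right_mono)
      then show "((1 - x) * ?g x)\<^sup>2 \<le> 2 / t\<^sup>2 * (exp (- ((1 - x) * t)) * p k x * p k x)"
        by (simp add: z_def power2_eq_square)
    qed (intro cont)+
    also have "\<dots> = 2 / t\<^sup>2 * ?u k" by (simp add: K_def)
    finally show ?thesis .
  qed
  have u2: "(\<Sum>j<Suc N. (?u j)\<^sup>2) \<le> ?u k"
    using K_row_square_sum[of t k] t by (meson less_imp_le order_trans)
  \<comment> \<open>The weights \<open>1 / t\<close> and \<open>t\<close> balance the two square sums, whose bounds differ by a factor of order \<open>t\<^sup>2\<close>.\<close>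
  have "(\<Sum>j<Suc N. ?u j * w j) \<le> (\<Sum>j<Suc N. 1 / 2 * (1 / t * (?u j)\<^sup>2 + t * (w j)\<^sup>2))"
  proof (rule sum_mono)
    fix j
    have "0 \<le> (?u j - t * w j)\<^sup>2" by simp
    then have "2 * t * (?u j * w j) \<le> (?u j)\<^sup>2 + t\<^sup>2 * (w j)\<^sup>2" by (simp add: power2_diff power_mult_distrib mult_ac)
    then show "?u j * w j \<le> 1 / 2 * (1 / t * (?u j)\<^sup>2 + t * (w j)\<^sup>2)"
      using t by (simp add: field_simps power2_eq_square)
  qed
  also have "\<dots> = 1 / 2 * (1 / t * (\<Sum>j<Suc N. (?u j)\<^sup>2) + t * (\<Sum>j<Suc N. (w j)\<^sup>2))"
    by (simp only: sum_distrib_left[symmetric] sum.distrib)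
  also have "\<dots> \<le> 1 / 2 * (1 / t * ?u k + t * (2 / t\<^sup>2 * ?u k))"
    using t u2 w2 by (intro mult_left_mono add_mono) auto
  also have "\<dots> = 3 / 2 * ?u k / t" using t by (simp add: field_simps power2_eq_square)
  finally show "(\<Sum>j\<le>N. ?u j * (?u j - (a j * ?u (Suc j) + b j * ?u j + a' j * ?u (j - 1)))) \<le> 3 / 2 * ?u k / t"
    unfolding w lessThan_Suc_atMost .
qed (use t K_row_tendsto_0 K_nonneg in auto)

text \<open>
  Interpolation for \<open>u = K t k\<close> at \<open>m = k\<close>: its square sum is at most \<open>K t k k\<close> and its energy at most
  \<open>3 / 2 * K t k k / t\<close>. Both sides then contain \<open>K t k k\<close>, on the left squared.
\<close>
lemma K_diagonal:
  assumes t: "0 < t"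
  shows "K t k k \<le> 5 / 2 * interp_const / sqrt t"
proof -
  let ?\<phi> = "K t k k"
  have \<phi>: "0 \<le> ?\<phi>" using t by (intro K_nonneg) simp
  \<comment> \<open>Interpolation with \<open>l = sqrt t\<close>.\<close>
  have "?\<phi>\<^sup>2 \<le> interp_const * (sqrt t * (3 / 2 * ?\<phi> / t) + ?\<phi> / sqrt t)"
  proof (rule sup_norm_interpolation[where u = "K t k" and m = k])
    show "K t k \<longlonglongrightarrow> 0" using t by (intro K_row_tendsto_0) simp
    show "(\<Sum>j<N. energy (K t k) j) \<le> 3 / 2 * ?\<phi> / t" for N by (rule K_energy[OF t])
    show "(\<Sum>j=k..<N. (K t k j)\<^sup>2) \<le> ?\<phi>" for N
    proof -
      have "(\<Sum>j=k..<N. (K t k j)\<^sup>2) \<le> (\<Sum>j<N. (K t k j)\<^sup>2)" by (rule sum_mono2) auto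
      then show ?thesis using K_row_square_sum(1)[of t k N] K_row_square_sum(2)[of t k] t by linarith
    qed
  qed (use t in simp)
  also have "sqrt t * (3 / 2 * ?\<phi> / t) = 3 / 2 * ?\<phi> / sqrt t"
    using t real_sqrt_mult_self[of t] by (simp add: field_simps)
  finally have "?\<phi> * ?\<phi> \<le> (5 / 2 * interp_const / sqrt t) * ?\<phi>"
    by (simp add: power2_eq_square field_simps)
  moreover have "0 \<le> 5 / 2 * interp_const / sqrt t" using interp_const_pos t by simp
  ultimately show ?thesis using \<phi> mult_right_le_imp_le[of ?\<phi> ?\<phi> "5 / 2 * interp_const / sqrt t"]
    by (cases "?\<phi> = 0") auto
qed

lemma K_le_diagonals:
  assumes "0 \<le> t"
  shows "K t m n \<le> (K t m m + K t n n) / 2"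
proof -
  have "K t m n \<le> (\<integral>x. 1 / 2 * (exp (- ((1 - x) * t)) * p m x * p m x + exp (- ((1 - x) * t)) * p n x * p n x) \<partial>M)"
    unfolding K_def
  proof (rule integral_mono_M)
    fix x :: real
    have "p m x * p n x \<le> 1 / 2 * (p m x * p m x + p n x * p n x)"
      using sum_squares_bound[of "p m x" "p n x"] by (simp add: power2_eq_square)
    then have "exp (- ((1 - x) * t)) * (p m x * p n x)
        \<le> exp (- ((1 - x) * t)) * (1 / 2 * (p m x * p m x + p n x * p n x))"
      by (rule mult_left_mono) simp
    then show "exp (- ((1 - x) * t)) * p m x * p n x
        \<le> 1 / 2 * (exp (- ((1 - x) * t)) * p m x * p m x + exp (- ((1 - x) * t)) * p n x * p n x)"
      by (simp add: algebra_simps)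
  qed (intro cont)+
  also have "\<dots> = (K t m m + K t n n) / 2"
  proof -
    have i: "integrable M (\<lambda>x. exp (- ((1 - x) * t)) * p q x * p q x)" for q
      by (intro continuous_integrable cont)
    show ?thesis unfolding K_def by (simp add: i)
  qed
  finally show ?thesis .
qed

lemma K_off_diagonal:
  obtains D where "0 < D" "\<And>t k m. 0 < t \<Longrightarrow> k \<le> m \<Longrightarrow>
    K t k m \<le> D / max 1 (sqrt t) * exp (- ((real m - real k) / (4 * max 1 (sqrt t))))"
proof -
  define c0 where "c0 = 2 + 2 * L"
  define C2 where "C2 = 5 / 2 * interp_const"
  define C3 where "C3 = interp_const * (3 / 2 * C2 + C2 * (2 * H * exp c0))"
  define D where "D = max (sqrt C3) (2 * H * exp c0)"
  have C2: "0 < C2" using interp_const_pos by (simp add: C2_def)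
  \<comment> \<open>For \<open>t < 1\<close> a single term of the tail sum with \<open>s = 1\<close> is small enough.\<close>
  have small: "K t k m \<le> 2 * H * exp c0 * exp (- (real m - real k))" if t: "0 < t" "t < 1" and km: "k \<le> m" for t k m
  proof -
    have "K t k m = (\<Sum>j=m..<Suc m. K t k j)" by simp
    also have "\<dots> \<le> 2 * H * exp ((2 + 2 * L) * 1\<^sup>2 * t) * exp (- (1 * (real m - real k)))"
      using t km by (intro K_upper_tail) auto
    also have "\<dots> \<le> 2 * H * exp c0 * exp (- (real m - real k))"
      using t L_pos H_ge_1 by (auto simp: c0_def mult_left_le intro!: mult_right_mono)
    finally show ?thesis .
  qed
  \<comment> \<open>For \<open>t \<ge> 1\<close> take \<open>s = 1 / sqrt t\<close> in the tail bound. The square sum of the tail is then at most a constant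
    times \<open>x\<^sup>2 / sqrt t\<close> and the energy at most a constant times \<open>1 / (t * sqrt t)\<close>, so that \<open>l = sqrt t * x\<close>
    balances the two terms of the interpolation.\<close>
  have large: "K t k m \<le> sqrt C3 / sqrt t * exp (- ((real m - real k) / (4 * sqrt t)))"
    if t: "1 \<le> t" and km: "k \<le> m" for t k m
  proof -
    let ?r = "sqrt t" and ?d = "real m - real k"
    have r: "1 \<le> ?r" using t by simp
    have rr: "?r * ?r = t" using t by simp
    define x where "x = exp (- (?d / (2 * ?r)))"
    have x: "0 < x" by (simp add: x_def)
    have "- (y / (2 * z)) + - (y / (2 * z)) = - (y / z)" for y z :: real by simp
    from this[of ?d ?r]
    have xx: "x * x = exp (- (?d / ?r))" unfolding x_def by (simp only: exp_add[symmetric])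
    have ub: "K t k j \<le> C2 / ?r" for j
      using K_le_diagonals[of t k j] K_diagonal[of t k] K_diagonal[of t j] t by (simp add: C2_def)
    have nn: "0 \<le> K t k j" for j using t by (intro K_nonneg) simp
    have tail: "(\<Sum>j=m..<N. (K t k j)\<^sup>2) \<le> C2 / ?r * (2 * H * exp c0 * (x * x))" for N
    proof -
      have "(\<Sum>j=m..<N. (K t k j)\<^sup>2) \<le> (\<Sum>j=m..<N. C2 / ?r * K t k j)"
        unfolding power2_eq_square by (intro sum_mono mult_right_mono ub nn)
      also have "\<dots> = C2 / ?r * (\<Sum>j=m..<N. K t k j)" by (rule sum_distrib_left[symmetric])
      also have "\<dots> \<le> C2 / ?r * (2 * H * exp ((2 + 2 * L) * (1 / ?r)\<^sup>2 * t) * exp (- (1 / ?r * ?d)))"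
        using t C2 r km by (intro mult_left_mono K_upper_tail) auto
      also have "(2 + 2 * L) * (1 / ?r)\<^sup>2 * t = c0"
        using t by (simp add: c0_def power_divide)
      also have "- (1 / ?r * ?d) = - (?d / ?r)" by (simp only: times_divide_eq_left mult_1)
      also have "exp \<dots> = x * x" by (rule xx[symmetric])
      finally show ?thesis .
    qed
    have en: "(\<Sum>j<N. energy (K t k) j) \<le> 3 / 2 * (C2 / ?r) / t" for N
    proof -
      have "(\<Sum>j<N. energy (K t k) j) \<le> 3 / 2 * K t k k / t" using t by (intro K_energy) simp
      also have "\<dots> \<le> 3 / 2 * (C2 / ?r) / t" using t by (intro divide_right_mono mult_left_mono ub) auto
      finally show ?thesis .
    qed
    have "(K t k m)\<^sup>2 \<le> interp_const * ((?r * x) * (3 / 2 * (C2 / ?r) / t) + C2 / ?r * (2 * H * exp c0 * (x * x)) / (?r * x))"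
      using t r x by (intro sup_norm_interpolation[where u = "K t k" and m = m] K_row_tendsto_0 en tail) auto
    also have "(?r * x) * (3 / 2 * (C2 / ?r) / t) + C2 / ?r * (2 * H * exp c0 * (x * x)) / (?r * x)
        = (3 / 2 * C2 + C2 * (2 * H * exp c0)) * (x / t)"
      using r x rr t by (simp add: field_simps)
    finally have "(K t k m)\<^sup>2 \<le> C3 * (x / t)" by (simp add: C3_def mult.assoc)
    then have "K t k m \<le> sqrt (C3 * (x / t))" by (rule real_le_rsqrt)
    also have "\<dots> = sqrt C3 / ?r * sqrt x" by (simp add: real_sqrt_mult real_sqrt_divide)
    also have "sqrt x = exp (- (?d / (4 * ?r)))"
    proof (rule real_sqrt_unique)
      show "(exp (- (?d / (4 * ?r))))\<^sup>2 = x"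
        by (simp add: x_def power2_eq_square exp_add[symmetric] field_simps)
    qed simp
    finally show ?thesis .
  qed
  show ?thesis
  proof
    have "0 < 2 * H * exp c0" using H_ge_1 by simp
    then show "0 < D" by (simp add: D_def)
    fix t :: real and k m :: nat assume t: "0 < t" and km: "k \<le> m"
    show "K t k m \<le> D / max 1 (sqrt t) * exp (- ((real m - real k) / (4 * max 1 (sqrt t))))"
    proof (cases "t < 1")
      case True
      then have mx: "max 1 (sqrt t) = 1" by simp
      have "K t k m \<le> 2 * H * exp c0 * exp (- (real m - real k))" by (rule small[OF t True km])
      also have "\<dots> \<le> D * exp (- ((real m - real k) / 4))"
      proof (intro mult_mono)
        have "(real m - real k) / 4 \<le> real m - real k" using km by simp
        then show "exp (- (real m - real k)) \<le> exp (- ((real m - real k) / 4))" by (simp only: exp_le_cancel_iff neg_le_iff_le)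
        show "0 \<le> D" using H_ge_1 by (auto simp: D_def intro: order_trans[OF _ max.cobounded2])
      qed (auto simp: D_def)
      finally show ?thesis unfolding mx by simp
    next
      case False
      then have mx: "max 1 (sqrt t) = sqrt t" by simp
      have "K t k m \<le> sqrt C3 / sqrt t * exp (- ((real m - real k) / (4 * sqrt t)))"
        using False km by (intro large) auto
      also have "\<dots> \<le> D / sqrt t * exp (- ((real m - real k) / (4 * sqrt t)))"
        using t by (intro mult_right_mono divide_right_mono) (auto simp: D_def)
      finally show ?thesis unfolding mx .
    qed
  qed
qed

text \<open>
  The bound \<open>1 / r * exp (- d / (4 * r))\<close> with \<open>r = max 1 (sqrt t)\<close> in the normalization that sums to a constant.
\<close>
theorem K_geometric_bound:
  "\<exists>D>0. \<forall>t>0. \<exists>\<rho>. 0 \<le> \<rho> \<and> \<rho> < 1 \<and>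
    (\<forall>m n. \<bar>K t m n\<bar> \<le> D * (1 - \<rho>) * \<rho> ^ (if m \<le> n then n - m else m - n))"
proof -
  obtain D where D: "0 < D" "\<And>t k m. 0 < t \<Longrightarrow> k \<le> m \<Longrightarrow>
    K t k m \<le> D / max 1 (sqrt t) * exp (- ((real m - real k) / (4 * max 1 (sqrt t))))"
    using K_off_diagonal by blast
  show ?thesis
  proof (rule exI[of _ "5 * D"], intro conjI allI impI)
    show "0 < 5 * D" using D by simp
    fix t :: real assume t: "0 < t"
    define r where "r = max 1 (sqrt t)"
    have r: "1 \<le> r" by (simp add: r_def)
    \<comment> \<open>This rational number lies above \<open>exp (- 1 / (4 * r))\<close>, and \<open>1 - \<rho>\<close> is comparable to \<open>1 / r\<close>.\<close>
    define \<rho> where "\<rho> = 4 * r / (4 * r + 1)"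
    have \<rho>: "0 \<le> \<rho>" "\<rho> < 1" using r by (auto simp: \<rho>_def)
    have e: "exp (- (1 / (4 * r))) \<le> \<rho>"
    proof -
      have "exp (- (1 / (4 * r))) = 1 / exp (1 / (4 * r))" by (simp add: exp_minus field_simps)
      also have "\<dots> \<le> 1 / (1 + 1 / (4 * r))"
        using r exp_ge_add_one_self[of "1 / (4 * r)"]
        by (intro divide_left_mono mult_pos_pos add_pos_pos) auto
      also have "\<dots> = \<rho>" using r by (simp add: \<rho>_def field_simps)
      finally show ?thesis .
    qed
    have d: "D / r \<le> 5 * D * (1 - \<rho>)"
    proof -
      have "1 - \<rho> = 1 / (4 * r + 1)" using r by (simp add: \<rho>_def field_simps)
      moreover have "D / r \<le> 5 * D * (1 / (4 * r + 1))" using r D(1) by (simp add: field_simps)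
      ultimately show ?thesis by simp
    qed
    have main: "K t k m \<le> 5 * D * (1 - \<rho>) * \<rho> ^ (m - k)" if km: "k \<le> m" for k m
    proof -
      have "exp (- ((real m - real k) / (4 * r))) = exp (- (1 / (4 * r))) ^ (m - k)"
        using km by (simp add: exp_of_nat_mult[symmetric] of_nat_diff)
      also have "\<dots> \<le> \<rho> ^ (m - k)" by (intro power_mono e) simp
      finally have x: "exp (- ((real m - real k) / (4 * r))) \<le> \<rho> ^ (m - k)" .
      have "K t k m \<le> D / r * exp (- ((real m - real k) / (4 * r)))"
        using D(2)[OF t km] by (simp add: r_def)
      also have "\<dots> \<le> 5 * D * (1 - \<rho>) * \<rho> ^ (m - k)"
        using d x \<rho> D(1) by (intro mult_mono) auto
      finally show ?thesis .
    qed
    show "\<exists>\<rho>. 0 \<le> \<rho> \<and> \<rho> < 1 \<and>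
      (\<forall>m n. \<bar>K t m n\<bar> \<le> 5 * D * (1 - \<rho>) * \<rho> ^ (if m \<le> n then n - m else m - n))"
    proof (intro exI[of _ \<rho>] conjI \<rho> allI)
      fix m n
      have "0 \<le> K t m n" using t by (intro K_nonneg) simp
      then show "\<bar>K t m n\<bar> \<le> 5 * D * (1 - \<rho>) * \<rho> ^ (if m \<le> n then n - m else m - n)"
        using main[of m n] main[of n m] K_sym[of t m n] by auto
    qed
  qed
qed

end

text \<open>
  The factors \<open>1 + \<kappa> / (n + 1)\<^sup>2\<close> have a convergent product: \<open>1 / (n + 1)\<^sup>2 \<le> 2 / (n + 1) - 2 / (n + 2)\<close>
  makes \<open>x n * exp (- 2 * \<kappa> / (n + 1))\<close> increasing.
\<close>
lemma quasi_monotone_from_ratio: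
  fixes x :: "nat \<Rightarrow> real"
  assumes x: "\<And>n. 0 \<le> x n" and \<kappa>: "0 \<le> \<kappa>"
    and ratio: "\<And>n. x n \<le> (1 + \<kappa> / (real n + 1)\<^sup>2) * x (Suc n)" and mn: "m \<le> n"
  shows "x m \<le> exp (2 * \<kappa>) * x n"
proof -
  define u where "u = (\<lambda>n. x n * exp (- (2 * \<kappa> / (real n + 1))))"
  have "u n \<le> u (Suc n)" for n
  proof -
    have "(real n + 1) * (real n + 2) \<le> 2 * (real n + 1)\<^sup>2"
      by (simp add: power2_eq_square algebra_simps)
    then have "2 / (2 * (real n + 1)\<^sup>2) \<le> 2 / ((real n + 1) * (real n + 2))"
      by (intro divide_left_mono) auto
    then have "1 / (real n + 1)\<^sup>2 \<le> 2 / ((real n + 1) * (real n + 2))"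
      by (simp only: mult_divide_mult_cancel_left_if)
    also have "\<dots> = 2 / (real n + 1) - 2 / (real n + 2)" by (simp add: field_simps)
    finally have "\<kappa> * (1 / (real n + 1)\<^sup>2) \<le> \<kappa> * (2 / (real n + 1) - 2 / (real n + 2))"
      using \<kappa> by (rule mult_left_mono)
    then have e: "\<kappa> / (real n + 1)\<^sup>2 \<le> 2 * \<kappa> / (real n + 1) - 2 * \<kappa> / (real n + 2)"
      by (simp add: algebra_simps)
    have "1 + \<kappa> / (real n + 1)\<^sup>2 \<le> exp (\<kappa> / (real n + 1)\<^sup>2)" by (rule exp_ge_add_one_self)
    also have "\<dots> \<le> exp (2 * \<kappa> / (real n + 1) - 2 * \<kappa> / (real n + 2))" using e by simp
    finally have "x n \<le> exp (2 * \<kappa> / (real n + 1) - 2 * \<kappa> / (real n + 2)) * x (Suc n)"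
      using ratio[of n] x[of "Suc n"] by (meson mult_right_mono order_trans)
    then have "u n \<le> exp (2 * \<kappa> / (real n + 1) - 2 * \<kappa> / (real n + 2)) * x (Suc n) * exp (- (2 * \<kappa> / (real n + 1)))"
      unfolding u_def by (rule mult_right_mono) simp
    also have "\<dots> = u (Suc n)"
    proof -
      have "exp (A - B) * x * exp (- A) = x * exp (- B)" for A B x :: real
        by (simp add: exp_diff exp_minus field_simps)
      then show ?thesis unfolding u_def by (simp add: add_ac)
    qed
    finally show ?thesis .
  qed
  then have "incseq u" by (rule incseq_SucI)
  then have "u m \<le> u n" using mn by (rule incseqD)
  moreover have "u n \<le> x n" unfolding u_def using x[of n] \<kappa> by (simp add: mult_left_le)
  moreover have "x m * exp (- (2 * \<kappa>)) \<le> u m"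
    unfolding u_def using x[of m] \<kappa> by (intro mult_left_mono) (auto simp: divide_le_eq mult_le_cancel_left1)
  ultimately have "x m * exp (- (2 * \<kappa>)) \<le> x n" by linarith
  then show ?thesis by (simp add: exp_minus field_simps)
qed

section \<open>Jacobi polynomials from Rodrigues' formula\<close>

text \<open>
  The polynomial factor of the \<open>k\<close>-th derivative of \<open>(1 - x) powr a * (1 + x) powr b\<close>. Its values at \<open>1\<close> and
  \<open>-1\<close> and its leading coefficient follow from the recursion, since all but one of the terms disappear.
\<close>
primrec rodrigues_poly :: "real \<Rightarrow> real \<Rightarrow> nat \<Rightarrow> real poly" where
  "rodrigues_poly a b 0 = 1"
| "rodrigues_poly a b (Suc k) =
     smult (- (a - real k)) ([:1, 1:] * rodrigues_poly a b k)
     + smult (b - real k) ([:1, -1:] * rodrigues_poly a b k)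
     + [:1, -1:] * [:1, 1:] * pderiv (rodrigues_poly a b k)"

definition rodrigues_fun :: "real \<Rightarrow> real \<Rightarrow> nat \<Rightarrow> real \<Rightarrow> real" where
  "rodrigues_fun a b k x = (1 - x) powr (a - real k) * (1 + x) powr (b - real k) * poly (rodrigues_poly a b k) x"

lemma DERIV_weight_factors:
  fixes x c :: real
  assumes "x \<in> {-1<..<1}"
  shows "((\<lambda>x. (1 - x) powr c) has_real_derivative - c * (1 - x) powr (c - 1)) (at x)"
    and "((\<lambda>x. (1 + x) powr c) has_real_derivative c * (1 + x) powr (c - 1)) (at x)"
  using assms by (auto intro!: derivative_eq_intros simp: powr_diff field_simps)

lemma rodrigues_fun_deriv:
  assumes x: "x \<in> {-1<..<1}"
  shows "(rodrigues_fun a b k has_real_derivative rodrigues_fun a b (Suc k) x) (at x)"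
proof -
  define c d q where "c = a - real k" and "d = b - real k" and "q = rodrigues_poly a b k"
  have pos: "0 < 1 - x" "0 < 1 + x" using x by auto
  have "((\<lambda>x. (1 - x) powr c * (1 + x) powr d * poly q x) has_real_derivative
      (- c * (1 - x) powr (c - 1) * (1 + x) powr d + d * (1 + x) powr (d - 1) * (1 - x) powr c) * poly q x
      + poly (pderiv q) x * ((1 - x) powr c * (1 + x) powr d)) (at x)"
    by (intro DERIV_mult DERIV_weight_factors[OF x] poly_DERIV)
  moreover have "(- c * (1 - x) powr (c - 1) * (1 + x) powr d + d * (1 + x) powr (d - 1) * (1 - x) powr c) * poly q x
      + poly (pderiv q) x * ((1 - x) powr c * (1 + x) powr d)
    = (1 - x) powr (c - 1) * (1 + x) powr (d - 1) * poly (rodrigues_poly a b (Suc k)) x"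
  proof -
    have "(1 - x) powr c = (1 - x) * (1 - x) powr (c - 1)" "(1 + x) powr d = (1 + x) * (1 + x) powr (d - 1)"
      using pos by (simp_all add: powr_diff)
    then show ?thesis
      by (simp only: rodrigues_poly.simps c_def[symmetric] d_def[symmetric] q_def[symmetric])
        (simp add: algebra_simps)
  qed
  ultimately show ?thesis
    unfolding rodrigues_fun_def c_def d_def q_def by (simp add: diff_diff_eq add.commute)
qed

lemma iterated_deriv_rodrigues_fun:
  "x \<in> {-1<..<1} \<Longrightarrow> (deriv ^^ k) (\<lambda>y. (1 - y) powr a * (1 + y) powr b) x = rodrigues_fun a b k x"
proof (induction k arbitrary: x)
  case 0
  then show ?case by (simp add: rodrigues_fun_def)
next
  case (Suc k)
  have "((deriv ^^ k) (\<lambda>y. (1 - y) powr a * (1 + y) powr b) has_real_derivative rodrigues_fun a b (Suc k) x) (at x)"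
    by (rule has_field_derivative_transform_within_open[OF rodrigues_fun_deriv[OF Suc.prems], where S = "{-1<..<1}"])
      (use Suc in auto)
  then show ?case by (simp add: DERIV_imp_deriv)
qed

lemma jacobi_poly_eq:
  "jacobi_poly \<alpha> \<beta> n = smult ((-1) ^ n / (2 ^ n * fact n)) (rodrigues_poly (\<alpha> + real n) (\<beta> + real n) n)"
  unfolding jacobi_poly_def
proof (rule the1_equality[OF jacobi_poly_ex1])
  show "is_jacobi_poly \<alpha> \<beta> n (smult ((-1) ^ n / (2 ^ n * fact n)) (rodrigues_poly (\<alpha> + real n) (\<beta> + real n) n))"
    unfolding is_jacobi_poly_def
    by (auto simp: iterated_deriv_rodrigues_fun rodrigues_fun_def)
qed

lemma poly_rodrigues_at_1: "poly (rodrigues_poly a b k) 1 = (-2) ^ k * (\<Prod>i<k. a - real i)"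
  by (induction k) (auto simp: algebra_simps)

lemma poly_rodrigues_at_minus_1: "poly (rodrigues_poly a b k) (-1) = 2 ^ k * (\<Prod>i<k. b - real i)"
  by (induction k) (auto simp: algebra_simps)

lemma degree_rodrigues_poly: "degree (rodrigues_poly a b k) \<le> k"
proof (induction k)
  case (Suc k)
  have lin: "degree ([:1, c:] * rodrigues_poly a b k) \<le> Suc k" for c :: real
  proof -
    have "degree [:1, c:] \<le> 1" by simp
    then show ?thesis using degree_mult_le[of "[:1, c:]" "rodrigues_poly a b k"] Suc by linarith
  qed
  have "degree ([:1, -1:] * [:1, 1:] * pderiv (rodrigues_poly a b k)) \<le> Suc k"
  proof (cases "degree (rodrigues_poly a b k) = 0")
    case True
    then have "pderiv (rodrigues_poly a b k) = 0" by (simp add: pderiv_eq_0_iff)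
    then show ?thesis by simp
  next
    case False
    have "degree ([:1, -1:] * [:1, 1:] * pderiv (rodrigues_poly a b k))
        \<le> degree ([:1, -1:] * [:1, 1:] :: real poly) + degree (pderiv (rodrigues_poly a b k))"
      by (rule degree_mult_le)
    also have "\<dots> \<le> 2 + (k - 1)" using Suc by (intro add_mono) (auto simp: degree_pderiv)
    also have "\<dots> \<le> Suc k" using False Suc by simp
    finally show ?thesis .
  qed
  then show ?case
    unfolding rodrigues_poly.simps
    by (intro degree_add_le order_trans[OF degree_smult_le] lin)
qed simp

lemma coeff_rodrigues_poly: "coeff (rodrigues_poly a b k) k = (-1) ^ k * (\<Prod>i<k. a + b - real i)"
proof (induction k)
  case (Suc k)
  define q where "q = rodrigues_poly a b k"
  have z: "coeff q n = 0" if "k < n" for n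
    unfolding q_def using degree_rodrigues_poly[of a b k] that by (intro coeff_eq_0) simp
  have "coeff ([:1, -1:] * [:1, 1:] * pderiv q) (Suc k) = - (real k * coeff q k)"
  proof -
    have "[:1, -1:] * [:1, 1:] = ([:1, 0, -1:] :: real poly)" by simp
    then have "[:1, -1:] * [:1, 1:] * pderiv q = pderiv q - pCons 0 (pCons 0 (pderiv q))" by simp
    then show ?thesis by (cases k) (simp_all add: coeff_pderiv z)
  qed
  moreover have "coeff ([:1, c:] * q) (Suc k) = c * coeff q k" for c :: real
    by (simp add: z)
  ultimately have "coeff (rodrigues_poly a b (Suc k)) (Suc k) = - ((a + b - real k) * coeff q k)"
    unfolding rodrigues_poly.simps coeff_add coeff_smult q_def[symmetric] by (simp add: algebra_simps)
  then show ?case by (simp add: Suc q_def)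
qed simp

text \<open>
  Near each end point one of the factors is bounded and the other has an explicit antiderivative.
\<close>
lemma powr_weight_integrable:
  fixes c d :: real
  assumes c: "c > -1" and d: "d > -1"
  shows "set_integrable lborel {-1..1} (\<lambda>x. (1 - x) powr c * (1 + x) powr d)"
proof -
  have lb: "set_integrable lborel {-1..1} f"
    if "(f has_integral i) {-1..1}" "\<And>x. x \<in> {-1..1} \<Longrightarrow> 0 \<le> f x" "f \<in> borel_measurable borel" for f :: "real \<Rightarrow> real" and i
  proof -
    have "f absolutely_integrable_on {-1..1}"
      using that(1,2) by (intro nonnegative_absolutely_integrable_1) auto
    then show ?thesis
      using that(3) unfolding set_integrable_def by (subst (asm) integrable_completion) auto
  qed
  have 1: "set_integrable lborel {-1..1} (\<lambda>x. (1 - x) powr c)"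
  proof (rule lb)
    have "((\<lambda>x. (1 - x) powr c) has_integral (- ((1 - 1) powr (c + 1)) / (c + 1)) - (- ((1 - (- 1)) powr (c + 1)) / (c + 1))) {-1..1}"
    proof (rule fundamental_theorem_of_calculus_interior)
      show "continuous_on {-1..1} (\<lambda>x. - ((1 - x) powr (c + 1)) / (c + 1))"
        using c by (intro continuous_intros continuous_on_powr') auto
      fix x :: real assume x: "x \<in> {-1<..<1}"
      show "((\<lambda>x. - ((1 - x) powr (c + 1)) / (c + 1)) has_vector_derivative (1 - x) powr c) (at x)"
      proof -
        have "- (- (c + 1) * (1 - x) powr (c + 1 - 1)) / (c + 1) = (1 - x) powr c"
          using c by (simp add: field_simps)
        with DERIV_cdivide[OF DERIV_minus[OF DERIV_weight_factors(1)[OF x, of "c + 1"]], of "c + 1"]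
        show ?thesis
          unfolding has_real_derivative_iff_has_vector_derivative[symmetric] by simp
      qed
    qed simp
    then show "((\<lambda>x. (1 - x) powr c) has_integral (- ((1 - 1) powr (c + 1)) / (c + 1)) - (- ((1 - (- 1)) powr (c + 1)) / (c + 1))) {-1..1}" .
  qed auto
  have 2: "set_integrable lborel {-1..1} (\<lambda>x. (1 + x) powr d)"
  proof (rule lb)
    show "((\<lambda>x. (1 + x) powr d) has_integral ((1 + 1) powr (d + 1) / (d + 1)) - ((1 + (- 1)) powr (d + 1) / (d + 1))) {-1..1}"
    proof (rule fundamental_theorem_of_calculus_interior)
      show "continuous_on {-1..1} (\<lambda>x. (1 + x) powr (d + 1) / (d + 1))"
        using d by (intro continuous_intros continuous_on_powr') auto
      fix x :: real assume x: "x \<in> {-1<..<1}"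
      show "((\<lambda>x. (1 + x) powr (d + 1) / (d + 1)) has_vector_derivative (1 + x) powr d) (at x)"
        unfolding has_real_derivative_iff_has_vector_derivative[symmetric]
        using DERIV_cdivide[OF DERIV_weight_factors(2)[OF x, of "d + 1"], of "d + 1"] d
        by simp
    qed simp
  qed auto
  have B: "y powr e \<le> 2 powr \<bar>e\<bar>" if "1 \<le> y" "y \<le> 2" for y e :: real
  proof -
    have "y powr e \<le> y powr \<bar>e\<bar>" using that by (intro powr_mono) auto
    also have "\<dots> \<le> 2 powr \<bar>e\<bar>" using that by (intro powr_mono2) auto
    finally show ?thesis .
  qed
  show ?thesis
  proof (rule set_integrable_bound)
    show "set_integrable lborel {-1..1} (\<lambda>x. 2 powr \<bar>d\<bar> * (1 - x) powr c + 2 powr \<bar>c\<bar> * (1 + x) powr d)"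
      using 1 2 by (intro set_integral_add set_integrable_mult_right) auto
    show "set_borel_measurable lborel {-1..1} (\<lambda>x. (1 - x) powr c * (1 + x) powr d)"
      unfolding set_borel_measurable_def by measurable
    show "AE x in lborel. x \<in> {-1..1} \<longrightarrow> norm ((1 - x) powr c * (1 + x) powr d)
        \<le> norm (2 powr \<bar>d\<bar> * (1 - x) powr c + 2 powr \<bar>c\<bar> * (1 + x) powr d)"
    proof (rule AE_I2, rule impI)
      fix x :: real assume x: "x \<in> {-1..1}"
      have "(1 - x) powr c * (1 + x) powr d \<le> 2 powr \<bar>d\<bar> * (1 - x) powr c + 2 powr \<bar>c\<bar> * (1 + x) powr d"
      proof (cases "0 \<le> x")
        case True
        then have "(1 - x) powr c * (1 + x) powr d \<le> (1 - x) powr c * 2 powr \<bar>d\<bar>"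
          using x by (intro mult_left_mono B) auto
        then show ?thesis by (simp add: mult.commute add_increasing2)
      next
        case False
        then have "(1 - x) powr c * (1 + x) powr d \<le> 2 powr \<bar>c\<bar> * (1 + x) powr d"
          using x by (intro mult_right_mono B) auto
        then show ?thesis by (simp add: add_increasing)
      qed
      then show "norm ((1 - x) powr c * (1 + x) powr d)
        \<le> norm (2 powr \<bar>d\<bar> * (1 - x) powr c + 2 powr \<bar>c\<bar> * (1 + x) powr d)"
        by simp
    qed
  qed
qed

lemma measurable_poly [measurable]: "poly (g :: real poly) \<in> borel_measurable borel"
  by (intro borel_measurable_continuous_onI continuous_intros)

lemma powr_weight_poly_integrable:
  fixes c d :: real
  assumes c: "c > -1" and d: "d > -1"
  shows "set_integrable lborel {-1..1} (\<lambda>x. (1 - x) powr c * (1 + x) powr d * poly g x)"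
proof -
  have "compact (poly g ` {-1..1})"
    by (intro compact_continuous_image continuous_intros) auto
  then have "bounded (poly g ` {-1..1})" by (rule compact_imp_bounded)
  then obtain B where "\<forall>y\<in>poly g ` {-1..1}. norm y \<le> B" unfolding bounded_iff by blast
  then have B: "norm (poly g x) \<le> B" if "x \<in> {-1..1}" for x using that by blast
  show ?thesis
  proof (rule set_integrable_bound)
    show "set_integrable lborel {-1..1} (\<lambda>x. B * ((1 - x) powr c * (1 + x) powr d))"
      by (intro set_integrable_mult_right powr_weight_integrable c d)
    show "set_borel_measurable lborel {-1..1} (\<lambda>x. (1 - x) powr c * (1 + x) powr d * poly g x)"
      unfolding set_borel_measurable_def by measurable
    show "AE x in lborel. x \<in> {-1..1} \<longrightarrow> norm ((1 - x) powr c * (1 + x) powr d * poly g x)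
        \<le> norm (B * ((1 - x) powr c * (1 + x) powr d))"
    proof (rule AE_I2, rule impI)
      fix x :: real assume x: "x \<in> {-1..1}"
      have "norm (poly g x) \<le> norm B" using B[OF x] by simp
      then have "(1 - x) powr c * (1 + x) powr d * norm (poly g x) \<le> (1 - x) powr c * (1 + x) powr d * norm B"
        by (intro mult_left_mono) auto
      then show "norm ((1 - x) powr c * (1 + x) powr d * poly g x) \<le> norm (B * ((1 - x) powr c * (1 + x) powr d))"
        by (simp add: abs_mult mult_ac)
    qed
  qed
qed

lemma rodrigues_fun_poly_integrable:
  assumes "a - real k > -1" "b - real k > -1"
  shows "set_integrable lborel {-1..1} (\<lambda>x. rodrigues_fun a b k x * poly g x)"
  using powr_weight_poly_integrable[OF assms, of "rodrigues_poly a b k * g"]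
  by (simp add: rodrigues_fun_def mult.assoc)

lemma rodrigues_integration_by_parts:
  assumes a: "a - real k > 0" and b: "b - real k > 0"
  shows "(LINT x:{-1..1}|lborel. rodrigues_fun a b (Suc k) x * poly g x)
    = - (LINT x:{-1..1}|lborel. rodrigues_fun a b k x * poly (pderiv g) x)"
proof -
  let ?f1 = "\<lambda>x. rodrigues_fun a b (Suc k) x * poly g x"
  let ?f2 = "\<lambda>x. rodrigues_fun a b k x * poly (pderiv g) x"
  have i: "set_integrable lborel {-1..1} ?f1" "set_integrable lborel {-1..1} ?f2"
    using a b by (auto intro!: rodrigues_fun_poly_integrable)
  let ?F = "\<lambda>x. rodrigues_fun a b k x * poly g x"
  have "((\<lambda>x. ?f1 x + ?f2 x) has_integral ?F 1 - ?F (-1)) {-1..1}"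
  proof (rule fundamental_theorem_of_calculus_interior)
    show "continuous_on {-1..1} ?F"
      unfolding rodrigues_fun_def using a b by (intro continuous_intros continuous_on_powr') auto
    fix x :: real assume x: "x \<in> {-1<..<1}"
    show "(?F has_vector_derivative ?f1 x + ?f2 x) (at x)"
      unfolding has_real_derivative_iff_has_vector_derivative[symmetric]
      using DERIV_mult[OF rodrigues_fun_deriv[OF x] poly_DERIV[of g x]] by (simp add: mult.commute)
  qed simp
  moreover have "?F 1 = 0" "?F (-1) = 0" using a b by (auto simp: rodrigues_fun_def)
  ultimately have "integral {-1..1} (\<lambda>x. ?f1 x + ?f2 x) = 0" by (simp add: integral_unique)
  then have "(LINT x:{-1..1}|lborel. ?f1 x + ?f2 x) = 0"
    using set_borel_integral_eq_integral(2)[OF set_integral_add(1)[OF i]] by simp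
  then show ?thesis using set_integral_add(2)[OF i] by simp
qed

text \<open>
  Integrating by parts \<open>k\<close> times moves all derivatives to \<open>g\<close>. The condition on \<open>a\<close> and \<open>b\<close> makes the boundary
  terms vanish in each of the steps.
\<close>
lemma rodrigues_orthogonal:
  assumes "a > real n - 1" and "b > real n - 1"
  shows "k \<le> n \<Longrightarrow> degree g < k \<Longrightarrow> (LINT x:{-1..1}|lborel. rodrigues_fun a b k x * poly g x) = 0"
proof (induction k arbitrary: g)
  case (Suc k)
  then have "(LINT x:{-1..1}|lborel. rodrigues_fun a b (Suc k) x * poly g x)
    = - (LINT x:{-1..1}|lborel. rodrigues_fun a b k x * poly (pderiv g) x)"
    using assms by (intro rodrigues_integration_by_parts) auto
  moreover have "(LINT x:{-1..1}|lborel. rodrigues_fun a b k x * poly (pderiv g) x) = 0"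
  proof (cases "degree g = 0")
    case True
    then have "pderiv g = 0" by (simp add: pderiv_eq_0_iff)
    then show ?thesis by simp
  next
    case False
    then show ?thesis using Suc by (intro Suc.IH) (auto simp: degree_pderiv)
  qed
  ultimately show ?case by simp
qed simp

lemma integral_jacobi_measure:
  fixes f :: "real \<Rightarrow> real"
  assumes [measurable]: "f \<in> borel_measurable borel"
  shows "(\<integral>x. f x \<partial>jacobi_measure \<alpha> \<beta>) = (LINT x:{-1..1}|lborel. (1 - x) powr \<alpha> * (1 + x) powr \<beta> * f x)"
    and "integrable (jacobi_measure \<alpha> \<beta>) f \<longleftrightarrow> set_integrable lborel {-1..1} (\<lambda>x. (1 - x) powr \<alpha> * (1 + x) powr \<beta> * f x)"
proof -
  have m: "f \<in> borel_measurable (restrict_space lborel {-1..1})"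
    "(\<lambda>x. (1 - x) powr \<alpha> * (1 + x) powr \<beta>) \<in> borel_measurable (restrict_space lborel {-1..1})"
    by (auto intro!: measurable_restrict_space1)
  have ae: "AE x in restrict_space lborel {-1..1}. 0 \<le> (1 - x) powr \<alpha> * (1 + x) powr \<beta>" by simp
  show "(\<integral>x. f x \<partial>jacobi_measure \<alpha> \<beta>) = (LINT x:{-1..1}|lborel. (1 - x) powr \<alpha> * (1 + x) powr \<beta> * f x)"
    unfolding jacobi_measure_def integral_density[OF m ae] set_lebesgue_integral_def
    by (subst integral_restrict_space) auto
  show "integrable (jacobi_measure \<alpha> \<beta>) f \<longleftrightarrow> set_integrable lborel {-1..1} (\<lambda>x. (1 - x) powr \<alpha> * (1 + x) powr \<beta> * f x)"
    unfolding jacobi_measure_def integrable_density[OF m ae] set_integrable_def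
    by (subst integrable_restrict_space) auto
qed

locale jacobi_parameters =
  fixes \<alpha> \<beta> :: real
  assumes \<alpha>: "\<alpha> \<ge> - 1 / 2" and \<beta>: "\<beta> \<ge> - 1 / 2"
begin

abbreviation M :: "real measure" where "M \<equiv> jacobi_measure \<alpha> \<beta>"
abbreviation P :: "nat \<Rightarrow> real poly" where "P \<equiv> jacobi_poly \<alpha> \<beta>"

lemma space_M: "space M = {-1..1}"
  by (simp add: jacobi_measure_def space_restrict_space)

lemma sets_M: "sets M = sets (restrict_space borel {-1..1})"
  by (simp add: jacobi_measure_def cong: sets_restrict_space_cong)

lemma integrable_poly: "integrable M (poly g)"
  using powr_weight_poly_integrable[of \<alpha> \<beta> g] \<alpha> \<beta> by (subst integral_jacobi_measure) auto

sublocale finite_measure M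
proof
  have "poly 1 = (\<lambda>x. 1 :: real)" by (simp add: fun_eq_iff)
  then have "integrable M (\<lambda>x. 1 :: real)" using integrable_poly[of 1] by (simp only:)
  then show "emeasure M (space M) \<noteq> \<infinity>" by (simp add: integrable_iff_bounded)
qed

definition ip :: "real poly \<Rightarrow> real poly \<Rightarrow> real" where
  "ip f g = (\<integral>x. poly f x * poly g x \<partial>M)"

lemma integrable_poly_mult: "integrable M (\<lambda>x. poly f x * poly g x)"
proof -
  have "poly (f * g) = (\<lambda>x. poly f x * poly g x)" by (simp add: fun_eq_iff)
  then show ?thesis using integrable_poly[of "f * g"] by (simp only:)
qed

lemma ip_add: "ip (f + f') g = ip f g + ip f' g"
  unfolding ip_def by (simp add: distrib_right integrable_poly_mult)

lemma ip_diff: "ip (f - f') g = ip f g - ip f' g"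
  unfolding ip_def by (simp add: left_diff_distrib integrable_poly_mult)

lemma ip_smult: "ip (smult c f) g = c * ip f g"
  unfolding ip_def by (simp add: mult.assoc)

lemma ip_commute: "ip f g = ip g f"
  unfolding ip_def by (simp add: mult.commute)

lemma ip_shift: "ip (f * h) g = ip f (h * g)"
  unfolding ip_def by (simp add: mult.assoc)

text \<open>
  The weight is positive on the open interval and a nonzero polynomial has finitely many roots.
\<close>
lemma ip_self_zero:
  assumes "ip f f = 0"
  shows "f = 0"
proof (rule ccontr)
  assume f: "f \<noteq> 0"
  let ?w = "\<lambda>x. (1 - x) powr \<alpha> * (1 + x) powr \<beta> * (poly (f * f) x)"
  have nn: "0 \<le> indicator {-1..1} x * ?w x" for x :: real
    by (simp add: indicator_def)
  have "set_integrable lborel {-1..1} ?w" using powr_weight_poly_integrable[of \<alpha> \<beta> "f * f"] \<alpha> \<beta> by simp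
  then have i: "integrable lborel (\<lambda>x. indicator {-1..1} x * ?w x)" by (simp add: set_integrable_def)
  have "poly f x * poly f x = poly (f * f) x" for x by simp
  then have "(\<integral>x. indicator {-1..1} x * ?w x \<partial>lborel) = 0"
    using assms unfolding ip_def by (subst (asm) integral_jacobi_measure) (auto simp: set_lebesgue_integral_def)
  then have ae: "AE x in lborel. indicator {-1..1} x * ?w x = 0"
    using integral_nonneg_eq_0_iff_AE[OF i] nn by simp
  have "AE x in lborel. x \<notin> {x. poly f x = 0}"
    by (intro AE_not_in) (use poly_roots_finite[OF f] finite_imp_null_set_lborel in auto)
  with ae have "AE x in lborel. x \<notin> {-1<..<1::real}"
  proof eventually_elim
    case (elim x)
    then show ?case by (auto simp: indicator_def split: if_splits)
  qed
  moreover have "(AE x in lborel. x \<notin> {-1<..<1::real}) \<longleftrightarrow> emeasure lborel {-1<..<1::real} = 0"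
    by (rule AE_iff_measurable) auto
  ultimately show False by simp
qed

lemma ip_P_lower_degree:
  assumes "degree g < n"
  shows "ip (P n) g = 0"
proof -
  have "(LINT x:{-1..1}|lborel. rodrigues_fun (\<alpha> + real n) (\<beta> + real n) n x * poly g x) = 0"
    by (rule rodrigues_orthogonal[of n]) (use \<alpha> \<beta> assms in auto)
  moreover have "(1 - x) powr \<alpha> * (1 + x) powr \<beta> * (poly (P n) x * poly g x)
      = (-1) ^ n / (2 ^ n * fact n) * (rodrigues_fun (\<alpha> + real n) (\<beta> + real n) n x * poly g x)" for x
    by (simp add: jacobi_poly_eq rodrigues_fun_def)
  ultimately show ?thesis
    unfolding ip_def by (subst integral_jacobi_measure) auto
qed

text \<open>
  The leading coefficient of \<open>P n\<close> up to the factor \<open>2 ^ n * fact n\<close>.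
\<close>
definition lead_prod :: "nat \<Rightarrow> real" where "lead_prod n = (\<Prod>i<n. \<alpha> + \<beta> + 2 * real n - real i)"

lemma lead_prod_pos: "0 < lead_prod n"
  unfolding lead_prod_def by (rule prod_pos) (use \<alpha> \<beta> in auto)

lemma coeff_P: "coeff (P n) n = lead_prod n / (2 ^ n * fact n)"
  by (simp add: jacobi_poly_eq coeff_rodrigues_poly lead_prod_def power_mult_distrib[symmetric] algebra_simps)

lemma degree_P: "degree (P n) = n"
proof (rule antisym)
  show "degree (P n) \<le> n"
    unfolding jacobi_poly_eq by (rule order_trans[OF degree_smult_le degree_rodrigues_poly])
  show "n \<le> degree (P n)" using lead_prod_pos[of n] by (intro le_degree) (simp add: coeff_P)
qed

lemma lead_prod_Suc:
  "lead_prod (Suc n) * (\<alpha> + \<beta> + real n + 1) = (\<alpha> + \<beta> + 2 * real n + 2) * (\<alpha> + \<beta> + 2 * real n + 1) * lead_prod n"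
proof -
  define c where "c = \<alpha> + \<beta> + 2 * real n"
  have shift: "(\<Prod>i<Suc n. d + 1 - real i) = (d + 1) * (\<Prod>i<n. d - real i)" for d
    unfolding prod.lessThan_Suc_shift by simp
  have "lead_prod (Suc n) = (\<Prod>i<Suc n. (c + 1) + 1 - real i)" by (simp add: lead_prod_def c_def add_ac)
  also have "\<dots> = (c + 2) * (\<Prod>i<n. c + 1 - real i)" unfolding shift by simp
  finally have 1: "lead_prod (Suc n) = (c + 2) * (\<Prod>i<n. c + 1 - real i)" .
  have "(c + 1) * lead_prod n = (\<Prod>i<Suc n. c + 1 - real i)"
    unfolding shift by (simp add: lead_prod_def c_def)
  also have "\<dots> = (\<Prod>i<n. c + 1 - real i) * (c + 1 - real n)" by simp
  finally have "lead_prod (Suc n) * (c + 1 - real n) = (c + 2) * ((c + 1) * lead_prod n)"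
    unfolding 1 by simp
  moreover have "c + 1 - real n = \<alpha> + \<beta> + real n + 1" by (simp add: c_def)
  ultimately show ?thesis by (simp add: c_def mult.assoc add_ac)
qed

definition right_value :: "nat \<Rightarrow> real" where "right_value n = poly (P n) 1"
definition left_value :: "nat \<Rightarrow> real" where "left_value n = poly (P n) (-1)"

lemma right_value_eq: "right_value n = (\<Prod>i<n. \<alpha> + real n - real i) / fact n"
proof -
  have "(-2 :: real) ^ n = (-1) ^ n * 2 ^ n" by (rule power_minus)
  moreover have "(-1 :: real) ^ n * (-1) ^ n = 1" by (simp flip: power_mult_distrib)
  ultimately show ?thesis by (simp add: right_value_def jacobi_poly_eq poly_rodrigues_at_1 field_simps)
qed

lemma left_value_eq: "left_value n = (-1) ^ n * (\<Prod>i<n. \<beta> + real n - real i) / fact n"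
  by (simp add: left_value_def jacobi_poly_eq poly_rodrigues_at_minus_1)

lemma right_value_pos: "0 < right_value n"
  unfolding right_value_eq by (intro divide_pos_pos prod_pos) (use \<alpha> in auto)

lemma left_value_nonzero: "left_value n \<noteq> 0"
  unfolding left_value_eq using \<beta> by auto

lemma right_value_Suc: "real (Suc n) * right_value (Suc n) = (\<alpha> + real n + 1) * right_value n"
proof -
  have "(\<Prod>i<Suc n. \<alpha> + real (Suc n) - real i) = (\<alpha> + real n + 1) * (\<Prod>i<n. \<alpha> + real n - real i)"
    unfolding prod.lessThan_Suc_shift by (simp add: add_ac)
  moreover have "real (Suc n) * (x / fact (Suc n)) = x / fact n" for x :: real
    by (simp del: of_nat_Suc)
  ultimately show ?thesis unfolding right_value_eq by (simp del: fact_Suc)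
qed

lemma left_value_Suc: "real (Suc n) * left_value (Suc n) = - ((\<beta> + real n + 1) * left_value n)"
proof -
  have "(\<Prod>i<Suc n. \<beta> + real (Suc n) - real i) = (\<beta> + real n + 1) * (\<Prod>i<n. \<beta> + real n - real i)"
    unfolding prod.lessThan_Suc_shift by (simp add: add_ac)
  moreover have "real (Suc n) * (x / fact (Suc n)) = x / fact n" for x :: real
    by (simp del: of_nat_Suc)
  ultimately show ?thesis unfolding left_value_eq by (simp del: fact_Suc)
qed

text \<open>
  The quotient of the leading coefficients of \<open>P n\<close> and \<open>P (n + 1)\<close>.
\<close>
definition up_coeff :: "nat \<Rightarrow> real" where "up_coeff n = 2 * real (Suc n) * lead_prod n / lead_prod (Suc n)"

text \<open>
  Subtract from \<open>x P\<^sub>n\<close> multiples of \<open>P\<^sub>n\<^sub>+\<^sub>1\<close>, \<open>P\<^sub>n\<close> and \<open>P\<^sub>n\<^sub>-\<^sub>1\<close> that remove the three leading coefficients. The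
  rest has degree less than \<open>n - 1\<close> and is orthogonal to all such polynomials, hence to itself.
\<close>
lemma three_term_recurrence:
  "\<exists>B C. [:0, 1:] * P n = smult (up_coeff n) (P (Suc n)) + smult B (P n) + smult C (P (n - 1)) \<and> (n = 0 \<longrightarrow> C = 0)"
proof -
  \<comment> \<open>\<open>Q\<close>, \<open>Q1\<close> and \<open>Q2\<close> are what is left after removing one, two and three leading coefficients.\<close>
  define Q where "Q = [:0, 1:] * P n - smult (up_coeff n) (P (Suc n))"
  have kpos: "coeff (P m) m \<noteq> 0" for m using lead_prod_pos[of m] by (simp add: coeff_P)
  have Qn1: "coeff Q (Suc n) = 0"
  proof -
    have "up_coeff n * (lead_prod (Suc n) / (2 ^ Suc n * fact (Suc n))) = 2 * real (Suc n) * lead_prod n / (2 ^ Suc n * fact (Suc n))"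
      using lead_prod_pos[of "Suc n"] by (simp add: up_coeff_def del: of_nat_Suc fact_Suc power_Suc)
    also have "\<dots> = lead_prod n / (2 ^ n * fact n)" by (simp del: of_nat_Suc)
    finally show ?thesis by (simp add: Q_def coeff_P del: fact_Suc power_Suc)
  qed
  have Qdeg: "coeff Q i = 0" if ni: "n < i" for i
  proof (cases "i = Suc n")
    case False
    obtain j where "i = Suc j" using ni by (cases i) auto
    then have j: "i = Suc j" "n < j" using ni False by auto
    then show ?thesis using degree_P[of n] degree_P[of "Suc n"] by (simp add: Q_def coeff_eq_0)
  qed (simp add: Qn1)
  have Qorth: "ip Q g = 0" if "Suc (degree g) < n" for g
  proof -
    have "ip ([:0, 1:] * P n) g = ip (P n) ([:0, 1:] * g)"
      using ip_shift[of "P n" "[:0, 1:]" g] by (simp only: mult.commute)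
    also have "\<dots> = 0"
      using that degree_mult_le[of "[:0, 1:]" g] by (intro ip_P_lower_degree) simp
    finally show ?thesis
      unfolding Q_def ip_diff ip_smult using ip_P_lower_degree[of g "Suc n"] that by simp
  qed
  define B where "B = coeff Q n / coeff (P n) n"
  define Q1 where "Q1 = Q - smult B (P n)"
  have Q1n: "coeff Q1 i = 0" if "n \<le> i" for i
  proof (cases "i = n")
    case True
    then show ?thesis using kpos[of n] by (simp add: Q1_def B_def)
  next
    case False
    then show ?thesis using Qdeg[of i] degree_P[of n] that by (simp add: Q1_def coeff_eq_0)
  qed
  show ?thesis
  proof (cases n)
    case 0
    then have "Q1 = 0" using Q1n by (simp add: poly_eq_iff)
    then have "[:0, 1:] * P n = smult (up_coeff n) (P (Suc n)) + smult B (P n) + smult 0 (P (n - 1))"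
      by (simp add: Q1_def Q_def algebra_simps)
    then show ?thesis by blast
  next
    case (Suc m)
    define C where "C = coeff Q1 m / coeff (P m) m"
    define Q2 where "Q2 = Q1 - smult C (P m)"
    have Q2m: "coeff Q2 i = 0" if "m \<le> i" for i
    proof (cases "i = m")
      case True
      then show ?thesis using kpos[of m] by (simp add: Q2_def C_def)
    next
      case False
      then show ?thesis using Q1n[of i] degree_P[of m] that Suc by (simp add: Q2_def coeff_eq_0)
    qed
    have "Q2 = 0"
    proof (rule ccontr)
      assume nz: "Q2 \<noteq> 0"
      have d: "degree Q2 < m"
      proof (rule ccontr)
        assume "\<not> degree Q2 < m"
        then have "coeff Q2 (degree Q2) = 0" by (intro Q2m) simp
        with nz show False by simp
      qed
      have "ip Q2 g = ip Q g - B * ip (P n) g - C * ip (P m) g" for g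
        by (simp add: Q2_def Q1_def ip_diff ip_smult)
      then have "ip Q2 Q2 = 0" using d Suc by (simp add: Qorth ip_P_lower_degree)
      then show False using nz ip_self_zero by blast
    qed
    then have "[:0, 1:] * P n = smult (up_coeff n) (P (Suc n)) + smult B (P n) + smult C (P (n - 1))"
      using Suc by (simp add: Q2_def Q1_def Q_def algebra_simps)
    then show ?thesis using Suc by blast
  qed
qed

section \<open>Recurrence coefficients of Jacobi polynomials\<close>

definition norm_sq :: "nat \<Rightarrow> real" where "norm_sq n = ip (P n) (P n)"

lemma jacobi_norm_eq: "jacobi_norm \<alpha> \<beta> n = sqrt (norm_sq n)"
  by (simp add: jacobi_norm_def norm_sq_def ip_def power2_eq_square)

lemma norm_sq_pos: "0 < norm_sq n"
proof -
  have "P n \<noteq> 0" using coeff_P[of n] lead_prod_pos[of n] by auto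
  then have "norm_sq n \<noteq> 0" using ip_self_zero unfolding norm_sq_def by blast
  moreover have "0 \<le> norm_sq n" unfolding norm_sq_def ip_def by simp
  ultimately show ?thesis by simp
qed

lemma ip_P: "ip (P m) (P n) = (if m = n then norm_sq n else 0)"
proof (cases m n rule: linorder_cases)
  case less
  then show ?thesis using ip_P_lower_degree[of "P m" n] degree_P[of m] ip_commute[of "P m" "P n"] by simp
next
  case greater
  then show ?thesis using ip_P_lower_degree[of "P n" m] degree_P[of n] by simp
qed (simp add: norm_sq_def)

definition diag_coeff :: "nat \<Rightarrow> real" where "diag_coeff n = ip ([:0, 1:] * P n) (P n) / norm_sq n"

text \<open>
  Symmetry of multiplication by \<open>x\<close> ties this coefficient to \<open>up_coeff\<close>.
\<close>
definition down_coeff :: "nat \<Rightarrow> real" where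
  "down_coeff n = (case n of 0 \<Rightarrow> 0 | Suc m \<Rightarrow> up_coeff m * norm_sq (Suc m) / norm_sq m)"

lemma recurrence_P: "[:0, 1:] * P n = smult (up_coeff n) (P (Suc n)) + smult (diag_coeff n) (P n) + smult (down_coeff n) (P (n - 1))"
proof -
  obtain B C where eq: "[:0, 1:] * P n = smult (up_coeff n) (P (Suc n)) + smult B (P n) + smult C (P (n - 1))"
    and C0: "n = 0 \<longrightarrow> C = 0" using three_term_recurrence by blast
  have "ip ([:0, 1:] * P n) (P n) = B * norm_sq n"
    unfolding eq using C0 by (cases n) (auto simp: ip_add ip_smult ip_P)
  then have B: "B = diag_coeff n" using norm_sq_pos[of n] by (simp add: diag_coeff_def)
  have C: "C = down_coeff n"
  proof (cases n)
    case 0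
    then show ?thesis using C0 by (simp add: down_coeff_def)
  next
    case (Suc m)
    obtain B' C' where eq': "[:0, 1:] * P m = smult (up_coeff m) (P (Suc m)) + smult B' (P m) + smult C' (P (m - 1))"
      using three_term_recurrence by blast
    have "C * norm_sq m = ip ([:0, 1:] * P n) (P m)"
      unfolding eq using Suc by (simp add: ip_add ip_smult ip_P)
    also have "\<dots> = ip ([:0, 1:] * P m) (P n)"
      using ip_shift[of "P n" "[:0, 1:]" "P m"] ip_commute by (simp only: mult.commute)
    also have "\<dots> = up_coeff m * norm_sq n"
      unfolding eq' using Suc by (simp add: ip_add ip_smult ip_P)
    finally show ?thesis using Suc norm_sq_pos[of m] by (simp add: down_coeff_def field_simps)
  qed
  show ?thesis using eq unfolding B C .
qed

lemma up_coeff_eq: "up_coeff n * ((\<alpha> + \<beta> + 2 * real n + 1) * (\<alpha> + \<beta> + 2 * real n + 2)) = 2 * (real n + 1) * (\<alpha> + \<beta> + real n + 1)"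
proof -
  have "up_coeff n * ((\<alpha> + \<beta> + 2 * real n + 1) * (\<alpha> + \<beta> + 2 * real n + 2))
      = 2 * (real n + 1) * ((\<alpha> + \<beta> + 2 * real n + 2) * (\<alpha> + \<beta> + 2 * real n + 1) * lead_prod n) / lead_prod (Suc n)"
    by (simp add: up_coeff_def add_ac)
  also have "\<dots> = 2 * (real n + 1) * (\<alpha> + \<beta> + real n + 1)"
    unfolding lead_prod_Suc[symmetric] using lead_prod_pos[of "Suc n"] by simp
  finally show ?thesis .
qed

lemma up_coeff_0: "up_coeff 0 * (\<alpha> + \<beta> + 2) = 2"
proof -
  have "\<alpha> + \<beta> + 2 \<noteq> 0" using \<alpha> \<beta> by simp
  moreover have "lead_prod 0 = 1" "lead_prod (Suc 0) = \<alpha> + \<beta> + 2" by (simp_all add: lead_prod_def)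
  moreover from this have "up_coeff 0 = 2 / (\<alpha> + \<beta> + 2)" by (simp add: up_coeff_def)
  ultimately show ?thesis using nonzero_eq_divide_eq by blast
qed

lemma up_coeff_bounds: "1 / (\<alpha> + \<beta> + 3) \<le> up_coeff n" "up_coeff n \<le> 2"
proof -
  define s where "s = \<alpha> + \<beta>"
  have s: "s \<ge> -1" using \<alpha> \<beta> by (simp add: s_def)
  have "1 / (s + 3) \<le> up_coeff n \<and> up_coeff n \<le> 2"
  proof (cases "n = 0")
    case True
    have "up_coeff 0 = 2 / (s + 2)" using up_coeff_0 s by (simp add: s_def field_simps)
    moreover have "1 / (s + 3) \<le> 2 / (s + 2)" using s by (intro frac_le) auto
    moreover have "2 / (s + 2) \<le> 2 / 1" using s by (intro divide_left_mono) auto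
    ultimately show ?thesis using True by simp
  next
    case False
    define t where "t = real n"
    have t: "t \<ge> 1" using False by (simp add: t_def)
    have pos: "0 < s + 2 * t + 1" "0 < s + 2 * t + 2" using s t by auto
    have "s + 2 * t + 2 \<le> (s + 3) * (t + 1)"
    proof -
      have "0 \<le> (s + 1) * t + 1" using s t by simp
      then show ?thesis by (simp add: algebra_simps)
    qed
    then have "(s + 2 * t + 1) * (s + 2 * t + 2) \<le> (2 * (s + t + 1)) * ((s + 3) * (t + 1))"
      using pos s t by (intro mult_mono) auto
    also have "\<dots> = (s + 3) * (2 * (t + 1) * (s + t + 1))" by (simp only: mult_ac)
    also have "\<dots> = (s + 3) * (up_coeff n * ((s + 2 * t + 1) * (s + 2 * t + 2)))"
      using up_coeff_eq[of n] by (simp only: s_def t_def)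
    finally have "1 * ((s + 2 * t + 1) * (s + 2 * t + 2)) \<le> ((s + 3) * up_coeff n) * ((s + 2 * t + 1) * (s + 2 * t + 2))"
      by (simp only: mult.assoc mult_1)
    then have 1: "1 \<le> (s + 3) * up_coeff n" using pos by (subst (asm) mult_le_cancel_right) auto
    have "up_coeff n * ((s + 2 * t + 1) * (s + 2 * t + 2)) = 2 * ((s + t + 1) * (t + 1))"
      using up_coeff_eq[of n] by (simp only: s_def t_def mult_ac)
    also have "\<dots> \<le> 2 * ((s + 2 * t + 1) * (s + 2 * t + 2))"
      using s t by (intro mult_left_mono mult_mono) auto
    finally have "up_coeff n \<le> 2" using pos by (subst (asm) mult_le_cancel_right) auto
    with 1 show ?thesis using s by (simp add: field_simps)
  qed
  then show "1 / (\<alpha> + \<beta> + 3) \<le> up_coeff n" "up_coeff n \<le> 2" by (auto simp: s_def)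
qed

lemma up_coeff_pos: "0 < up_coeff n"
  unfolding up_coeff_def using lead_prod_pos by simp

text \<open>
  Evaluating the recurrence at \<open>1\<close> and at \<open>-1\<close> gives two linear equations for the two remaining coefficients;
  their difference eliminates \<open>diag_coeff\<close>.
\<close>
lemma down_coeff_eq:
  assumes n: "1 \<le> n"
  shows "down_coeff n * ((\<alpha> + \<beta> + 2 * real n) * (\<alpha> + \<beta> + 2 * real n + 1)) = 2 * (\<alpha> + real n) * (\<beta> + real n)"
proof -
  obtain m where m: "n = Suc m" using n by (cases n) auto
  define t where "t = real n"
  have t: "1 \<le> t" "real (Suc m) = t" "real (Suc n) = t + 1" using n m by (auto simp: t_def)
  have ab: "0 < \<alpha> + t" "0 < \<beta> + t" using \<alpha> \<beta> t by auto
  define A B C where "A = up_coeff n" and "B = diag_coeff n" and "C = down_coeff n"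
  have ev: "x * poly (P n) x = A * poly (P (Suc n)) x + B * poly (P n) x + C * poly (P m) x" for x
    using arg_cong[OF recurrence_P[of n], of "\<lambda>q. poly q x"] by (simp add: A_def B_def C_def m)
  define q1 q2 r1 r2 where "q1 = (\<alpha> + t + 1) / (t + 1)" and "q2 = t / (\<alpha> + t)"
    and "r1 = (\<beta> + t + 1) / (t + 1)" and "r2 = t / (\<beta> + t)"
  have "right_value (Suc n) = q1 * right_value n" using right_value_Suc[of n] t by (simp add: q1_def t_def field_simps)
  moreover have "right_value m = q2 * right_value n"
  proof -
    have "t * right_value n = (\<alpha> + t) * right_value m" using right_value_Suc[of m] m by (simp add: t_def algebra_simps)
    then show ?thesis using ab by (simp add: q2_def field_simps)
  qed
  ultimately have "right_value n * 1 = right_value n * (A * q1 + B + C * q2)"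
    using ev[of 1] unfolding right_value_def by (simp add: algebra_simps)
  then have e1: "1 = A * q1 + B + C * q2"
    using right_value_pos[of n] by (subst (asm) mult_cancel_left) simp
  have "left_value (Suc n) = - r1 * left_value n" using left_value_Suc[of n] t by (simp add: r1_def t_def field_simps)
  moreover have "left_value m = - r2 * left_value n"
  proof -
    have "t * left_value n = - ((\<beta> + t) * left_value m)" using left_value_Suc[of m] m by (simp add: t_def algebra_simps)
    then have "left_value m = - (t * left_value n) / (\<beta> + t)" using ab by (simp add: field_simps)
    then show ?thesis by (simp add: r2_def)
  qed
  ultimately have "left_value n * (- 1) = left_value n * (B - A * r1 - C * r2)"
    using ev[of "-1"] unfolding left_value_def by (simp add: algebra_simps)
  then have e2: "- 1 = B - A * r1 - C * r2"
    using left_value_nonzero[of n] by (subst (asm) mult_cancel_left) simp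
  define c D where "c = \<alpha> + \<beta> + 2 * t" and "D = (\<alpha> + t) * (\<beta> + t)"
  have D: "D \<noteq> 0" using ab by (simp add: D_def)
  have q: "q1 + r1 = (c + 2) / (t + 1)"
    unfolding q1_def r1_def c_def add_divide_distrib[symmetric] by simp
  have r: "q2 + r2 = t * c / D"
    using ab by (simp add: q2_def r2_def c_def D_def field_simps)
  have X: "A * ((c + 1) * (c + 2)) = 2 * (t + 1) * (\<alpha> + \<beta> + t + 1)"
    unfolding A_def c_def t_def by (rule up_coeff_eq)
  have "2 = A * (q1 + r1) + C * (q2 + r2)" using e1 e2 by (simp add: distrib_left)
  then have "2 * (c + 1) = (A * ((c + 2) / (t + 1)) + C * (t * c / D)) * (c + 1)"
    unfolding q r by simp
  also have "\<dots> = A * ((c + 1) * (c + 2)) / (t + 1) + C * (c * (c + 1)) * t / D"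
  proof -
    have "(A * (f / u) + C * (t * c / D)) * e = A * (e * f) / u + C * (c * e) * t / D" for e f u
      by (simp add: algebra_simps)
    then show ?thesis .
  qed
  also have "A * ((c + 1) * (c + 2)) / (t + 1) = 2 * (\<alpha> + \<beta> + t + 1)"
  proof -
    have "2 * d * v / d = 2 * v" if "d \<noteq> 0" for d v :: real using that by simp
    from this[of "t + 1"] show ?thesis unfolding X using t by simp
  qed
  finally have "C * (c * (c + 1)) * t / D = t * 2" by (simp add: c_def)
  then have "C * (c * (c + 1)) * t = (2 * D) * t" using D by (simp add: divide_eq_eq mult_ac)
  then have "C * (c * (c + 1)) = 2 * D" using t by (subst (asm) mult_cancel_right) simp
  then show ?thesis unfolding C_def c_def t_def D_def by (simp only: mult.assoc)
qed

lemma down_coeff_lower: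
  assumes n: "1 \<le> n"
  shows "1 / (2 * (\<alpha> + \<beta> + 3)\<^sup>2) \<le> down_coeff n"
proof -
  define s t where "s = \<alpha> + \<beta>" and "t = real n"
  have s: "s \<ge> -1" and t: "t \<ge> 1" using \<alpha> \<beta> n by (auto simp: s_def t_def)
  have pos: "0 < s + 2 * t" using s t by simp
  have "0 \<le> (s + 1) * (t - 1)" using s t by simp
  then have le: "s + 2 * t + 1 \<le> (s + 3) * t" by (simp add: algebra_simps)
  then have "(s + 2 * t) * (s + 2 * t + 1) \<le> ((s + 3) * t) * ((s + 3) * t)"
    using pos by (intro mult_mono) auto
  also have "\<dots> = 4 * (s + 3)\<^sup>2 * ((t / 2) * (t / 2))" by (simp add: power2_eq_square)
  also have "\<dots> \<le> 4 * (s + 3)\<^sup>2 * ((\<alpha> + t) * (\<beta> + t))"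
    using \<alpha> \<beta> t by (intro mult_left_mono mult_mono) auto
  also have "\<dots> = 2 * (s + 3)\<^sup>2 * (2 * (\<alpha> + t) * (\<beta> + t))" by simp
  also have "\<dots> = 2 * (s + 3)\<^sup>2 * (down_coeff n * ((s + 2 * t) * (s + 2 * t + 1)))"
    unfolding s_def t_def down_coeff_eq[OF n] ..
  also have "\<dots> = (2 * (s + 3)\<^sup>2 * down_coeff n) * ((s + 2 * t) * (s + 2 * t + 1))" by (simp only: mult.assoc)
  finally have "1 * ((s + 2 * t) * (s + 2 * t + 1)) \<le> (2 * (s + 3)\<^sup>2 * down_coeff n) * ((s + 2 * t) * (s + 2 * t + 1))"
    by simp
  then have "1 \<le> 2 * (s + 3)\<^sup>2 * down_coeff n" using pos by (subst (asm) mult_le_cancel_right) auto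
  then show ?thesis using s by (simp add: s_def[symmetric] field_simps)
qed

text \<open>
  The coefficients of the recurrence for the polynomials normalized to be \<open>1\<close> at the point \<open>1\<close>, that is, the
  jump rates of the birth-death chain. The value of \<open>down_rate\<close> at \<open>0\<close> is \<open>0\<close>, also when the denominator vanishes.
\<close>
definition up_rate :: "nat \<Rightarrow> real" where "up_rate n = up_coeff n * (\<alpha> + real n + 1) / (real n + 1)"
definition down_rate :: "nat \<Rightarrow> real" where "down_rate n = down_coeff n * real n / (\<alpha> + real n)"

lemma up_rate_eq: "up_rate n * ((\<alpha> + \<beta> + 2 * real n + 1) * (\<alpha> + \<beta> + 2 * real n + 2))
    = 2 * (\<alpha> + real n + 1) * (\<alpha> + \<beta> + real n + 1)"
proof -
  have "up_rate n * ((\<alpha> + \<beta> + 2 * real n + 1) * (\<alpha> + \<beta> + 2 * real n + 2))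
    = (up_coeff n * ((\<alpha> + \<beta> + 2 * real n + 1) * (\<alpha> + \<beta> + 2 * real n + 2))) * (\<alpha> + real n + 1) / (real n + 1)"
    by (simp add: up_rate_def)
  also have "\<dots> = 2 * (\<alpha> + real n + 1) * (\<alpha> + \<beta> + real n + 1)"
  proof -
    have cancel: "2 * d * u * v / d = 2 * v * u" if "d \<noteq> 0" for d u v :: real using that by simp
    show ?thesis unfolding up_coeff_eq by (rule cancel) simp
  qed
  finally show ?thesis .
qed

lemma up_rate_0: "up_rate 0 * (\<alpha> + \<beta> + 2) = 2 * (\<alpha> + 1)"
  using up_coeff_0 by (simp add: up_rate_def mult_ac)

lemma down_rate_eq:
  "1 \<le> n \<Longrightarrow> down_rate n * ((\<alpha> + \<beta> + 2 * real n) * (\<alpha> + \<beta> + 2 * real n + 1)) = 2 * real n * (\<beta> + real n)"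
proof -
  assume n: "1 \<le> n"
  then have a: "0 < \<alpha> + real n" using \<alpha> by auto
  have "down_rate n * ((\<alpha> + \<beta> + 2 * real n) * (\<alpha> + \<beta> + 2 * real n + 1))
      = (down_coeff n * ((\<alpha> + \<beta> + 2 * real n) * (\<alpha> + \<beta> + 2 * real n + 1))) * real n / (\<alpha> + real n)"
    by (simp add: down_rate_def)
  also have "\<dots> = 2 * real n * (\<beta> + real n)"
  proof -
    have cancel: "2 * d * u * v / d = 2 * v * u" if "d \<noteq> 0" for d u v :: real using that by simp
    show ?thesis unfolding down_coeff_eq[OF n] by (rule cancel) (use a in simp)
  qed
  finally show ?thesis .
qed

lemma down_rate_0: "down_rate 0 = 0" by (simp add: down_rate_def)

lemma up_rate_upper: "up_rate n \<le> 2 * (1 + \<bar>\<alpha>\<bar>)"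
proof -
  have "(\<alpha> + real n + 1) / (real n + 1) \<le> 1 + \<bar>\<alpha>\<bar>"
  proof -
    have "\<bar>\<alpha>\<bar> * 1 \<le> \<bar>\<alpha>\<bar> * (real n + 1)" by (intro mult_left_mono) auto
    then have "\<alpha> + real n + 1 \<le> (1 + \<bar>\<alpha>\<bar>) * (real n + 1)" by (simp add: distrib_right)
    then show ?thesis by (simp add: divide_le_eq)
  qed
  then have "up_coeff n * ((\<alpha> + real n + 1) / (real n + 1)) \<le> 2 * (1 + \<bar>\<alpha>\<bar>)"
    using up_coeff_bounds(2)[of n] up_coeff_pos[of n] \<alpha> by (intro mult_mono) auto
  then show ?thesis by (simp add: up_rate_def)
qed

text \<open>
  With \<open>c = \<alpha> + \<beta> + 2 * n\<close> the drift is \<open>(2 \<alpha> + 1) (c + 1) / (c (c + 2))\<close> up to a term of order \<open>n\<close> to the power \<open>-3\<close>.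
\<close>
lemma drift_upper: "up_rate n - down_rate n \<le> (2 * (2 * \<alpha> + 1) + (\<alpha> + \<beta> + 1) * \<bar>\<beta> - \<alpha> - 1\<bar> + 2 * (1 + \<bar>\<alpha>\<bar>)) / (real n + 1)"
proof (cases "n = 0")
  case True
  have "0 \<le> 2 * (2 * \<alpha> + 1) + (\<alpha> + \<beta> + 1) * \<bar>\<beta> - \<alpha> - 1\<bar>"
  proof -
    have "0 \<le> 2 * (2 * \<alpha> + 1)" "0 \<le> \<alpha> + \<beta> + 1" using \<alpha> \<beta> by auto
    then show ?thesis by (metis abs_ge_zero add_nonneg_nonneg mult_nonneg_nonneg)
  qed
  then show ?thesis using True up_rate_upper[of 0] down_rate_0 by simp
next
  case False
  define t c where "t = real n" and "c = \<alpha> + \<beta> + 2 * t"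
  have t: "t \<ge> 1" using False by (simp add: t_def)
  have c: "c \<ge> 1" "c + 2 \<ge> t + 1" using t \<alpha> \<beta> by (auto simp: c_def)
  have A: "up_rate n = 2 * (\<alpha> + t + 1) * (\<alpha> + \<beta> + t + 1) / ((c + 1) * (c + 2))"
    using up_rate_eq[of n] c by (simp add: t_def c_def eq_divide_eq)
  have C: "down_rate n = 2 * t * (\<beta> + t) / (c * (c + 1))"
    using down_rate_eq[of n] c False by (simp add: t_def c_def eq_divide_eq)
  have "up_rate n - down_rate n = ((2 * (\<alpha> + t + 1) * (\<alpha> + \<beta> + t + 1)) * c - (2 * t * (\<beta> + t)) * (c + 2)) / (c * (c + 1) * (c + 2))"
  proof -
    have "n1 / (d * e) - n2 / (c * d) = (n1 * c - n2 * e) / (c * d * e)"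
      if "d \<noteq> 0" "e \<noteq> 0" for n1 n2 d e using that c by (simp add: field_simps)
    from this[of "c + 1" "c + 2"] show ?thesis unfolding A C using c by simp
  qed
  also have "(2 * (\<alpha> + t + 1) * (\<alpha> + \<beta> + t + 1)) * c - (2 * t * (\<beta> + t)) * (c + 2)
      = (2 * \<alpha> + 1) * ((c + 1) * (c + 1)) + (\<alpha> + \<beta> + 1) * (\<beta> - \<alpha> - 1)"
    by (simp add: c_def algebra_simps)
  also have "\<dots> / (c * (c + 1) * (c + 2)) = (2 * \<alpha> + 1) * ((c + 1) / c) / (c + 2)
      + (\<alpha> + \<beta> + 1) * (\<beta> - \<alpha> - 1) / (c * (c + 1)) / (c + 2)"
  proof -
    have "(u * (d * d) + v) / (c * d * e) = u * (d / c) / e + v / (c * d) / e"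
      if "d \<noteq> 0" for u v d e using that c by (simp add: add_divide_distrib)
    from this[of "c + 1"] show ?thesis using c by simp
  qed
  also have "\<dots> \<le> (2 * (2 * \<alpha> + 1)) / (t + 1) + ((\<alpha> + \<beta> + 1) * \<bar>\<beta> - \<alpha> - 1\<bar>) / (t + 1)"
  proof (rule add_mono; rule frac_le)
    have "(c + 1) / c \<le> 2" using c by (simp add: divide_le_eq)
    then have "(2 * \<alpha> + 1) * ((c + 1) / c) \<le> (2 * \<alpha> + 1) * 2" using \<alpha> by (intro mult_left_mono) auto
    then show "(2 * \<alpha> + 1) * ((c + 1) / c) \<le> 2 * (2 * \<alpha> + 1)" by simp
    have x: "(\<alpha> + \<beta> + 1) * (\<beta> - \<alpha> - 1) \<le> (\<alpha> + \<beta> + 1) * \<bar>\<beta> - \<alpha> - 1\<bar>"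
      using \<alpha> \<beta> by (intro mult_left_mono) auto
    have x0: "0 \<le> (\<alpha> + \<beta> + 1) * \<bar>\<beta> - \<alpha> - 1\<bar>" using \<alpha> \<beta> by simp
    have cc: "1 \<le> c * (c + 1)" using c mult_mono[of 1 c 1 "c + 1"] by simp
    have "(\<alpha> + \<beta> + 1) * (\<beta> - \<alpha> - 1) / (c * (c + 1)) \<le> (\<alpha> + \<beta> + 1) * \<bar>\<beta> - \<alpha> - 1\<bar> / (c * (c + 1))"
      using x cc by (intro divide_right_mono) auto
    also have "\<dots> \<le> (\<alpha> + \<beta> + 1) * \<bar>\<beta> - \<alpha> - 1\<bar> / 1" using x0 cc by (intro divide_left_mono) auto
    finally show "(\<alpha> + \<beta> + 1) * (\<beta> - \<alpha> - 1) / (c * (c + 1)) \<le> (\<alpha> + \<beta> + 1) * \<bar>\<beta> - \<alpha> - 1\<bar>" by simp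
  qed (use c t \<alpha> \<beta> in auto)
  also have "\<dots> \<le> (2 * (2 * \<alpha> + 1) + (\<alpha> + \<beta> + 1) * \<bar>\<beta> - \<alpha> - 1\<bar> + 2 * (1 + \<bar>\<alpha>\<bar>)) / (t + 1)"
  proof -
    have drop: "X / (t + 1) + Y / (t + 1) \<le> (X + Y + Z) / (t + 1)" if "0 \<le> Z" for X Y Z
      unfolding add_divide_distrib[symmetric] using t that by (intro divide_right_mono) auto
    show ?thesis by (rule drop) simp
  qed
  finally show ?thesis by (simp add: t_def)
qed

text \<open>
  The ratio of the rates across an edge is the ratio of the squares of \<open>h\<close> at its ends. In the parameters
  \<open>a = \<alpha> + 1 / 2\<close> and \<open>b = \<beta> + 1 / 2\<close> the difference of numerator and denominator is a polynomial in \<open>a\<close> with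
  nonnegative coefficients, except for the constant term \<open>(b - b\<^sup>2) / 2\<close>. That exception only affects a term of
  order \<open>1 / n ^ 3\<close> in the ratio, so \<open>h\<close> is increasing up to a convergent product.
\<close>
lemma down_rate_Suc_le: "down_rate (Suc n) \<le> (1 + (2 * (\<beta> + 1 / 2)\<^sup>2 + \<bar>\<beta>\<bar>) / (real n + 1)\<^sup>2) * up_rate n"
proof (cases "n = 0")
  case True
  have s: "0 < \<alpha> + \<beta> + 2" "2 \<le> \<alpha> + \<beta> + 3" "1 / 2 \<le> \<alpha> + 1" using \<alpha> \<beta> by auto
  have A: "up_rate 0 = 2 * (\<alpha> + 1) / (\<alpha> + \<beta> + 2)" using up_rate_0 s by (simp add: field_simps)
  have C: "down_rate 1 = 2 * (\<beta> + 1) / ((\<alpha> + \<beta> + 2) * (\<alpha> + \<beta> + 3))"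
    using down_rate_eq[of 1] s by (simp add: eq_divide_eq add_ac)
  have "(\<beta> + 1) * 1 \<le> (1 + \<bar>\<beta>\<bar>) * ((\<alpha> + 1) * (\<alpha> + \<beta> + 3))"
    using \<beta> s mult_mono[of "1/2" "\<alpha> + 1" 2 "\<alpha> + \<beta> + 3"] by (intro mult_mono) auto
  also have "\<dots> \<le> (1 + (2 * (\<beta> + 1 / 2)\<^sup>2 + \<bar>\<beta>\<bar>)) * ((\<alpha> + 1) * (\<alpha> + \<beta> + 3))"
    using s by (intro mult_right_mono) auto
  finally have "2 * (\<beta> + 1) / ((\<alpha> + \<beta> + 2) * (\<alpha> + \<beta> + 3)) \<le>
      2 * ((1 + (2 * (\<beta> + 1 / 2)\<^sup>2 + \<bar>\<beta>\<bar>)) * ((\<alpha> + 1) * (\<alpha> + \<beta> + 3))) / ((\<alpha> + \<beta> + 2) * (\<alpha> + \<beta> + 3))"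
    using s by (intro divide_right_mono) auto
  also have "\<dots> = (1 + (2 * (\<beta> + 1 / 2)\<^sup>2 + \<bar>\<beta>\<bar>)) * up_rate 0" unfolding A using s by simp
  finally show ?thesis using True C by simp
next
  case False
  define t a b where "t = real n" and "a = \<alpha> + 1 / 2" and "b = \<beta> + 1 / 2"
  define S where "S = 2 * t + a + b"
  have t: "t \<ge> 1" and ab: "0 \<le> a" "0 \<le> b" using False \<alpha> \<beta> by (auto simp: t_def a_def b_def)
  define k where "k = 1 + (2 * b\<^sup>2 + \<bar>\<beta>\<bar>) / (t + 1)\<^sup>2"
  have S: "S \<ge> 2" using t ab by (simp add: S_def)
  have A: "up_rate n = 2 * (t + a + 1 / 2) * (t + a + b) / (S * (S + 1))"
  proof -
    have e: "\<alpha> + \<beta> + 2 * real n + 1 = S" "\<alpha> + \<beta> + 2 * real n + 2 = S + 1"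
      "\<alpha> + real n + 1 = t + a + 1 / 2" "\<alpha> + \<beta> + real n + 1 = t + a + b"
      by (simp_all add: t_def a_def b_def S_def)
    have "up_rate n * (S * (S + 1)) = 2 * (t + a + 1 / 2) * (t + a + b)"
      using up_rate_eq[of n] by (simp only: e)
    moreover have "S * (S + 1) \<noteq> 0" using S by simp
    ultimately show ?thesis using nonzero_eq_divide_eq by blast
  qed
  have C: "down_rate (Suc n) = 2 * (t + 1) * (t + b + 1 / 2) / ((S + 1) * (S + 2))"
  proof -
    have e: "real (Suc n) = t + 1" "\<alpha> + \<beta> + 2 * (t + 1) = S + 1" "S + 1 + 1 = S + 2"
      "\<beta> + (t + 1) = t + b + 1 / 2"
      by (simp_all add: t_def a_def b_def S_def)
    have "1 \<le> Suc n" by simp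
    from down_rate_eq[OF this] have "down_rate (Suc n) * ((S + 1) * (S + 2)) = 2 * (t + 1) * (t + b + 1 / 2)"
      by (simp only: e)
    moreover have "(S + 1) * (S + 2) \<noteq> 0" using S by simp
    ultimately show ?thesis using nonzero_eq_divide_eq by blast
  qed
  have key: "S * ((t + 1) * (t + b + 1 / 2)) \<le> (t + a + 1 / 2) * (t + a + b) * (S + 2) + b\<^sup>2 / 2"
  proof -
    define R where "R = (t + 1 / 2) * (2 * t + b + 2) + (t + b) * (2 * t + b + 2) + (t + b) * (t + 1 / 2)
            - (t + 1) * (t + b + 1 / 2)"
    define Q where "Q = (2 * t + b + 2) + (t + 1 / 2) + (t + b)"
    have eq: "(t + a + 1 / 2) * (t + a + b) * (S + 2) + b\<^sup>2 / 2 - S * ((t + 1) * (t + b + 1 / 2))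
        = b / 2 + a * R + a\<^sup>2 * Q + a ^ 3"
      unfolding S_def R_def Q_def by (simp add: field_simps power2_eq_square power3_eq_cube)
    have "(t + 1) * (t + b + 1 / 2) \<le> (2 * t + b + 2) * ((t + b) + (t + 1 / 2))"
      by (rule mult_mono) (use t ab in auto)
    also have "\<dots> = R - (t + b) * (t + 1 / 2) + (t + 1) * (t + b + 1 / 2)"
      unfolding R_def by algebra
    finally have "(t + b) * (t + 1 / 2) \<le> R" by linarith
    moreover have "0 \<le> (t + b) * (t + 1 / 2)" using t ab by simp
    ultimately have "0 \<le> a * R" using ab(1) by (intro mult_nonneg_nonneg) linarith+
    moreover have "0 \<le> a\<^sup>2 * Q" using t ab unfolding Q_def by (intro mult_nonneg_nonneg) auto
    moreover have "0 \<le> a ^ 3" "0 \<le> b / 2" using ab by auto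
    ultimately show ?thesis using eq by linarith
  qed
  have "(t + 1)\<^sup>2 / 4 \<le> (t + a + 1 / 2) * (t + a + b) * (S + 2)"
  proof -
    have "((t + 1) / 2 * ((t + 1) / 2)) * 1 \<le> (t + a + 1 / 2) * (t + a + b) * (S + 2)"
      using t ab S by (intro mult_mono) auto
    then show ?thesis by (simp add: power2_eq_square)
  qed
  then have "2 * b\<^sup>2 / (t + 1)\<^sup>2 * ((t + 1)\<^sup>2 / 4) \<le> 2 * b\<^sup>2 / (t + 1)\<^sup>2 * ((t + a + 1 / 2) * (t + a + b) * (S + 2))"
    by (intro mult_left_mono) auto
  moreover have "2 * b\<^sup>2 / (t + 1)\<^sup>2 * ((t + 1)\<^sup>2 / 4) = b\<^sup>2 / 2" using t by simp
  ultimately have "S * ((t + 1) * (t + b + 1 / 2)) \<le> (1 + 2 * b\<^sup>2 / (t + 1)\<^sup>2) * ((t + a + 1 / 2) * (t + a + b) * (S + 2))"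
    using key by (simp add: distrib_right)
  also have "\<dots> \<le> k * ((t + a + 1 / 2) * (t + a + b) * (S + 2))"
    unfolding k_def using t ab S by (intro mult_right_mono) (auto simp: add_divide_distrib)
  finally have "2 * (S * ((t + 1) * (t + b + 1 / 2))) / (S * (S + 1) * (S + 2))
      \<le> 2 * (k * ((t + a + 1 / 2) * (t + a + b) * (S + 2))) / (S * (S + 1) * (S + 2))"
    using S by (intro divide_right_mono) auto
  moreover have "2 * (S * ((t + 1) * (t + b + 1 / 2))) / (S * (S + 1) * (S + 2)) = down_rate (Suc n)"
  proof -
    have "2 * (S * (u * v)) / (S * d * e) = 2 * u * v / (d * e)" for u v d e using S by simp
    then show ?thesis unfolding C .
  qed
  moreover have "2 * (k * ((t + a + 1 / 2) * (t + a + b) * (S + 2))) / (S * (S + 1) * (S + 2)) = k * up_rate n"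
  proof -
    have cancel: "2 * (k * (u * v * e)) / (S * d * e) = k * (2 * u * v / (S * d))" if "e \<noteq> 0" for u v d e
      using that by simp
    show ?thesis unfolding A by (rule cancel) (use S in simp)
  qed
  ultimately show ?thesis by (simp add: k_def b_def t_def)
qed

section \<open>The Jacobi heat kernel\<close>

definition pnorm :: "nat \<Rightarrow> real" where "pnorm n = sqrt (norm_sq n)"
definition offdiag :: "nat \<Rightarrow> real" where "offdiag n = up_coeff n * pnorm (Suc n) / pnorm n"
text \<open>
  The value at \<open>1\<close> of the normalized polynomial, the positive solution \<open>h\<close> of the recurrence at \<open>x = 1\<close>.
\<close>
definition endpoint :: "nat \<Rightarrow> real" where "endpoint n = right_value n / pnorm n"

lemma pnorm_pos: "0 < pnorm n" by (simp add: pnorm_def norm_sq_pos)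
lemma pnorm_sq: "pnorm n * pnorm n = norm_sq n" using norm_sq_pos[of n] by (simp add: pnorm_def)
lemma endpoint_pos: "0 < endpoint n" using right_value_pos pnorm_pos by (simp add: endpoint_def)

lemma jacobi_normalized_eq: "jacobi_normalized \<alpha> \<beta> n x = poly (P n) x / pnorm n"
  by (simp add: jacobi_normalized_def jacobi_norm_eq pnorm_def)

lemma offdiag_sq: "(offdiag n)\<^sup>2 = up_coeff n * down_coeff (Suc n)"
proof -
  have "(offdiag n)\<^sup>2 = up_coeff n * (up_coeff n * (pnorm (Suc n) * pnorm (Suc n)) / (pnorm n * pnorm n))"
    by (simp add: offdiag_def power2_eq_square)
  then show ?thesis unfolding pnorm_sq by (simp add: down_coeff_def)
qed

lemma offdiag_pos: "0 < offdiag n" using up_coeff_pos pnorm_pos by (simp add: offdiag_def)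

lemma offdiag_lower: "sqrt (1 / (2 * (\<alpha> + \<beta> + 3) ^ 3)) \<le> offdiag n"
proof (rule real_le_lsqrt)
  have s: "0 < \<alpha> + \<beta> + 3" using \<alpha> \<beta> by simp
  have "1 / (2 * (\<alpha> + \<beta> + 3) ^ 3) = 1 / (\<alpha> + \<beta> + 3) * (1 / (2 * (\<alpha> + \<beta> + 3)\<^sup>2))"
    by (simp add: power2_eq_square power3_eq_cube)
  also have "\<dots> \<le> up_coeff n * down_coeff (Suc n)"
    using up_coeff_bounds(1)[of n] down_coeff_lower[of "Suc n"] up_coeff_pos[of n] s by (intro mult_mono) auto
  finally show "1 / (2 * (\<alpha> + \<beta> + 3) ^ 3) \<le> (offdiag n)\<^sup>2" unfolding offdiag_sq .
qed (use offdiag_pos[of n] in simp)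

text \<open>
  Together with \<open>offdiag_down\<close> this is detailed balance: the chain with the rates \<open>up_rate\<close> and \<open>down_rate\<close> is reversible with respect to the
  squares of \<open>endpoint\<close>.
\<close>
lemma offdiag_up: "offdiag n * endpoint (Suc n) = up_rate n * endpoint n"
proof -
  have "right_value (Suc n) = (\<alpha> + real n + 1) / (real n + 1) * right_value n" using right_value_Suc[of n] by (simp add: field_simps)
  then show ?thesis using pnorm_pos[of n] pnorm_pos[of "Suc n"] by (simp add: offdiag_def endpoint_def up_rate_def mult_ac)
qed

lemma offdiag_down: "offdiag n * endpoint n = down_rate (Suc n) * endpoint (Suc n)"
proof -
  have a: "0 < \<alpha> + real n + 1" using \<alpha> by simp
  have right_value: "right_value n = real (Suc n) / (\<alpha> + real n + 1) * right_value (Suc n)" using right_value_Suc[of n] a by (simp add: field_simps)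
  have "offdiag n * endpoint n = up_coeff n * pnorm (Suc n) * right_value n / (pnorm n * pnorm n)"
    by (simp add: offdiag_def endpoint_def)
  also have "\<dots> = up_coeff n * (pnorm (Suc n) * pnorm (Suc n)) / norm_sq n * (real (Suc n) / (\<alpha> + real n + 1)) * (right_value (Suc n) / pnorm (Suc n))"
    unfolding pnorm_sq[of n] right_value using pnorm_pos[of "Suc n"] by (simp add: mult_ac)
  also have "\<dots> = down_rate (Suc n) * endpoint (Suc n)"
    unfolding pnorm_sq by (simp add: down_rate_def down_coeff_def endpoint_def add_ac)
  finally show ?thesis .
qed

lemma endpoint_quasi_monotone:
  assumes "m \<le> n"
  shows "endpoint m \<le> exp (2 * (\<beta> + 1 / 2)\<^sup>2 + \<bar>\<beta>\<bar>) * endpoint n"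
proof -
  define \<kappa> where "\<kappa> = 2 * (\<beta> + 1 / 2)\<^sup>2 + \<bar>\<beta>\<bar>"
  have "(endpoint m)\<^sup>2 \<le> exp (2 * \<kappa>) * (endpoint n)\<^sup>2"
  proof (rule quasi_monotone_from_ratio[OF _ _ _ assms])
    fix k
    have "0 < up_rate k * endpoint k"
      unfolding offdiag_up[symmetric] by (rule mult_pos_pos[OF offdiag_pos endpoint_pos])
    then have up_rate: "0 < up_rate k" using endpoint_pos by (rule zero_less_mult_pos2)
    have "up_rate k * (endpoint k)\<^sup>2 = (offdiag k * endpoint k) * endpoint (Suc k)"
      unfolding power2_eq_square mult.assoc[symmetric] offdiag_up[symmetric] by (simp only: mult_ac)
    also have "\<dots> = down_rate (Suc k) * (endpoint (Suc k))\<^sup>2"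
      unfolding offdiag_down power2_eq_square by (simp only: mult_ac)
    also have "\<dots> \<le> ((1 + \<kappa> / (real k + 1)\<^sup>2) * up_rate k) * (endpoint (Suc k))\<^sup>2"
      unfolding \<kappa>_def by (intro mult_right_mono down_rate_Suc_le) simp
    finally have "up_rate k * (endpoint k)\<^sup>2 \<le> up_rate k * ((1 + \<kappa> / (real k + 1)\<^sup>2) * (endpoint (Suc k))\<^sup>2)"
      by (simp only: mult_ac)
    then show "(endpoint k)\<^sup>2 \<le> (1 + \<kappa> / (real k + 1)\<^sup>2) * (endpoint (Suc k))\<^sup>2"
      using up_rate by (subst (asm) mult_le_cancel_left_pos) auto
  qed (auto simp: \<kappa>_def)
  also have "\<dots> = (exp \<kappa> * endpoint n)\<^sup>2" by (simp add: power_mult_distrib exp_double)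
  finally show ?thesis
    unfolding \<kappa>_def using endpoint_pos[of n] by (intro power2_le_imp_le[of "endpoint m"]) auto
qed

theorem heat_kernel_geometric_bound:
  "\<exists>D>0. \<forall>t>0. \<exists>\<rho>. 0 \<le> \<rho> \<and> \<rho> < 1 \<and>
    (\<forall>m n. \<bar>heat_kernel \<alpha> \<beta> t m n\<bar> \<le> D * (1 - \<rho>) * \<rho> ^ (if m \<le> n then n - m else m - n))"
proof -
  define c where "c = sqrt (1 / (2 * (\<alpha> + \<beta> + 3) ^ 3))"
  define L0 where "L0 = 2 * (2 * \<alpha> + 1) + (\<alpha> + \<beta> + 1) * \<bar>\<beta> - \<alpha> - 1\<bar> + 2 * (1 + \<bar>\<alpha>\<bar>)"
  define L where "L = L0 + 2 * (1 + \<bar>\<alpha>\<bar>) / c"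
  define offdiag' where "offdiag' = (\<lambda>n. case n of 0 \<Rightarrow> 0 | Suc k \<Rightarrow> offdiag k)"
  have s: "0 < \<alpha> + \<beta> + 3" using \<alpha> \<beta> by simp
  have c: "0 < c" using s by (simp add: c_def)
  have L0: "0 \<le> L0"
  proof -
    have "0 \<le> 2 * \<alpha> + 1" "0 \<le> \<alpha> + \<beta> + 1" using \<alpha> \<beta> by auto
    then have "0 \<le> 2 * (2 * \<alpha> + 1)" "0 \<le> (\<alpha> + \<beta> + 1) * \<bar>\<beta> - \<alpha> - 1\<bar>" by simp_all
    then show ?thesis unfolding L0_def by simp
  qed
  have L: "L0 \<le> L" "2 * (1 + \<bar>\<alpha>\<bar>) / c \<le> L" using L0 c by (simp_all add: L_def)
  interpret K: orthonormal_recurrence M "jacobi_normalized \<alpha> \<beta>" offdiag diag_coeff offdiag' endpoint c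
    "exp (2 * (\<beta> + 1 / 2)\<^sup>2 + \<bar>\<beta>\<bar>)" L
  proof
    show "space M = {-1..1}" by (rule space_M)
    show "sets M = sets (restrict_space borel {-1..1})" by (rule sets_M)
    show "continuous_on UNIV (jacobi_normalized \<alpha> \<beta> n)" for n
      unfolding jacobi_normalized_eq[abs_def] using pnorm_pos[of n] by (intro continuous_intros) auto
    show "(\<integral>x. jacobi_normalized \<alpha> \<beta> m x * jacobi_normalized \<alpha> \<beta> n x \<partial>M) = (if m = n then 1 else 0)" for m n
    proof -
      have "(\<integral>x. jacobi_normalized \<alpha> \<beta> m x * jacobi_normalized \<alpha> \<beta> n x \<partial>M) = ip (P m) (P n) / (pnorm m * pnorm n)"
        unfolding jacobi_normalized_eq ip_def by simp
      also have "\<dots> = (if m = n then 1 else 0)"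
        unfolding ip_P pnorm_sq[of n, symmetric] using pnorm_pos[of n] by simp
      finally show ?thesis .
    qed
    show "offdiag' n = (case n of 0 \<Rightarrow> 0 | Suc k \<Rightarrow> offdiag k)" for n by (simp add: offdiag'_def)
    show "x * jacobi_normalized \<alpha> \<beta> n x = offdiag n * jacobi_normalized \<alpha> \<beta> (Suc n) x
        + diag_coeff n * jacobi_normalized \<alpha> \<beta> n x + offdiag' n * jacobi_normalized \<alpha> \<beta> (n - 1) x" for n x
    proof -
      have "x * poly (P n) x = up_coeff n * poly (P (Suc n)) x + diag_coeff n * poly (P n) x + down_coeff n * poly (P (n - 1)) x"
        using arg_cong[OF recurrence_P[of n], of "\<lambda>q. poly q x"] by simp
      then have "x * jacobi_normalized \<alpha> \<beta> n x = up_coeff n * poly (P (Suc n)) x / pnorm n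
          + diag_coeff n * jacobi_normalized \<alpha> \<beta> n x + down_coeff n * poly (P (n - 1)) x / pnorm n"
        unfolding jacobi_normalized_eq by (simp add: add_divide_distrib)
      moreover have "up_coeff n * poly (P (Suc n)) x / pnorm n = offdiag n * jacobi_normalized \<alpha> \<beta> (Suc n) x"
        using pnorm_pos[of "Suc n"] by (simp add: jacobi_normalized_eq offdiag_def)
      moreover have "down_coeff n * poly (P (n - 1)) x / pnorm n = offdiag' n * jacobi_normalized \<alpha> \<beta> (n - 1) x"
        using pnorm_pos[of n] by (cases n) (simp_all add: jacobi_normalized_eq offdiag'_def offdiag_def down_coeff_def pnorm_sq[symmetric])
      ultimately show ?thesis by simp
    qed
    show "endpoint n = jacobi_normalized \<alpha> \<beta> n 1" for n by (simp add: endpoint_def right_value_def jacobi_normalized_eq)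
    show "0 < endpoint n" for n by (rule endpoint_pos)
    show "0 < c" by (rule c)
    show "c \<le> offdiag n" for n unfolding c_def by (rule offdiag_lower)
    show "endpoint m \<le> exp (2 * (\<beta> + 1 / 2)\<^sup>2 + \<bar>\<beta>\<bar>) * endpoint n" if "m \<le> n" for m n
      using that by (rule endpoint_quasi_monotone)
    show "endpoint (Suc n) \<le> L * endpoint n" for n
    proof -
      have "c * endpoint (Suc n) \<le> offdiag n * endpoint (Suc n)"
        using offdiag_lower[of n] endpoint_pos[of "Suc n"] unfolding c_def by (intro mult_right_mono) auto
      also have "\<dots> \<le> 2 * (1 + \<bar>\<alpha>\<bar>) * endpoint n"
        unfolding offdiag_up using endpoint_pos[of n] by (intro mult_right_mono up_rate_upper) auto
      finally have "endpoint (Suc n) \<le> 2 * (1 + \<bar>\<alpha>\<bar>) / c * endpoint n" using c by (simp add: field_simps)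
      also have "\<dots> \<le> L * endpoint n" using L endpoint_pos[of n] by (intro mult_right_mono) auto
      finally show ?thesis .
    qed
    show "offdiag n * endpoint (Suc n) - offdiag' n * endpoint (n - 1) \<le> L / (real n + 1) * endpoint n" for n
    proof -
      have "offdiag' n * endpoint (n - 1) = down_rate n * endpoint n"
        using offdiag_down down_rate_0 by (cases n) (auto simp: offdiag'_def)
      then have "offdiag n * endpoint (Suc n) - offdiag' n * endpoint (n - 1) = (up_rate n - down_rate n) * endpoint n"
        unfolding offdiag_up by (simp add: left_diff_distrib)
      also have "\<dots> \<le> L0 / (real n + 1) * endpoint n"
        using endpoint_pos[of n] unfolding L0_def by (intro mult_right_mono drift_upper) auto
      also have "\<dots> \<le> L / (real n + 1) * endpoint n"
        using endpoint_pos[of n] L by (intro mult_right_mono divide_right_mono) auto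
      finally show ?thesis .
    qed
  qed
  have "K.K t m n = heat_kernel \<alpha> \<beta> t m n" for t m n
    by (simp add: K.K_def heat_kernel_def)
  then show ?thesis using K.K_geometric_bound by simp
qed

end

theorem theorem4p1:
  fixes \<alpha> \<beta> :: real
  assumes "\<alpha> \<ge> - 1 / 2" and "\<beta> \<ge> - 1 / 2"
  shows "(\<forall>p w. 1 < p \<and> w \<in> Ap_class p \<longrightarrow>
            (\<exists>C::real. C > 0 \<and> (\<forall>f\<in>lp_space p w.
               (\<forall>t>0. \<forall>n. summable (\<lambda>m. f m * complex_of_real (heat_kernel \<alpha> \<beta> t m n))) \<and>
               lp_norm p w (heat_maximal \<alpha> \<beta> f)
                 \<le> ennreal C * lp_norm p w (\<lambda>m. ennreal (norm (f m))))))
       \<and> (\<forall>w. w \<in> A1_class \<longrightarrow>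
            (\<exists>C::real. C > 0 \<and> (\<forall>f\<in>lp_space 1 w.
               (\<forall>t>0. \<forall>n. summable (\<lambda>m. f m * complex_of_real (heat_kernel \<alpha> \<beta> t m n))) \<and>
               weak_l1_norm w (heat_maximal \<alpha> \<beta> f)
                 \<le> ennreal C * lp_norm 1 w (\<lambda>m. ennreal (norm (f m))))))"
proof -
  interpret jacobi_parameters \<alpha> \<beta> using assms by unfold_locales
  obtain D where D: "0 < D" "\<forall>t>0. \<exists>\<rho>. 0 \<le> \<rho> \<and> \<rho> < 1 \<and>
    (\<forall>m n. \<bar>heat_kernel \<alpha> \<beta> t m n\<bar> \<le> D * (1 - \<rho>) * \<rho> ^ (if m \<le> n then n - m else m - n))"
    using heat_kernel_geometric_bound by (elim exE conjE)
  interpret dominated_heat_kernel \<alpha> \<beta> D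
    by (rule dominated_heat_kernel.intro[OF D(1) D(2)[rule_format]])
  show ?thesis
    by (intro conjI allI impI maximal_strong_type maximal_weak_type) blast+
qed

end
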